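(* Let $\Omega\subset\mathbb{R}^p$ be open, connected and bounded with smooth boundary $\partial\Omega$, let $n,q\ge1$, $L\in\mathcal{G}_\tau((\bar\Omega\times\mathbb{R}^q)^{(n)})$, $u_0\in\mathcal{G}(\partial\Omega)^q$, and $$\mathcal{L}(u)=\int_\Omega L(x,u^{(n)}(x))\,dx\quad(u\in\mathcal{G}(\bar\Omega)^q),$$ $$\mathcal{A}=\{w\in\mathcal{G}(\bar\Omega)^q: w|_{\partial\Omega}=u_0\},\qquad \mathcal{A}_0=\{w\in\mathcal{G}(\bar\Omega)^q: w|_{\partial\Omega}=0\}.$$ Let $u\in\mathcal{A}$ and suppose that (i) $\delta\mathcal{L}(u;v)=0$ in $\tilde{\mathbb{R}}$ for all $v\in\mathcal{A}_0$; (ii) $\delta^2\mathcal{L}(w;v)\ge0$ in $\tilde{\mathbb{R}}$ for all $w\in\mathcal{A}$ and $v\in\mathcal{A}_0$. Then $u$ is a minimizer for $\mathcal{L}$, i.e. $\mathcal{L}(u)\le\mathcal{L}(w)$ in $\tilde{\mathbb{R}}$ for all $w\in\mathcal{A}$. If, in addition, $s\mapsto\delta^2\mathcal{L}(u+sv;v)\ne0$ in $\mathcal{G}([0,1])$ for all $v\in\mathcal{A}_0$ with $v\neq0$, then the minimizer is unique.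
   Context: Colombeau algebras. For a set $D$ which is an open set $\Omega\subseteq\mathbb{R}^p$ or its closure $\bar\Omega$: $\mathcal{E}_M(D)$ is the set of nets $(u_\varepsilon)_{\varepsilon\in(0,1]}$ in $C^\infty(D)$ such that for every compact $K\subset D$ and every multi-index $\alpha$ there is $N\in\mathbb{N}$ with $\sup_K|\partial^\alpha u_\varepsilon|=O(\varepsilon^{-N})$ as $\varepsilon\to0$; $\mathcal{N}(D)$ is the set of nets such that for all $K,\alpha$ and all $m\in\mathbb{N}$, $\sup_K|\partial^\alpha u_\varepsilon|=O(\varepsilon^m)$. $\mathcal{G}(D)=\mathcal{E}_M(D)/\mathcal{N}(D)$, with componentwise operations; in particular $\mathcal{G}([0,1])$ is defined. ($C^\infty(\bar\Omega)$: functions smooth in $\Omega$ all of whose derivatives extend continuously to $\bar\Omega$.) $\mathcal{G}(\partial\Omega)$ is defined analogously on the manifold $\partial\Omega$ (estimates in charts), and restriction to $\partial\Omega$ is componentwise. $\tilde{\mathbb{R}}$ is the ring of nets of reals with $|x_\varepsilon|=O(\varepsilon^{-N})$ for some $N$, modulo nets with $|x_\varepsilon|=O(\varepsilon^m)$ for all $m$. $\tilde x\ge0$ means that $\tilde x$ has a representative with all $x_\varepsilon\ge0$; $\tilde x\le\tilde y$ means $\tilde y-\tilde x\ge0$. Jets. $(\bar\Omega\times\mathbb{R}^q)^{(n)}=\bar\Omega\times\mathbb{R}^d$ is the $n$-jet space; $u^{(n)}(x)$ is the collection of the values at $x$ of $u$ and all its partial derivatives up to order $n$. Tempered algebra. $\mathcal{G}_\tau((\bar\Omega\times\mathbb{R}^q)^{(n)})$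 is the quotient of nets of smooth functions $L_\varepsilon$ on the jet space such that for each multi-index $\beta$ there is $N$ with $\sup_{z}(1+|z|)^{-N}|\partial^\beta L_\varepsilon(z)|=O(\varepsilon^{-N})$, modulo nets such that for each $\beta$ there is $l$ such that for all $m$, $\sup_z(1+|z|)^{-l}|\partial^\beta L_\varepsilon(z)|=O(\varepsilon^m)$. Then $L(x,u^{(n)}(x)):=[(L_\varepsilon(x,u_\varepsilon^{(n)}(x)))_\varepsilon]\in\mathcal{G}(\bar\Omega)$ is well-defined for $u\in\mathcal{G}(\bar\Omega)^q$; integrals are defined componentwise on representatives. Variations. For $u\in\mathcal{A}$, $v\in\mathcal{A}_0$ the map $s\mapsto\mathcal{L}(u+sv)$ is an element of $\mathcal{G}(\mathbb{R})$, and $$\delta\mathcal{L}(u;v)=\frac{d}{ds}\Big|_{s=0}\mathcal{L}(u+sv),\qquad \delta^2\mathcal{L}(u;v)=\frac{d^2}{ds^2}\Big|_{s=0}\mathcal{L}(u+sv)$$ in $\tilde{\mathbb{R}}$. *)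

theory Defs
  imports "HOL-Analysis.Analysis"
begin

section \<open>Partial derivatives and smooth functions\<close>

definition partial :: "'a::euclidean_space \<Rightarrow> ('a \<Rightarrow> real) \<Rightarrow> 'a \<Rightarrow> real" where
  "partial b f x = deriv (\<lambda>t. f (x + t *\<^sub>R b)) 0"

text \<open>A multi-index on a Euclidean space is a function \<open>\<alpha>\<close> of which only the values on \<open>Basis\<close>
  are used. The order in which the basis directions are taken is irrelevant for smooth functions,
  so an arbitrary enumeration of \<open>Basis\<close> is fixed.\<close>

definition mpartial :: "('a::euclidean_space \<Rightarrow> nat) \<Rightarrow> ('a \<Rightarrow> real) \<Rightarrow> 'a \<Rightarrow> real" where
  "mpartial \<alpha> f = foldr (\<lambda>b g. (partial b ^^ \<alpha> b) g) (SOME bs. distinct bs \<and> set bs = Basis) f"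

fun Ck :: "nat \<Rightarrow> 'a::euclidean_space set \<Rightarrow> ('a \<Rightarrow> real) \<Rightarrow> bool" where
  "Ck 0 \<Omega> f \<longleftrightarrow> continuous_on \<Omega> f"
| "Ck (Suc k) \<Omega> f \<longleftrightarrow> f differentiable_on \<Omega> \<and> (\<forall>b\<in>Basis. Ck k \<Omega> (partial b f))"

definition smooth :: "'a::euclidean_space set \<Rightarrow> ('a \<Rightarrow> real) \<Rightarrow> bool" where
  "smooth \<Omega> f \<longleftrightarrow> (\<forall>k. Ck k \<Omega> f)"

definition smooth_map :: "'a::euclidean_space set \<Rightarrow> ('a \<Rightarrow> 'b::euclidean_space) \<Rightarrow> bool" where
  "smooth_map \<Omega> F \<longleftrightarrow> (\<forall>b\<in>Basis. smooth \<Omega> (\<lambda>x. F x \<bullet> b))"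

text \<open>Throughout, a domain is given by a pair \<open>\<Omega>, D\<close> with \<open>\<Omega>\<close> open and \<open>D = \<Omega>\<close> or
  \<open>D = closure \<Omega>\<close>. Functions on \<open>D\<close> are total functions whose values outside \<open>D\<close> are irrelevant.
  \<open>Cinf \<Omega> D\<close> is the space of smooth functions on \<open>D\<close>: smooth in \<open>\<Omega>\<close>, with all derivatives
  (of order 0 included, where the extension is the function itself) extending continuously to \<open>D\<close>.\<close>

definition Cinf :: "'a::euclidean_space set \<Rightarrow> 'a set \<Rightarrow> ('a \<Rightarrow> real) set" where
  "Cinf \<Omega> D = {f. smooth \<Omega> f \<and> continuous_on D f \<and>
      (\<forall>\<alpha>. \<exists>g. continuous_on D g \<and> (\<forall>x\<in>\<Omega>. g x = mpartial \<alpha> f x))}"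

text \<open>The derivative on the closure: its value at a boundary point is the continuous extension.\<close>

definition ext_partial :: "'a::euclidean_space set \<Rightarrow> ('a \<Rightarrow> nat) \<Rightarrow> ('a \<Rightarrow> real) \<Rightarrow> 'a \<Rightarrow> real" where
  "ext_partial \<Omega> \<alpha> f x =
     (if x \<in> \<Omega> then mpartial \<alpha> f x else Lim (at x within \<Omega>) (mpartial \<alpha> f))"


section \<open>Quotients of nets\<close>

text \<open>Nets are functions of \<open>\<epsilon> :: real\<close>; only the values for \<open>\<epsilon> \<in> {0<..1}\<close> matter.
  \<open>bigO_on K f g\<close> says \<open>sup\<^sub>K |f\<^sub>\<epsilon>| = O(g\<^sub>\<epsilon>)\<close> as \<open>\<epsilon> \<rightarrow> 0\<close>; it is spelled out pointwise since
  \<open>Sup\<close> on the reals is unspecified for empty and for unbounded sets.\<close>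

definition bigO_on :: "'a set \<Rightarrow> (real \<Rightarrow> 'a \<Rightarrow> real) \<Rightarrow> (real \<Rightarrow> real) \<Rightarrow> bool" where
  "bigO_on K f g \<longleftrightarrow> (\<exists>C. eventually (\<lambda>\<epsilon>. \<forall>x\<in>K. \<bar>f \<epsilon> x\<bar> \<le> C * g \<epsilon>) (at_right 0))"

definition net_rel :: "'a::minus set \<Rightarrow> 'a set \<Rightarrow> ('a \<times> 'a) set" where
  "net_rel M N = {(u, v). u \<in> M \<and> v \<in> M \<and> u - v \<in> N}"

definition net_class :: "'a::minus set \<Rightarrow> 'a set \<Rightarrow> 'a \<Rightarrow> 'a set" where
  "net_class M N u = net_rel M N `` {u}"

text \<open>Operations on classes are componentwise, carried out on a chosen representative; the
  choice is immaterial since the operations are well defined on the quotients.\<close>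

definition rep :: "'a set \<Rightarrow> 'a" where
  "rep U = (SOME u. u \<in> U)"


section \<open>The Colombeau algebras on \<open>D\<close>\<close>

definition moderate :: "'a::euclidean_space set \<Rightarrow> 'a set \<Rightarrow> (real \<Rightarrow> 'a \<Rightarrow> real) set" where
  "moderate \<Omega> D = {u. (\<forall>\<epsilon>\<in>{0<..1}. u \<epsilon> \<in> Cinf \<Omega> D) \<and>
     (\<forall>K \<alpha>. compact K \<and> K \<subseteq> D \<longrightarrow>
        (\<exists>N::nat. bigO_on K (\<lambda>\<epsilon>. ext_partial \<Omega> \<alpha> (u \<epsilon>)) (\<lambda>\<epsilon>. (1 / \<epsilon>) ^ N)))}"

definition negligible_nets :: "'a::euclidean_space set \<Rightarrow> 'a set \<Rightarrow> (real \<Rightarrow> 'a \<Rightarrow> real) set" where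
  "negligible_nets \<Omega> D = {u. (\<forall>\<epsilon>\<in>{0<..1}. u \<epsilon> \<in> Cinf \<Omega> D) \<and>
     (\<forall>K \<alpha>. compact K \<and> K \<subseteq> D \<longrightarrow>
        (\<forall>m::nat. bigO_on K (\<lambda>\<epsilon>. ext_partial \<Omega> \<alpha> (u \<epsilon>)) (\<lambda>\<epsilon>. \<epsilon> ^ m)))}"

definition gen_class ::
    "'a::euclidean_space set \<Rightarrow> 'a set \<Rightarrow> (real \<Rightarrow> 'a \<Rightarrow> real) \<Rightarrow> (real \<Rightarrow> 'a \<Rightarrow> real) set" where
  "gen_class \<Omega> D = net_class (moderate \<Omega> D) (negligible_nets \<Omega> D)"

definition gen :: "'a::euclidean_space set \<Rightarrow> 'a set \<Rightarrow> (real \<Rightarrow> 'a \<Rightarrow> real) set set" where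
  "gen \<Omega> D = moderate \<Omega> D // net_rel (moderate \<Omega> D) (negligible_nets \<Omega> D)"

definition gen_zero :: "'a::euclidean_space set \<Rightarrow> 'a set \<Rightarrow> (real \<Rightarrow> 'a \<Rightarrow> real) set" where
  "gen_zero \<Omega> D = gen_class \<Omega> D (\<lambda>\<epsilon> x. 0)"


section \<open>Generalized real numbers\<close>

definition rt_moderate :: "(real \<Rightarrow> real) set" where
  "rt_moderate = {x. \<exists>N::nat. x \<in> O[at_right 0](\<lambda>\<epsilon>. (1 / \<epsilon>) ^ N)}"

definition rt_negligible :: "(real \<Rightarrow> real) set" where
  "rt_negligible = {x. \<forall>m::nat. x \<in> O[at_right 0](\<lambda>\<epsilon>. \<epsilon> ^ m)}"

definition rt_class :: "(real \<Rightarrow> real) \<Rightarrow> (real \<Rightarrow> real) set" where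
  "rt_class = net_class rt_moderate rt_negligible"

definition rt_zero :: "(real \<Rightarrow> real) set" where
  "rt_zero = rt_class (\<lambda>\<epsilon>. 0)"

definition rt_nonneg :: "(real \<Rightarrow> real) set \<Rightarrow> bool" where
  "rt_nonneg X \<longleftrightarrow> (\<exists>x\<in>X. \<forall>\<epsilon>\<in>{0<..1}. x \<epsilon> \<ge> 0)"

definition rt_le :: "(real \<Rightarrow> real) set \<Rightarrow> (real \<Rightarrow> real) set \<Rightarrow> bool" where
  "rt_le X Y \<longleftrightarrow> rt_nonneg (rt_class (\<lambda>\<epsilon>. rep Y \<epsilon> - rep X \<epsilon>))"


section \<open>Smooth boundary and the Colombeau algebra on the boundary\<close>

text \<open>A chart of \<open>\<Omega>\<close> near a boundary point: a diffeomorphism \<open>\<Phi>\<close> with inverse \<open>\<Psi>\<close>, mapping the open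
  set \<open>U\<close> onto an open set so that \<open>\<Omega>\<close> becomes \<open>{y. y \<bullet> b > 0}\<close> and its boundary
  \<open>{y. y \<bullet> b = 0}\<close>.\<close>

definition boundary_chart ::
    "'a::euclidean_space set \<Rightarrow> 'a set \<Rightarrow> ('a \<Rightarrow> 'a) \<Rightarrow> ('a \<Rightarrow> 'a) \<Rightarrow> 'a \<Rightarrow> bool" where
  "boundary_chart \<Omega> U \<Phi> \<Psi> b \<longleftrightarrow>
     b \<in> Basis \<and> open U \<and> open (\<Phi> ` U) \<and> smooth_map U \<Phi> \<and> smooth_map (\<Phi> ` U) \<Psi> \<and>
     (\<forall>x\<in>U. \<Psi> (\<Phi> x) = x) \<and>
     \<Phi> ` (U \<inter> \<Omega>) = {y \<in> \<Phi> ` U. y \<bullet> b > 0} \<and>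
     \<Phi> ` (U \<inter> frontier \<Omega>) = {y \<in> \<Phi> ` U. y \<bullet> b = 0}"

definition smooth_boundary :: "'a::euclidean_space set \<Rightarrow> bool" where
  "smooth_boundary \<Omega> \<longleftrightarrow> (\<forall>x\<in>frontier \<Omega>. \<exists>U \<Phi> \<Psi> b. x \<in> U \<and> boundary_chart \<Omega> U \<Phi> \<Psi> b)"

text \<open>The restriction of \<open>\<Phi>\<close> to \<open>U \<inter> frontier \<Omega>\<close> is a chart of the boundary manifold, with
  values in the hyperplane \<open>H = {y. y \<bullet> b = 0}\<close>. There is no type for \<open>H\<close>, so the local
  expression of a function in this chart, which lives on \<open>\<Phi> ` U \<inter> H\<close>, is made constant in
  direction \<open>b\<close> and thus becomes a function on the open cylinder over \<open>\<Phi> ` U \<inter> H\<close>. It is smooth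
  there iff the local expression is, its derivatives involving \<open>b\<close> vanish, its other derivatives
  are those of the local expression, and compact sets project to compact sets. Only values on
  \<open>frontier \<Omega>\<close> enter.\<close>

definition cylinder :: "'a::euclidean_space set \<Rightarrow> ('a \<Rightarrow> 'a) \<Rightarrow> 'a \<Rightarrow> 'a set" where
  "cylinder U \<Phi> b = {y. y - (y \<bullet> b) *\<^sub>R b \<in> \<Phi> ` U}"

definition chart_expr ::
    "('a::euclidean_space \<Rightarrow> 'a) \<Rightarrow> 'a \<Rightarrow> (real \<Rightarrow> 'a \<Rightarrow> real) \<Rightarrow> real \<Rightarrow> 'a \<Rightarrow> real" where
  "chart_expr \<Psi> b u \<epsilon> y = u \<epsilon> (\<Psi> (y - (y \<bullet> b) *\<^sub>R b))"

definition bd_moderate :: "'a::euclidean_space set \<Rightarrow> (real \<Rightarrow> 'a \<Rightarrow> real) set" where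
  "bd_moderate \<Omega> = {u. \<forall>U \<Phi> \<Psi> b. boundary_chart \<Omega> U \<Phi> \<Psi> b \<longrightarrow>
     chart_expr \<Psi> b u \<in> moderate (cylinder U \<Phi> b) (cylinder U \<Phi> b)}"

definition bd_negligible :: "'a::euclidean_space set \<Rightarrow> (real \<Rightarrow> 'a \<Rightarrow> real) set" where
  "bd_negligible \<Omega> = {u. \<forall>U \<Phi> \<Psi> b. boundary_chart \<Omega> U \<Phi> \<Psi> b \<longrightarrow>
     chart_expr \<Psi> b u \<in> negligible_nets (cylinder U \<Phi> b) (cylinder U \<Phi> b)}"

definition gen_bd :: "'a::euclidean_space set \<Rightarrow> (real \<Rightarrow> 'a \<Rightarrow> real) set set" where
  "gen_bd \<Omega> = bd_moderate \<Omega> // net_rel (bd_moderate \<Omega>) (bd_negligible \<Omega>)"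

definition bd_class ::
    "'a::euclidean_space set \<Rightarrow> (real \<Rightarrow> 'a \<Rightarrow> real) \<Rightarrow> (real \<Rightarrow> 'a \<Rightarrow> real) set" where
  "bd_class \<Omega> = net_class (bd_moderate \<Omega>) (bd_negligible \<Omega>)"

definition gen_bd_zero :: "'a::euclidean_space set \<Rightarrow> (real \<Rightarrow> 'a \<Rightarrow> real) set" where
  "gen_bd_zero \<Omega> = bd_class \<Omega> (\<lambda>\<epsilon> x. 0)"

text \<open>The relation \<open>W|\<^bsub>frontier \<Omega>\<^esub> = U\<^sub>0\<close> for \<open>W\<close> in \<open>gen \<Omega> (closure \<Omega>)\<close> and \<open>U\<^sub>0\<close> in \<open>gen_bd \<Omega>\<close>:
  the class of the restriction of a representative \<open>w\<close> of \<open>W\<close> is \<open>U\<^sub>0\<close>. Nets on \<open>frontier \<Omega>\<close> are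
  total functions whose other values are irrelevant, so the restriction of \<open>w\<close> is \<open>w\<close> itself. Since
  restriction is well defined on classes, it does not matter which representative is taken.\<close>

definition restricts_to :: "'a::euclidean_space set
    \<Rightarrow> (real \<Rightarrow> 'a \<Rightarrow> real) set \<Rightarrow> (real \<Rightarrow> 'a \<Rightarrow> real) set \<Rightarrow> bool" where
  "restricts_to \<Omega> W U\<^sub>0 \<longleftrightarrow> (\<exists>w\<in>W. bd_class \<Omega> w = U\<^sub>0)"


section \<open>Jets and tempered generalized functions\<close>

text \<open>The order of the jets is \<open>n = CARD('n) \<ge> 1\<close>. The \<open>n\<close>-jet space over \<open>closure \<Omega>\<close> is
  \<open>closure \<Omega> \<times> \<real>\<^sup>d\<close>, where the coordinates of \<open>\<real>\<^sup>d\<close> are indexed by a component in \<open>'q\<close> and a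
  multi-index of order at most \<open>n\<close> in the variables \<open>'p\<close>.\<close>

typedef ('p::finite, 'n::finite) jet_index = "{\<alpha> :: 'p \<Rightarrow> nat. (\<Sum>i\<in>UNIV. \<alpha> i) \<le> CARD('n)}"
  by (intro exI[of _ "\<lambda>_. 0"]) simp

instance jet_index :: (finite, finite) finite
proof
  let ?A = "{\<alpha> :: 'a \<Rightarrow> nat. (\<Sum>i\<in>UNIV. \<alpha> i) \<le> CARD('b)}"
  have "\<alpha> i \<le> CARD('b)" if "\<alpha> \<in> ?A" for \<alpha> i
    using that member_le_sum[of i UNIV \<alpha>] by simp
  then have "?A \<subseteq> Pi\<^sub>E UNIV (\<lambda>_. {..CARD('b)})"
    by (auto simp: PiE_iff)
  moreover have "finite (Pi\<^sub>E (UNIV :: 'a set) (\<lambda>_. {..CARD('b)}))"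
    by (intro finite_PiE) auto
  ultimately have "finite ?A"
    by (rule finite_subset)
  then have "finite (Abs_jet_index ` ?A :: ('a, 'b) jet_index set)"
    by (rule finite_imageI)
  then show "finite (UNIV :: ('a, 'b) jet_index set)"
    using type_definition.Abs_image[OF type_definition_jet_index[where 'p='a and 'n='b]] by simp
qed

type_synonym ('p, 'q, 'n) jet_space = "(real ^ 'p) \<times> (real ^ ('q \<times> ('p, 'n) jet_index))"

text \<open>The fibre part of \<open>u\<^sup>(\<^sup>n\<^sup>)(x)\<close>.\<close>

definition jet :: "(real ^ 'p) set \<Rightarrow> ('q \<Rightarrow> real ^ 'p \<Rightarrow> real) \<Rightarrow> real ^ 'p
    \<Rightarrow> real ^ ('q::finite \<times> ('p::finite, 'n::finite) jet_index)" where
  "jet \<Omega> u x =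
     (\<chi> k. ext_partial \<Omega> (\<lambda>b. Rep_jet_index (snd k) (axis_index b)) (u (fst k)) x)"

definition temp_moderate ::
    "(real ^ 'p) set \<Rightarrow> (real \<Rightarrow> ('p::finite, 'q::finite, 'n::finite) jet_space \<Rightarrow> real) set" where
  "temp_moderate \<Omega> = {l. (\<forall>\<epsilon>\<in>{0<..1}. l \<epsilon> \<in> Cinf (\<Omega> \<times> UNIV) (closure \<Omega> \<times> UNIV)) \<and>
     (\<forall>\<beta>. \<exists>N::nat. bigO_on (closure \<Omega> \<times> UNIV)
        (\<lambda>\<epsilon> z. ext_partial (\<Omega> \<times> UNIV) \<beta> (l \<epsilon>) z / (1 + norm z) ^ N) (\<lambda>\<epsilon>. (1 / \<epsilon>) ^ N))}"

definition temp_negligible ::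
    "(real ^ 'p) set \<Rightarrow> (real \<Rightarrow> ('p::finite, 'q::finite, 'n::finite) jet_space \<Rightarrow> real) set" where
  "temp_negligible \<Omega> = {l. (\<forall>\<epsilon>\<in>{0<..1}. l \<epsilon> \<in> Cinf (\<Omega> \<times> UNIV) (closure \<Omega> \<times> UNIV)) \<and>
     (\<forall>\<beta>. \<exists>k::nat. \<forall>m::nat. bigO_on (closure \<Omega> \<times> UNIV)
        (\<lambda>\<epsilon> z. ext_partial (\<Omega> \<times> UNIV) \<beta> (l \<epsilon>) z / (1 + norm z) ^ k) (\<lambda>\<epsilon>. \<epsilon> ^ m))}"

definition gen_temp ::
    "(real ^ 'p) set \<Rightarrow> (real \<Rightarrow> ('p::finite, 'q::finite, 'n::finite) jet_space \<Rightarrow> real) set set" where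
  "gen_temp \<Omega> = temp_moderate \<Omega> // net_rel (temp_moderate \<Omega>) (temp_negligible \<Omega>)"


section \<open>The functional and its variations\<close>

definition classical_functional :: "(real ^ 'p) set
    \<Rightarrow> (('p::finite, 'q::finite, 'n::finite) jet_space \<Rightarrow> real)
    \<Rightarrow> ('q \<Rightarrow> real ^ 'p \<Rightarrow> real) \<Rightarrow> real" where
  "classical_functional \<Omega> l u = (LINT x:\<Omega>|lborel. l (x, jet \<Omega> u x))"

definition gen_functional :: "(real ^ 'p) set
    \<Rightarrow> (real \<Rightarrow> ('p::finite, 'q::finite, 'n::finite) jet_space \<Rightarrow> real) set
    \<Rightarrow> ('q \<Rightarrow> (real \<Rightarrow> real ^ 'p \<Rightarrow> real) set) \<Rightarrow> (real \<Rightarrow> real) set" where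
  "gen_functional \<Omega> L u =
     rt_class (\<lambda>\<epsilon>. classical_functional \<Omega> (rep L \<epsilon>) (\<lambda>i. rep (u i) \<epsilon>))"

text \<open>The element \<open>s \<mapsto> \<L>(u + s v)\<close> of the Colombeau algebra on the real line.\<close>

definition functional_line :: "(real ^ 'p) set
    \<Rightarrow> (real \<Rightarrow> ('p::finite, 'q::finite, 'n::finite) jet_space \<Rightarrow> real) set
    \<Rightarrow> ('q \<Rightarrow> (real \<Rightarrow> real ^ 'p \<Rightarrow> real) set) \<Rightarrow> ('q \<Rightarrow> (real \<Rightarrow> real ^ 'p \<Rightarrow> real) set)
    \<Rightarrow> (real \<Rightarrow> real \<Rightarrow> real) set" where
  "functional_line \<Omega> L u v = gen_class UNIV UNIV
     (\<lambda>\<epsilon> s. classical_functional \<Omega> (rep L \<epsilon>) (\<lambda>i x. rep (u i) \<epsilon> x + s * rep (v i) \<epsilon> x))"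

definition gen_deriv :: "(real \<Rightarrow> real \<Rightarrow> real) set \<Rightarrow> (real \<Rightarrow> real \<Rightarrow> real) set" where
  "gen_deriv F = gen_class UNIV UNIV (\<lambda>\<epsilon>. deriv (rep F \<epsilon>))"

definition gen_at :: "(real \<Rightarrow> real \<Rightarrow> real) set \<Rightarrow> real \<Rightarrow> (real \<Rightarrow> real) set" where
  "gen_at F a = rt_class (\<lambda>\<epsilon>. rep F \<epsilon> a)"

definition first_variation :: "(real ^ 'p) set
    \<Rightarrow> (real \<Rightarrow> ('p::finite, 'q::finite, 'n::finite) jet_space \<Rightarrow> real) set
    \<Rightarrow> ('q \<Rightarrow> (real \<Rightarrow> real ^ 'p \<Rightarrow> real) set) \<Rightarrow> ('q \<Rightarrow> (real \<Rightarrow> real ^ 'p \<Rightarrow> real) set)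
    \<Rightarrow> (real \<Rightarrow> real) set" where
  "first_variation \<Omega> L u v = gen_at (gen_deriv (functional_line \<Omega> L u v)) 0"

definition second_variation :: "(real ^ 'p) set
    \<Rightarrow> (real \<Rightarrow> ('p::finite, 'q::finite, 'n::finite) jet_space \<Rightarrow> real) set
    \<Rightarrow> ('q \<Rightarrow> (real \<Rightarrow> real ^ 'p \<Rightarrow> real) set) \<Rightarrow> ('q \<Rightarrow> (real \<Rightarrow> real ^ 'p \<Rightarrow> real) set)
    \<Rightarrow> (real \<Rightarrow> real) set" where
  "second_variation \<Omega> L u v = gen_at (gen_deriv (gen_deriv (functional_line \<Omega> L u v))) 0"

text \<open>The element \<open>s \<mapsto> \<delta>\<^sup>2\<L>(u + s v; v)\<close> of the Colombeau algebra on \<open>[0,1]\<close>, componentwise.\<close>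

definition second_variation_line :: "(real ^ 'p) set
    \<Rightarrow> (real \<Rightarrow> ('p::finite, 'q::finite, 'n::finite) jet_space \<Rightarrow> real) set
    \<Rightarrow> ('q \<Rightarrow> (real \<Rightarrow> real ^ 'p \<Rightarrow> real) set) \<Rightarrow> ('q \<Rightarrow> (real \<Rightarrow> real ^ 'p \<Rightarrow> real) set)
    \<Rightarrow> (real \<Rightarrow> real \<Rightarrow> real) set" where
  "second_variation_line \<Omega> L u v = gen_class {0<..<1} {0..1}
     (\<lambda>\<epsilon> s. deriv (deriv (\<lambda>\<sigma>. classical_functional \<Omega> (rep L \<epsilon>)
        (\<lambda>i x. (rep (u i) \<epsilon> x + s * rep (v i) \<epsilon> x) + \<sigma> * rep (v i) \<epsilon> x))) 0)"

definition admissible :: "(real ^ 'p) set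
    \<Rightarrow> ('q \<Rightarrow> (real \<Rightarrow> real ^ 'p \<Rightarrow> real) set)
    \<Rightarrow> ('q \<Rightarrow> (real \<Rightarrow> real ^ 'p \<Rightarrow> real) set) set" where
  "admissible \<Omega> u\<^sub>0 = {w. \<forall>i. w i \<in> gen \<Omega> (closure \<Omega>) \<and> restricts_to \<Omega> (w i) (u\<^sub>0 i)}"

definition admissible_zero :: "(real ^ 'p) set
    \<Rightarrow> ('q \<Rightarrow> (real \<Rightarrow> real ^ 'p \<Rightarrow> real) set) set" where
  "admissible_zero \<Omega> = admissible \<Omega> (\<lambda>i. gen_bd_zero \<Omega>)"

definition is_minimizer :: "(real ^ 'p) set
    \<Rightarrow> (real \<Rightarrow> ('p::finite, 'q::finite, 'n::finite) jet_space \<Rightarrow> real) set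
    \<Rightarrow> ('q \<Rightarrow> (real \<Rightarrow> real ^ 'p \<Rightarrow> real) set)
    \<Rightarrow> ('q \<Rightarrow> (real \<Rightarrow> real ^ 'p \<Rightarrow> real) set) \<Rightarrow> bool" where
  "is_minimizer \<Omega> L u\<^sub>0 u \<longleftrightarrow> u \<in> admissible \<Omega> u\<^sub>0 \<and>
     (\<forall>w\<in>admissible \<Omega> u\<^sub>0. rt_le (gen_functional \<Omega> L u) (gen_functional \<Omega> L w))"

end

theory Submission
  imports Defs "HOL-Library.Multiset"
begin

text \<open>The statement is reduced to nets of smooth functions of one real variable. For \<open>u\<close> admissible
  and \<open>v\<close> with zero boundary values let
  \<open>f\<^sub>\<epsilon>(s) = \<integral> L\<^sub>\<epsilon>(x, (u\<^sub>\<epsilon> + s v\<^sub>\<epsilon>)\<^sup>(\<^sup>n\<^sup>)(x)) dx\<close>.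
  Suppose that \<open>f\<^sub>\<epsilon>'' \<ge> - n\<^sub>\<epsilon>\<close> on \<open>[0,1]\<close> for a negligible net \<open>n\<^sub>\<epsilon>\<close>. Then
  \<open>h\<^sub>\<epsilon>(s) = f\<^sub>\<epsilon>(s) - f\<^sub>\<epsilon>(0) - f\<^sub>\<epsilon>'(0) s + n\<^sub>\<epsilon> s\<^sup>2 / 2\<close>
  is convex on \<open>[0,1]\<close> with \<open>h\<^sub>\<epsilon>(0) = h\<^sub>\<epsilon>'(0) = 0\<close>, hence nonnegative and increasing there
  (\<open>almost_convex_taylor\<close>). Since \<open>f\<^sub>\<epsilon>'(0)\<close> is negligible by the vanishing of the first variation,
  \<open>f\<^sub>\<epsilon>(1) - f\<^sub>\<epsilon>(0)\<close> is bounded below by a negligible net, which is the minimizing property.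

  The bound for \<open>f\<^sub>\<epsilon>''\<close> has to be uniform in \<open>s\<close>, while nonnegativity of the second variation at
  \<open>u + s v\<close> for a real number \<open>s\<close> only gives a negligible error that depends on \<open>s\<close>. Therefore the
  hypothesis is used at a generalized point: \<open>s\<^sub>\<epsilon>\<close> is a point of \<open>[0,1]\<close> at which \<open>f\<^sub>\<epsilon>''\<close> is minimal,
  and the class of \<open>u\<^sub>\<epsilon> + s\<^sub>\<epsilon> v\<^sub>\<epsilon>\<close> is again admissible (\<open>admissible_add_scaled\<close>,
  \<open>second_variation_lower_bound\<close>).

  If \<open>w = u + v\<close> is a second minimizer, then \<open>h\<^sub>\<epsilon>(1)\<close> is negligible, so by monotonicity \<open>h\<^sub>\<epsilon>\<close> is
  negligible uniformly on \<open>[0,1]\<close>. As all its derivatives are moderate, Landau's inequality makes them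
  negligible as well (\<open>negligible_on_all_derivatives\<close>). From \<open>h\<^sub>\<epsilon>'' = f\<^sub>\<epsilon>'' + n\<^sub>\<epsilon>\<close> it follows that
  \<open>s \<mapsto> \<delta>\<^sup>2\<L>(u + s v; v)\<close> vanishes in the algebra on \<open>[0,1]\<close>, so that strictness forces \<open>v = 0\<close>.

  The rest of the work shows that these classes are what they should be. The \<open>k\<close>-th derivative of
  \<open>f\<^sub>\<epsilon>\<close> is the integral of the \<open>k\<close>-th directional derivative of \<open>L\<^sub>\<epsilon>\<close> along the jet of \<open>v\<^sub>\<epsilon>\<close>
  (\<open>variation_has_derivative\<close>); it is moderate because \<open>L\<^sub>\<epsilon>\<close> is tempered and jets are moderate on
  the compact closure of \<open>\<Omega>\<close> (\<open>variation_line_moderate\<close>), and it changes by a negligible amount with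
  the representative of \<open>u\<close> (\<open>variation_negligible\<close>). Temperedness is an estimate of the
  multi-index derivatives, in which the coordinate directions are taken in a fixed order; by the
  symmetry of second derivatives (\<open>partial_commute\<close>) it controls the iterated directional derivatives.\<close>

section \<open>Equality of mixed partial derivatives\<close>

lemma partial_cong:
  assumes "open S" "x \<in> S" "\<And>y. y \<in> S \<Longrightarrow> f y = g y"
  shows "partial b f x = partial b g x"
  unfolding partial_def
proof (rule deriv_cong_ev)
  have "((\<lambda>t. x + t *\<^sub>R b) \<longlongrightarrow> x + 0 *\<^sub>R b) (nhds 0)"
    by (intro tendsto_intros filterlim_ident)
  then have "\<forall>\<^sub>F t in nhds 0. x + t *\<^sub>R b \<in> S"
    using assms(1,2) by (simp add: tendsto_def)
  then show "\<forall>\<^sub>F t in nhds 0. f (x + t *\<^sub>R b) = g (x + t *\<^sub>R b)"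
    by eventually_elim (use assms(3) in auto)
qed simp

lemma has_derivative_imp_partial:
  assumes "(f has_derivative f') (at x)"
  shows "partial b f x = f' b"
proof -
  have "((\<lambda>t. f (x + t *\<^sub>R b)) has_derivative (\<lambda>t. f' (t *\<^sub>R b))) (at 0)"
    by (rule has_derivative_compose[of "\<lambda>t. x + t *\<^sub>R b" "\<lambda>t. t *\<^sub>R b" 0 UNIV f f'])
       (use assms in \<open>auto intro!: derivative_eq_intros\<close>)
  moreover have "(\<lambda>t. f' (t *\<^sub>R b)) = (*) (f' b)"
    using linear_cmul[OF has_derivative_linear[OF assms]] by (auto simp: mult.commute)
  ultimately show ?thesis
    unfolding partial_def by (intro DERIV_imp_deriv) (simp add: has_field_derivative_def)
qed

lemma smooth_partial: "smooth S f \<Longrightarrow> b \<in> Basis \<Longrightarrow> smooth S (partial b f)"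
  unfolding smooth_def by (metis Ck.simps(2))

lemma smooth_continuous_on: "smooth S f \<Longrightarrow> continuous_on S f"
  unfolding smooth_def by (metis Ck.simps(1))

lemma smooth_has_derivative:
  assumes "smooth S f" "open S" "x \<in> S"
  shows "(f has_derivative (\<lambda>h. \<Sum>b\<in>Basis. (h \<bullet> b) * partial b f x)) (at x)"
proof -
  have "f differentiable_on S"
    using assms(1) unfolding smooth_def by (metis Ck.simps(2))
  then have "f differentiable (at x)"
    using assms(2,3) by (simp add: differentiable_on_eq_differentiable_at)
  then obtain f' where f': "(f has_derivative f') (at x)"
    unfolding differentiable_def by blast
  then interpret linear f' by (rule has_derivative_linear)
  have "f' h = (\<Sum>b\<in>Basis. (h \<bullet> b) * partial b f x)" for h
  proof -
    have "f' h = f' (\<Sum>b\<in>Basis. (h \<bullet> b) *\<^sub>R b)" by (simp add: euclidean_representation)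
    also have "\<dots> = (\<Sum>b\<in>Basis. (h \<bullet> b) * f' b)" by (simp add: sum scale)
    finally show ?thesis by (simp add: has_derivative_imp_partial[OF f'])
  qed
  then have "f' = (\<lambda>h. \<Sum>b\<in>Basis. (h \<bullet> b) * partial b f x)" by auto
  with f' show ?thesis by simp
qed

lemma smooth_line_derivative:
  assumes "smooth S f" "open S" "x + t *\<^sub>R d \<in> S"
  shows "((\<lambda>t. f (x + t *\<^sub>R d)) has_real_derivative
           (\<Sum>b\<in>Basis. (d \<bullet> b) * partial b f (x + t *\<^sub>R d))) (at t)"
proof -
  have "((\<lambda>t. f (x + t *\<^sub>R d)) has_derivative
     (\<lambda>s. \<Sum>b\<in>Basis. ((s *\<^sub>R d) \<bullet> b) * partial b f (x + t *\<^sub>R d))) (at t)"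
    by (rule has_derivative_compose[of "\<lambda>t. x + t *\<^sub>R d" "\<lambda>t. t *\<^sub>R d" t UNIV f])
       (use smooth_has_derivative[OF assms] in \<open>auto intro!: derivative_eq_intros\<close>)
  moreover have "(\<lambda>s. \<Sum>b\<in>Basis. ((s *\<^sub>R d) \<bullet> b) * partial b f (x + t *\<^sub>R d))
      = (*) (\<Sum>b\<in>Basis. (d \<bullet> b) * partial b f (x + t *\<^sub>R d))"
    by (auto simp: sum_distrib_left sum_distrib_right mult_ac)
  ultimately show ?thesis by (simp add: has_field_derivative_def)
qed

lemma smooth_basis_line_derivative:
  assumes "smooth S f" "open S" "x + t *\<^sub>R c \<in> S" "c \<in> Basis"
  shows "((\<lambda>t. f (x + t *\<^sub>R c)) has_real_derivative partial c f (x + t *\<^sub>R c)) (at t)"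
proof -
  have "(\<Sum>b\<in>Basis. (c \<bullet> b) * partial b f (x + t *\<^sub>R c))
      = (\<Sum>b\<in>Basis. if b = c then partial b f (x + t *\<^sub>R c) else 0)"
    by (rule sum.cong) (use assms(4) in \<open>auto simp: inner_Basis\<close>)
  also have "\<dots> = partial c f (x + t *\<^sub>R c)" using assms(4) by simp
  finally have eq: "(\<Sum>b\<in>Basis. (c \<bullet> b) * partial b f (x + t *\<^sub>R c)) = partial c f (x + t *\<^sub>R c)" .
  show ?thesis
    using smooth_line_derivative[OF assms(1-3)] unfolding eq .
qed

text \<open>The mean value theorem, applied in direction \<open>b\<close> and then in direction \<open>c\<close>. The left-hand side is
  symmetric in \<open>b\<close> and \<open>c\<close>, which is what gives the symmetry of second derivatives.\<close>

lemma second_difference_mvt: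
  assumes "smooth S f" "open S" "b \<in> Basis" "c \<in> Basis" "0 < h"
    and S: "\<And>s t. 0 \<le> s \<Longrightarrow> s \<le> h \<Longrightarrow> 0 \<le> t \<Longrightarrow> t \<le> h \<Longrightarrow> x + s *\<^sub>R b + t *\<^sub>R c \<in> S"
  shows "\<exists>s t. 0 < s \<and> s < h \<and> 0 < t \<and> t < h \<and>
     f (x + h *\<^sub>R b + h *\<^sub>R c) - f (x + h *\<^sub>R b) - f (x + h *\<^sub>R c) + f x
       = h * (h * partial c (partial b f) (x + s *\<^sub>R b + t *\<^sub>R c))"
proof -
  let ?\<phi> = "\<lambda>s. f (x + h *\<^sub>R c + s *\<^sub>R b) - f (x + s *\<^sub>R b)"
  have "\<exists>s>0. s < h \<and> ?\<phi> h - ?\<phi> 0 = (h - 0) *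
      (partial b f (x + h *\<^sub>R c + s *\<^sub>R b) - partial b f (x + s *\<^sub>R b))"
  proof (rule MVT2[OF assms(5)])
    fix s assume s: "0 \<le> s" "s \<le> h"
    show "(?\<phi> has_real_derivative
      (partial b f (x + h *\<^sub>R c + s *\<^sub>R b) - partial b f (x + s *\<^sub>R b))) (at s)"
      using S[OF s, of 0] S[OF s, of h] assms
      by (intro DERIV_diff smooth_basis_line_derivative[of S]) (auto simp: algebra_simps)
  qed
  then obtain s where s: "0 < s" "s < h" "?\<phi> h - ?\<phi> 0 = h *
      (partial b f (x + h *\<^sub>R c + s *\<^sub>R b) - partial b f (x + s *\<^sub>R b))" by auto
  let ?\<psi> = "\<lambda>t. partial b f (x + s *\<^sub>R b + t *\<^sub>R c)"
  have "\<exists>t>0. t < h \<and> ?\<psi> h - ?\<psi> 0 = (h - 0) * partial c (partial b f) (x + s *\<^sub>R b + t *\<^sub>R c)"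
  proof (rule MVT2[OF assms(5)])
    fix t assume t: "0 \<le> t" "t \<le> h"
    show "(?\<psi> has_real_derivative partial c (partial b f) (x + s *\<^sub>R b + t *\<^sub>R c)) (at t)"
      using S[of s t] s t assms
      by (intro smooth_basis_line_derivative[of S] smooth_partial) auto
  qed
  then obtain t where "0 < t" "t < h"
    "?\<psi> h - ?\<psi> 0 = h * partial c (partial b f) (x + s *\<^sub>R b + t *\<^sub>R c)" by auto
  with s show ?thesis by (intro exI[of _ s] exI[of _ t]) (simp add: algebra_simps)
qed

text \<open>Both orders of differentiation occur as values of the same second difference at points arbitrarily
  close to \<open>x\<close>, and both are continuous.\<close>

lemma partial_commute:
  assumes "smooth S f" "open S" "x \<in> S" "b \<in> Basis" "c \<in> Basis"
  shows "partial b (partial c f) x = partial c (partial b f) x"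
proof (rule ccontr)
  let ?F = "partial b (partial c f)" and ?G = "partial c (partial b f)"
  assume ne: "?F x \<noteq> ?G x"
  define e where "e = \<bar>?F x - ?G x\<bar> / 2"
  have e: "e > 0" using ne by (simp add: e_def)
  have near: "\<exists>r>0. \<forall>y. dist y x < r \<longrightarrow> y \<in> S \<and> \<bar>H y - H x\<bar> < e" if "smooth S H" for H
  proof -
    obtain r1 where r1: "r1 > 0" "\<And>y. dist y x < r1 \<Longrightarrow> y \<in> S"
      using assms(2,3) unfolding open_dist by blast
    have "continuous (at x) H"
      using smooth_continuous_on[OF that] assms(2,3) by (simp add: continuous_on_eq_continuous_at)
    then obtain r2 where "r2 > 0" "\<And>y. dist y x < r2 \<Longrightarrow> dist (H y) (H x) < e"
      using e unfolding continuous_at_eps_delta by blast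
    with r1 show ?thesis by (intro exI[of _ "min r1 r2"]) (auto simp: dist_real_def)
  qed
  obtain r where r: "r > 0" "\<And>y. dist y x < r \<Longrightarrow> y \<in> S \<and> \<bar>?F y - ?F x\<bar> < e"
    using near[of ?F] assms by (blast intro: smooth_partial)
  obtain r' where r': "r' > 0" "\<And>y. dist y x < r' \<Longrightarrow> \<bar>?G y - ?G x\<bar> < e"
    using near[of ?G] assms by (blast intro: smooth_partial)
  define h where "h = min r r' / 3"
  have h: "h > 0" using r r' by (simp add: h_def)
  have d: "dist (x + s *\<^sub>R b + t *\<^sub>R c) x < min r r'" if "0 \<le> s" "s \<le> h" "0 \<le> t" "t \<le> h" for s t
  proof -
    have "dist (x + s *\<^sub>R b + t *\<^sub>R c) x \<le> norm (s *\<^sub>R b) + norm (t *\<^sub>R c)"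
      by (simp add: dist_norm add.assoc norm_triangle_ineq del: norm_scaleR)
    also have "\<dots> \<le> 2 * h" using that assms by simp
    also have "\<dots> < min r r'" using r r' unfolding h_def by linarith
    finally show ?thesis .
  qed
  obtain s t where st: "0 < s" "s < h" "0 < t" "t < h"
     "f (x + h *\<^sub>R b + h *\<^sub>R c) - f (x + h *\<^sub>R b) - f (x + h *\<^sub>R c) + f x
       = h * (h * ?G (x + s *\<^sub>R b + t *\<^sub>R c))"
    using second_difference_mvt[OF assms(1,2,4,5) h, of x] d r(2) by (meson min.strict_boundedE)
  have d': "dist (x + s *\<^sub>R c + t *\<^sub>R b) x < min r r'" if "0 \<le> s" "s \<le> h" "0 \<le> t" "t \<le> h" for s t
    using d[of t s] that by (simp add: algebra_simps)
  obtain s' t' where st': "0 < s'" "s' < h" "0 < t'" "t' < h"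
     "f (x + h *\<^sub>R c + h *\<^sub>R b) - f (x + h *\<^sub>R c) - f (x + h *\<^sub>R b) + f x
       = h * (h * ?F (x + s' *\<^sub>R c + t' *\<^sub>R b))"
    using second_difference_mvt[OF assms(1,2,5,4) h, of x] d' r(2) by (meson min.strict_boundedE)
  have "?F (x + s' *\<^sub>R c + t' *\<^sub>R b) = ?G (x + s *\<^sub>R b + t *\<^sub>R c)"
    using st(5) st'(5) h by (simp add: algebra_simps)
  moreover have "\<bar>?F (x + s' *\<^sub>R c + t' *\<^sub>R b) - ?F x\<bar> < e"
    using r(2) d'[of s' t'] st' by simp
  moreover have "\<bar>?G (x + s *\<^sub>R b + t *\<^sub>R c) - ?G x\<bar> < e"
    using r'(2) d[of s t] st by simp
  ultimately have "\<bar>?F x - ?G x\<bar> < 2 * e" by linarith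
  then show False by (simp add: e_def)
qed

abbreviation partials :: "'a::euclidean_space list \<Rightarrow> ('a \<Rightarrow> real) \<Rightarrow> 'a \<Rightarrow> real" where
  "partials bs f \<equiv> foldr partial bs f"

lemma smooth_partials: "smooth S f \<Longrightarrow> set bs \<subseteq> Basis \<Longrightarrow> smooth S (partials bs f)"
  by (induction bs) (auto intro: smooth_partial)

lemma partials_move:
  assumes "smooth S f" "open S" "set xs \<subseteq> Basis" "set ys \<subseteq> Basis" "b \<in> Basis" "x \<in> S"
  shows "partials (xs @ b # ys) f x = partials (b # xs @ ys) f x"
  using assms(3,6)
proof (induction xs arbitrary: x)
  case (Cons a xs)
  have "partials ((a # xs) @ b # ys) f x = partial a (partials (b # xs @ ys) f) x"
    unfolding append_Cons foldr.simps o_apply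
    using Cons assms by (intro partial_cong[of S]) auto
  also have "\<dots> = partial b (partial a (partials (xs @ ys) f)) x"
    using Cons.prems assms
      partial_commute[OF smooth_partials[OF assms(1), of "xs @ ys"] assms(2), of x a b] by simp
  finally show ?case by simp
qed simp

lemma partials_permute:
  assumes "smooth S f" "open S" "set bs \<subseteq> Basis" "mset bs = mset cs" "x \<in> S"
  shows "partials bs f x = partials cs f x"
  using assms(3-)
proof (induction bs arbitrary: cs x)
  case (Cons b bs)
  have "b \<in> set cs" using Cons.prems(2) by (metis list.set_intros(1) mset_eq_setD)
  then obtain xs ys where cs: "cs = xs @ b # ys" by (meson split_list)
  have "set cs \<subseteq> Basis" using Cons.prems by (metis mset_eq_setD)
  then have sub: "set xs \<subseteq> Basis" "set ys \<subseteq> Basis" "b \<in> Basis" using cs by auto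
  have "partials (b # bs) f x = partial b (partials (xs @ ys) f) x"
    unfolding foldr.simps o_apply
  proof (rule partial_cong[OF assms(2) Cons.prems(3)])
    fix y assume "y \<in> S"
    then show "partials bs f y = partials (xs @ ys) f y"
      using Cons.prems(1,2) unfolding cs by (intro Cons.IH) auto
  qed
  also have "\<dots> = partials cs f x"
    unfolding cs using partials_move[OF assms(1,2) sub Cons.prems(3)] by simp
  finally show ?case .
qed simp

text \<open>The enumeration of the basis that occurs in \<^const>\<open>mpartial\<close>.\<close>

definition basis_list :: "'a::euclidean_space list" where
  "basis_list = (SOME bs. distinct bs \<and> set bs = Basis)"

lemma basis_list: "distinct (basis_list :: 'a list)" "set basis_list = (Basis :: 'a::euclidean_space set)"
proof -
  have "\<exists>bs. distinct bs \<and> set bs = (Basis :: 'a set)"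
    using finite_distinct_list[OF finite_Basis] by blast
  from someI_ex[OF this] show "distinct (basis_list :: 'a list)" "set basis_list = (Basis :: 'a set)"
    by (simp_all add: basis_list_def)
qed

text \<open>The order in which \<^const>\<open>mpartial\<close> differentiates, spelled out letter by letter.\<close>

definition mindex_word :: "('a::euclidean_space \<Rightarrow> nat) \<Rightarrow> 'a list" where
  "mindex_word \<alpha> = concat (map (\<lambda>b. replicate (\<alpha> b) b) basis_list)"

lemma mpartial_eq_partials: "mpartial \<alpha> f = partials (mindex_word \<alpha>) f"
proof -
  have "foldr (\<lambda>b g. (partial b ^^ \<alpha> b) g) bs f
      = partials (concat (map (\<lambda>b. replicate (\<alpha> b) b) bs)) f" for bs
    by (induction bs) (simp_all only: list.map concat.simps foldr.simps foldr_append foldr_replicate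
        o_apply id_apply)
  then show ?thesis by (simp only: mpartial_def mindex_word_def flip: basis_list_def)
qed

lemma set_mindex_word: "set (mindex_word \<alpha>) \<subseteq> Basis"
proof
  fix a assume "a \<in> set (mindex_word \<alpha>)"
  then have "a \<in> set basis_list" by (auto simp: mindex_word_def)
  then show "a \<in> Basis" by (simp only: basis_list(2))
qed

lemma mset_mindex_word:
  assumes "set bs \<subseteq> Basis"
  shows "mset (mindex_word (count_list bs)) = mset bs"
proof (rule multiset_eqI)
  fix a
  have "count (mset (concat (map (\<lambda>b. replicate (\<alpha> b) b) cs))) a = (if a \<in> set cs then \<alpha> a else 0)"
    if "distinct cs" for cs and \<alpha> :: "'a \<Rightarrow> nat"
    using that by (induction cs) auto
  from this[OF basis_list(1)] show "count (mset (mindex_word (count_list bs))) a = count (mset bs) a"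
    unfolding mindex_word_def using assms
    by (auto simp: basis_list(2) count_mset count_list_0_iff)
qed

text \<open>Estimates are given for multi-index derivatives, whereas iterated directional derivatives produce
  arbitrary words of basis vectors. This lemma translates one into the other.\<close>

lemma partials_eq_mpartial:
  assumes "smooth S f" "open S" "set bs \<subseteq> Basis" "x \<in> S"
  shows "partials bs f x = mpartial (count_list bs) f x"
  unfolding mpartial_eq_partials
  using assms mset_mindex_word[OF assms(3)] by (intro partials_permute[of S]) auto

section \<open>Linear structure of smooth functions\<close>

lemma partial_lincomb:
  assumes "smooth S f" "smooth S g" "open S" "x \<in> S"
  shows "partial b (\<lambda>x. c * f x + d * g x) x = c * partial b f x + d * partial b g x"
proof -
  note f = smooth_has_derivative[OF assms(1,3,4)] and g = smooth_has_derivative[OF assms(2-4)]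
  note fg = has_derivative_add[OF has_derivative_mult_right[OF f, of c]
      has_derivative_mult_right[OF g, of d]]
  show ?thesis
    using has_derivative_imp_partial[OF fg, of b] has_derivative_imp_partial[OF f, of b]
      has_derivative_imp_partial[OF g, of b] by simp
qed

lemma Ck_cong:
  assumes "open S" "\<And>x. x \<in> S \<Longrightarrow> f x = g x" "Ck k S f"
  shows "Ck k S g"
  using assms(2,3)
proof (induction k arbitrary: f g)
  case 0
  have "continuous_on S g" if "continuous_on S f"
    using continuous_on_cong[OF refl, of S f g] 0(1) that by blast
  then show ?case using 0(2) by simp
next
  case (Suc k)
  have "f differentiable_on S" using Suc.prems(2) by simp
  then have "g differentiable_on S"
    unfolding differentiable_on_def
    using differentiable_transform_within[of f _ S 1 g] Suc.prems(1) by simp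
  moreover have "Ck k S (partial b g)" if "b \<in> Basis" for b
  proof (rule Suc.IH)
    show "partial b f x = partial b g x" if "x \<in> S" for x
      by (rule partial_cong[OF assms(1) that Suc.prems(1)])
    show "Ck k S (partial b f)" using Suc.prems(2) that by simp
  qed
  ultimately show ?case by simp
qed

lemma smooth_lincomb:
  assumes "smooth S f" "smooth S g" "open S"
  shows "smooth S (\<lambda>x. c * f x + d * g x)"
proof -
  have "Ck k S (\<lambda>x. c * f x + d * g x)" for k
    using assms(1,2)
  proof (induction k arbitrary: f g)
    case 0
    then show ?case
      unfolding Ck.simps by (intro continuous_intros smooth_continuous_on)
  next
    case (Suc k)
    have "Ck k S (partial b (\<lambda>x. c * f x + d * g x))" if b: "b \<in> Basis" for b
      by (rule Ck_cong[OF assms(3) _ Suc.IH[OF smooth_partial[OF Suc.prems(1) b]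
              smooth_partial[OF Suc.prems(2) b]]])
        (simp add: partial_lincomb[OF Suc.prems assms(3)])
    moreover have "f differentiable_on S" "g differentiable_on S"
      using Suc.prems unfolding smooth_def by (metis Ck.simps(2))+
    ultimately show ?case
      by (auto intro!: differentiable_on_add differentiable_on_mult differentiable_on_const)
  qed
  then show ?thesis by (simp add: smooth_def)
qed

lemma partials_lincomb:
  assumes "smooth S f" "smooth S g" "open S" "set bs \<subseteq> Basis" "x \<in> S"
  shows "partials bs (\<lambda>x. c * f x + d * g x) x = c * partials bs f x + d * partials bs g x"
  using assms(4,5)
proof (induction bs arbitrary: x)
  case (Cons b bs)
  then have "partials (b # bs) (\<lambda>x. c * f x + d * g x) x
      = partial b (\<lambda>x. c * partials bs f x + d * partials bs g x) x"
    unfolding foldr.simps o_apply by (intro partial_cong[OF assms(3)]) auto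
  also have "\<dots> = c * partials (b # bs) f x + d * partials (b # bs) g x"
    using Cons.prems assms by (simp add: partial_lincomb[of S] smooth_partials)
  finally show ?case .
qed simp

lemma partial_zero [simp]: "partial b (\<lambda>x. 0) = (\<lambda>x. 0)"
  by (auto simp: partial_def)

lemma mpartial_zero [simp]: "mpartial \<alpha> (\<lambda>x. 0) = (\<lambda>x. 0)"
proof -
  have "partials bs (\<lambda>x. 0) = (\<lambda>x. 0)" for bs :: "'a list" by (induction bs) auto
  then show ?thesis by (simp only: mpartial_eq_partials)
qed

lemma smooth_zero: "smooth S (\<lambda>x. 0)"
proof -
  have "Ck k S (\<lambda>x. 0)" for k by (induction k) auto
  then show ?thesis by (simp add: smooth_def)
qed

section \<open>Functions smooth up to the boundary\<close>

text \<open>The pairs that occur are \<open>\<Omega>\<close> with its closure, the jet space over them, the cylinders of boundary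
  charts, the real line and the unit interval.\<close>

locale smooth_domain =
  fixes \<Omega> D :: "'a::euclidean_space set"
  assumes open_dom: "open \<Omega>" and dom_subset: "\<Omega> \<subseteq> D" and dom_dense: "D \<subseteq> closure \<Omega>"
begin

lemma ext_partial_interior: "x \<in> \<Omega> \<Longrightarrow> ext_partial \<Omega> \<alpha> f x = mpartial \<alpha> f x"
  by (simp add: ext_partial_def)

text \<open>By density there is only one continuous extension to \<open>D\<close>. Hence identities between extended
  derivatives only have to be checked in the interior.\<close>

lemma ext_partial_unique:
  assumes "continuous_on D g" "\<And>x. x \<in> \<Omega> \<Longrightarrow> g x = mpartial \<alpha> f x" "x \<in> D"
  shows "ext_partial \<Omega> \<alpha> f x = g x"
proof (cases "x \<in> \<Omega>")
  case False
  then have lim: "at x within \<Omega> \<noteq> bot"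
    using assms(3) dom_dense by (auto simp: closure_def trivial_limit_within)
  have "(g \<longlongrightarrow> g x) (at x within \<Omega>)"
    using assms(1,3) dom_subset by (meson continuous_on_def tendsto_within_subset)
  moreover have "\<forall>\<^sub>F y in at x within \<Omega>. g y = mpartial \<alpha> f y"
    using assms(2) by (simp add: eventually_at_filter)
  ultimately have "(mpartial \<alpha> f \<longlongrightarrow> g x) (at x within \<Omega>)"
    using tendsto_cong by fast
  then show ?thesis using False lim by (simp add: ext_partial_def tendsto_Lim)
qed (simp add: assms ext_partial_interior)

lemma Cinf_ext_partial:
  assumes "f \<in> Cinf \<Omega> D"
  shows "continuous_on D (ext_partial \<Omega> \<alpha> f)"
proof -
  obtain g where g: "continuous_on D g" "\<And>x. x \<in> \<Omega> \<Longrightarrow> g x = mpartial \<alpha> f x"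
    using assms unfolding Cinf_def by blast
  then show ?thesis using ext_partial_unique[OF g]
    by (metis (no_types, lifting) continuous_on_cong)
qed

lemma Cinf_smooth: "f \<in> Cinf \<Omega> D \<Longrightarrow> smooth \<Omega> f"
  by (simp add: Cinf_def)

lemma Cinf_lincomb:
  assumes "f \<in> Cinf \<Omega> D" "g \<in> Cinf \<Omega> D"
  shows "(\<lambda>x. c * f x + d * g x) \<in> Cinf \<Omega> D"
    and "x \<in> D \<Longrightarrow> ext_partial \<Omega> \<alpha> (\<lambda>x. c * f x + d * g x) x
           = c * ext_partial \<Omega> \<alpha> f x + d * ext_partial \<Omega> \<alpha> g x"
proof -
  let ?h = "\<lambda>\<alpha> x. c * ext_partial \<Omega> \<alpha> f x + d * ext_partial \<Omega> \<alpha> g x"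
  note sm = Cinf_smooth[OF assms(1)] Cinf_smooth[OF assms(2)]
  have h: "continuous_on D (?h \<alpha>)" for \<alpha>
    by (intro continuous_intros Cinf_ext_partial assms)
  have eq: "?h \<alpha> x = mpartial \<alpha> (\<lambda>x. c * f x + d * g x) x" if "x \<in> \<Omega>" for \<alpha> x
    using partials_lincomb[OF sm open_dom set_mindex_word that] that
    by (simp only: ext_partial_interior mpartial_eq_partials)
  have "continuous_on D f" "continuous_on D g" using assms by (simp_all add: Cinf_def)
  then have "continuous_on D (\<lambda>x. c * f x + d * g x)" by (intro continuous_intros)
  then show "(\<lambda>x. c * f x + d * g x) \<in> Cinf \<Omega> D"
    using smooth_lincomb[OF sm open_dom] h eq unfolding Cinf_def by blast
  show "ext_partial \<Omega> \<alpha> (\<lambda>x. c * f x + d * g x) x = ?h \<alpha> x" if "x \<in> D"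
    by (rule ext_partial_unique[OF h eq that])
qed

lemma Cinf_zero: "(\<lambda>x. 0) \<in> Cinf \<Omega> D"
  unfolding Cinf_def by (auto simp: smooth_zero intro!: exI[of _ "\<lambda>x. 0"])

lemma ext_partial_zero: "x \<in> D \<Longrightarrow> ext_partial \<Omega> \<alpha> (\<lambda>x. 0) x = 0"
  by (rule ext_partial_unique) auto

end

section \<open>Asymptotic estimates\<close>

definition moderate_on :: "'a set \<Rightarrow> (real \<Rightarrow> 'a \<Rightarrow> real) \<Rightarrow> bool" where
  "moderate_on K f \<longleftrightarrow> (\<exists>N::nat. bigO_on K f (\<lambda>\<epsilon>. (1 / \<epsilon>) ^ N))"

definition negligible_on :: "'a set \<Rightarrow> (real \<Rightarrow> 'a \<Rightarrow> real) \<Rightarrow> bool" where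
  "negligible_on K f \<longleftrightarrow> (\<forall>m::nat. bigO_on K f (\<lambda>\<epsilon>. \<epsilon> ^ m))"

lemma eventually_at_right_0_le: "0 < (r::real) \<Longrightarrow> \<forall>\<^sub>F \<epsilon> in at_right 0. 0 < \<epsilon> \<and> \<epsilon> \<le> r"
  using eventually_at_right_real[of 0 r] by (auto elim: eventually_mono)

text \<open>The constant of the \<open>O\<close>-estimate is absorbed by one more power of \<open>\<epsilon>\<close>; without it the estimates
  are easier to combine.\<close>

lemma moderate_on_iff:
  "moderate_on K f \<longleftrightarrow> (\<exists>N::nat. \<forall>\<^sub>F \<epsilon> in at_right 0. \<forall>x\<in>K. \<bar>f \<epsilon> x\<bar> \<le> (1 / \<epsilon>) ^ N)"
proof
  assume "moderate_on K f"
  then obtain N C where N: "\<forall>\<^sub>F \<epsilon> in at_right 0. \<forall>x\<in>K. \<bar>f \<epsilon> x\<bar> \<le> C * (1 / \<epsilon>) ^ N"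
    unfolding moderate_on_def bigO_on_def by blast
  have "\<forall>\<^sub>F \<epsilon> in at_right 0. 0 < \<epsilon> \<and> \<epsilon> \<le> 1 / (\<bar>C\<bar> + 1)"
    by (rule eventually_at_right_0_le) simp
  with N have "\<forall>\<^sub>F \<epsilon> in at_right 0. \<forall>x\<in>K. \<bar>f \<epsilon> x\<bar> \<le> (1 / \<epsilon>) ^ Suc N"
  proof eventually_elim
    case (elim \<epsilon>)
    then have "(\<bar>C\<bar> + 1) * \<epsilon> \<le> 1" by (auto simp: field_simps)
    then have "C * \<epsilon> \<le> 1"
      using elim by (smt (verit) mult_right_mono)
    then have "C \<le> 1 / \<epsilon>" using elim by (simp add: field_simps)
    then have *: "C * (1 / \<epsilon>) ^ N \<le> (1 / \<epsilon>) ^ Suc N"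
      using elim mult_right_mono[of C "1 / \<epsilon>" "(1 / \<epsilon>) ^ N"] by simp
    show ?case
    proof
      fix x assume "x \<in> K"
      then have "\<bar>f \<epsilon> x\<bar> \<le> C * (1 / \<epsilon>) ^ N" using elim by blast
      also note *
      finally show "\<bar>f \<epsilon> x\<bar> \<le> (1 / \<epsilon>) ^ Suc N" .
    qed
  qed
  then show "\<exists>N::nat. \<forall>\<^sub>F \<epsilon> in at_right 0. \<forall>x\<in>K. \<bar>f \<epsilon> x\<bar> \<le> (1 / \<epsilon>) ^ N" by blast
next
  assume "\<exists>N::nat. \<forall>\<^sub>F \<epsilon> in at_right 0. \<forall>x\<in>K. \<bar>f \<epsilon> x\<bar> \<le> (1 / \<epsilon>) ^ N"
  then show "moderate_on K f"
    unfolding moderate_on_def bigO_on_def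
    by (elim exE, intro exI[where x = 1] exI) simp
qed

lemma negligible_on_iff:
  "negligible_on K f \<longleftrightarrow> (\<forall>m::nat. \<forall>\<^sub>F \<epsilon> in at_right 0. \<forall>x\<in>K. \<bar>f \<epsilon> x\<bar> \<le> \<epsilon> ^ m)"
proof
  assume f: "negligible_on K f"
  show "\<forall>m::nat. \<forall>\<^sub>F \<epsilon> in at_right 0. \<forall>x\<in>K. \<bar>f \<epsilon> x\<bar> \<le> \<epsilon> ^ m"
  proof
    fix m :: nat
    obtain C where N: "\<forall>\<^sub>F \<epsilon> in at_right 0. \<forall>x\<in>K. \<bar>f \<epsilon> x\<bar> \<le> C * \<epsilon> ^ Suc m"
      using f unfolding negligible_on_def bigO_on_def by blast
    have "\<forall>\<^sub>F \<epsilon> in at_right 0. 0 < \<epsilon> \<and> \<epsilon> \<le> 1 / (\<bar>C\<bar> + 1)"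
      by (rule eventually_at_right_0_le) simp
    with N show "\<forall>\<^sub>F \<epsilon> in at_right 0. \<forall>x\<in>K. \<bar>f \<epsilon> x\<bar> \<le> \<epsilon> ^ m"
    proof eventually_elim
      case (elim \<epsilon>)
      then have "(\<bar>C\<bar> + 1) * \<epsilon> \<le> 1" by (auto simp: field_simps)
      then have "C * \<epsilon> \<le> 1"
        using elim by (smt (verit) mult_right_mono)
      then have *: "C * \<epsilon> ^ Suc m \<le> 1 * \<epsilon> ^ m"
        using elim mult_right_mono[of "C * \<epsilon>" 1 "\<epsilon> ^ m"] by (simp add: mult_ac)
      show ?case
      proof
        fix x assume "x \<in> K"
        then have "\<bar>f \<epsilon> x\<bar> \<le> C * \<epsilon> ^ Suc m" using elim by blast
        also note *
        finally show "\<bar>f \<epsilon> x\<bar> \<le> \<epsilon> ^ m" by simp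
      qed
    qed
  qed
next
  assume "\<forall>m::nat. \<forall>\<^sub>F \<epsilon> in at_right 0. \<forall>x\<in>K. \<bar>f \<epsilon> x\<bar> \<le> \<epsilon> ^ m"
  then show "negligible_on K f"
    unfolding negligible_on_def bigO_on_def by (auto intro!: exI[of _ 1])
qed

lemma moderate_onE:
  assumes "moderate_on K f"
  obtains N :: nat where "\<forall>\<^sub>F \<epsilon> in at_right 0. \<forall>x\<in>K. \<bar>f \<epsilon> x\<bar> \<le> (1 / \<epsilon>) ^ N"
  using assms unfolding moderate_on_iff by blast

lemma negligible_onD:
  "negligible_on K f \<Longrightarrow> \<forall>\<^sub>F \<epsilon> in at_right 0. \<forall>x\<in>K. \<bar>f \<epsilon> x\<bar> \<le> \<epsilon> ^ m"
  by (simp add: negligible_on_iff)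

lemma eps_power_le:
  assumes "0 < (\<epsilon>::real)" "\<epsilon> \<le> 1" "M \<le> N"
  shows "(1 / \<epsilon>) ^ M \<le> (1 / \<epsilon>) ^ N" "\<epsilon> ^ N \<le> \<epsilon> ^ M"
  using assms by (intro power_increasing power_decreasing; simp)+

lemma moderate_on_mono:
  assumes "moderate_on K' g"
    and "\<forall>\<^sub>F \<epsilon> in at_right 0. \<forall>x\<in>K. \<exists>y\<in>K'. \<bar>f \<epsilon> x\<bar> \<le> \<bar>g \<epsilon> y\<bar>"
  shows "moderate_on K f"
proof -
  obtain N where "\<forall>\<^sub>F \<epsilon> in at_right 0. \<forall>x\<in>K'. \<bar>g \<epsilon> x\<bar> \<le> (1 / \<epsilon>) ^ N"
    using assms(1) moderate_on_iff by blast
  with assms(2) have "\<forall>\<^sub>F \<epsilon> in at_right 0. \<forall>x\<in>K. \<bar>f \<epsilon> x\<bar> \<le> (1 / \<epsilon>) ^ N"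
    by eventually_elim (meson order_trans)
  then show ?thesis using moderate_on_iff by blast
qed

lemma negligible_on_mono:
  assumes "negligible_on K' g"
    and "\<forall>\<^sub>F \<epsilon> in at_right 0. \<forall>x\<in>K. \<exists>y\<in>K'. \<bar>f \<epsilon> x\<bar> \<le> \<bar>g \<epsilon> y\<bar>"
  shows "negligible_on K f"
  unfolding negligible_on_iff
proof
  fix m :: nat
  have "\<forall>\<^sub>F \<epsilon> in at_right 0. \<forall>x\<in>K'. \<bar>g \<epsilon> x\<bar> \<le> \<epsilon> ^ m"
    using assms(1) negligible_on_iff by blast
  with assms(2) show "\<forall>\<^sub>F \<epsilon> in at_right 0. \<forall>x\<in>K. \<bar>f \<epsilon> x\<bar> \<le> \<epsilon> ^ m"
    by eventually_elim (meson order_trans)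
qed

lemma moderate_on_le:
  assumes "moderate_on K g" "\<And>\<epsilon> x. 0 < \<epsilon> \<Longrightarrow> \<epsilon> \<le> 1 \<Longrightarrow> x \<in> K \<Longrightarrow> \<bar>f \<epsilon> x\<bar> \<le> g \<epsilon> x"
  shows "moderate_on K f"
  using eventually_at_right_0_le[OF zero_less_one]
  by (intro moderate_on_mono[OF assms(1)]) (auto elim!: eventually_mono, metis abs_ge_self assms(2) order_trans)

lemma negligible_on_le:
  assumes "negligible_on K g" "\<And>\<epsilon> x. 0 < \<epsilon> \<Longrightarrow> \<epsilon> \<le> 1 \<Longrightarrow> x \<in> K \<Longrightarrow> \<bar>f \<epsilon> x\<bar> \<le> g \<epsilon> x"
  shows "negligible_on K f"
  using eventually_at_right_0_le[OF zero_less_one]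
  by (intro negligible_on_mono[OF assms(1)]) (auto elim!: eventually_mono, metis abs_ge_self assms(2) order_trans)

lemma moderate_on_cong:
  assumes "\<And>\<epsilon> x. 0 < \<epsilon> \<Longrightarrow> \<epsilon> \<le> 1 \<Longrightarrow> x \<in> K \<Longrightarrow> f \<epsilon> x = g \<epsilon> x"
  shows "moderate_on K f \<longleftrightarrow> moderate_on K g"
proof -
  have ev: "\<forall>\<^sub>F \<epsilon> in at_right 0. \<forall>x\<in>K. f \<epsilon> x = g \<epsilon> x"
    using eventually_at_right_0_le[OF zero_less_one] by eventually_elim (simp add: assms)
  show ?thesis
    using moderate_on_mono[of K f K g] moderate_on_mono[of K g K f]
      eventually_mono[OF ev, of "\<lambda>\<epsilon>. \<forall>x\<in>K. \<exists>y\<in>K. \<bar>g \<epsilon> x\<bar> \<le> \<bar>f \<epsilon> y\<bar>"]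
      eventually_mono[OF ev, of "\<lambda>\<epsilon>. \<forall>x\<in>K. \<exists>y\<in>K. \<bar>f \<epsilon> x\<bar> \<le> \<bar>g \<epsilon> y\<bar>"] by force
qed

lemma negligible_on_cong:
  assumes "\<And>\<epsilon> x. 0 < \<epsilon> \<Longrightarrow> \<epsilon> \<le> 1 \<Longrightarrow> x \<in> K \<Longrightarrow> f \<epsilon> x = g \<epsilon> x"
  shows "negligible_on K f \<longleftrightarrow> negligible_on K g"
proof -
  have ev: "\<forall>\<^sub>F \<epsilon> in at_right 0. \<forall>x\<in>K. f \<epsilon> x = g \<epsilon> x"
    using eventually_at_right_0_le[OF zero_less_one] by eventually_elim (simp add: assms)
  show ?thesis
    using negligible_on_mono[of K f K g] negligible_on_mono[of K g K f]
      eventually_mono[OF ev, of "\<lambda>\<epsilon>. \<forall>x\<in>K. \<exists>y\<in>K. \<bar>g \<epsilon> x\<bar> \<le> \<bar>f \<epsilon> y\<bar>"]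
      eventually_mono[OF ev, of "\<lambda>\<epsilon>. \<forall>x\<in>K. \<exists>y\<in>K. \<bar>f \<epsilon> x\<bar> \<le> \<bar>g \<epsilon> y\<bar>"] by force
qed

lemma moderate_on_const: "moderate_on K (\<lambda>\<epsilon> x. c)"
  unfolding moderate_on_def bigO_on_def by (intro exI[of _ 0] exI[of _ "\<bar>c\<bar>"]) simp

lemma negligible_on_zero: "negligible_on K (\<lambda>\<epsilon> x. 0)"
  unfolding negligible_on_def bigO_on_def by (intro allI exI[of _ 0]) simp

lemma moderate_on_mult:
  assumes "moderate_on K f" "moderate_on K g"
  shows "moderate_on K (\<lambda>\<epsilon> x. f \<epsilon> x * g \<epsilon> x)"
proof -
  obtain M where "\<forall>\<^sub>F \<epsilon> in at_right 0. \<forall>x\<in>K. \<bar>f \<epsilon> x\<bar> \<le> (1 / \<epsilon>) ^ M"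
    using assms(1) by (rule moderate_onE)
  moreover obtain N where "\<forall>\<^sub>F \<epsilon> in at_right 0. \<forall>x\<in>K. \<bar>g \<epsilon> x\<bar> \<le> (1 / \<epsilon>) ^ N"
    using assms(2) by (rule moderate_onE)
  ultimately have "\<forall>\<^sub>F \<epsilon> in at_right 0. \<forall>x\<in>K. \<bar>f \<epsilon> x * g \<epsilon> x\<bar> \<le> (1 / \<epsilon>) ^ (M + N)"
    by eventually_elim (auto simp: abs_mult power_add intro!: mult_mono' order_trans[OF abs_ge_zero])
  then show ?thesis using moderate_on_iff by blast
qed

lemma moderate_on_add:
  assumes "moderate_on K f" "moderate_on K g"
  shows "moderate_on K (\<lambda>\<epsilon> x. f \<epsilon> x + g \<epsilon> x)"
proof -
  obtain M where "\<forall>\<^sub>F \<epsilon> in at_right 0. \<forall>x\<in>K. \<bar>f \<epsilon> x\<bar> \<le> (1 / \<epsilon>) ^ M"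
    using assms(1) by (rule moderate_onE)
  moreover obtain N where "\<forall>\<^sub>F \<epsilon> in at_right 0. \<forall>x\<in>K. \<bar>g \<epsilon> x\<bar> \<le> (1 / \<epsilon>) ^ N"
    using assms(2) by (rule moderate_onE)
  ultimately have "\<forall>\<^sub>F \<epsilon> in at_right 0. \<forall>x\<in>K. \<bar>f \<epsilon> x + g \<epsilon> x\<bar> \<le> 2 * (1 / \<epsilon>) ^ (M + N)"
    using eventually_at_right_0_le[OF zero_less_one]
  proof eventually_elim
    case (elim \<epsilon>)
    show ?case
    proof
      fix x assume "x \<in> K"
      then show "\<bar>f \<epsilon> x + g \<epsilon> x\<bar> \<le> 2 * (1 / \<epsilon>) ^ (M + N)"
        using elim eps_power_le(1)[of \<epsilon> M "M + N"] eps_power_le(1)[of \<epsilon> N "M + N"] by force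
    qed
  qed
  then show ?thesis unfolding moderate_on_def bigO_on_def by blast
qed

lemma negligible_on_add:
  assumes "negligible_on K f" "negligible_on K g"
  shows "negligible_on K (\<lambda>\<epsilon> x. f \<epsilon> x + g \<epsilon> x)"
  unfolding negligible_on_def bigO_on_def
proof
  fix m :: nat
  have "\<forall>\<^sub>F \<epsilon> in at_right 0. \<forall>x\<in>K. \<bar>f \<epsilon> x\<bar> \<le> \<epsilon> ^ m"
     "\<forall>\<^sub>F \<epsilon> in at_right 0. \<forall>x\<in>K. \<bar>g \<epsilon> x\<bar> \<le> \<epsilon> ^ m"
    by (rule negligible_onD[OF assms(1)], rule negligible_onD[OF assms(2)])
  then have "\<forall>\<^sub>F \<epsilon> in at_right 0. \<forall>x\<in>K. \<bar>f \<epsilon> x + g \<epsilon> x\<bar> \<le> 2 * \<epsilon> ^ m"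
    by eventually_elim force
  then show "\<exists>C. \<forall>\<^sub>F \<epsilon> in at_right 0. \<forall>x\<in>K. \<bar>f \<epsilon> x + g \<epsilon> x\<bar> \<le> C * \<epsilon> ^ m" by blast
qed

lemma negligible_on_mult:
  assumes "moderate_on K f" "negligible_on K g"
  shows "negligible_on K (\<lambda>\<epsilon> x. f \<epsilon> x * g \<epsilon> x)"
  unfolding negligible_on_iff
proof
  fix m :: nat
  obtain M where "\<forall>\<^sub>F \<epsilon> in at_right 0. \<forall>x\<in>K. \<bar>f \<epsilon> x\<bar> \<le> (1 / \<epsilon>) ^ M"
    using assms(1) by (rule moderate_onE)
  moreover have "\<forall>\<^sub>F \<epsilon> in at_right 0. \<forall>x\<in>K. \<bar>g \<epsilon> x\<bar> \<le> \<epsilon> ^ (m + M)"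
    using assms(2) by (rule negligible_onD)
  ultimately show "\<forall>\<^sub>F \<epsilon> in at_right 0. \<forall>x\<in>K. \<bar>f \<epsilon> x * g \<epsilon> x\<bar> \<le> \<epsilon> ^ m"
    using eventually_at_right_0_le[OF zero_less_one]
  proof eventually_elim
    case (elim \<epsilon>)
    show ?case
    proof
      fix x assume "x \<in> K"
      then have "\<bar>f \<epsilon> x * g \<epsilon> x\<bar> \<le> (1 / \<epsilon>) ^ M * \<epsilon> ^ (m + M)"
        using elim unfolding abs_mult by (intro mult_mono) auto
      also have "\<dots> = \<epsilon> ^ m" using elim by (simp add: power_add power_one_over)
      finally show "\<bar>f \<epsilon> x * g \<epsilon> x\<bar> \<le> \<epsilon> ^ m" .
    qed
  qed
qed

lemma negligible_imp_moderate_on: "negligible_on K f \<Longrightarrow> moderate_on K f"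
  using negligible_onD[of K f 0] unfolding moderate_on_iff by (intro exI[of _ 0]) simp

lemma moderate_on_sum:
  "(\<And>i. i \<in> I \<Longrightarrow> moderate_on K (f i)) \<Longrightarrow> moderate_on K (\<lambda>\<epsilon> x. \<Sum>i\<in>I. f i \<epsilon> x)"
  by (induction I rule: infinite_finite_induct) (auto intro: moderate_on_add moderate_on_const)

lemma negligible_on_sum:
  "(\<And>i. i \<in> I \<Longrightarrow> negligible_on K (f i)) \<Longrightarrow> negligible_on K (\<lambda>\<epsilon> x. \<Sum>i\<in>I. f i \<epsilon> x)"
  by (induction I rule: infinite_finite_induct) (auto intro: negligible_on_add negligible_on_zero)

lemma moderate_on_power: "moderate_on K f \<Longrightarrow> moderate_on K (\<lambda>\<epsilon> x. f \<epsilon> x ^ k)"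
  by (induction k) (auto intro: moderate_on_mult moderate_on_const)

lemma moderate_on_abs: "moderate_on K f \<Longrightarrow> moderate_on K (\<lambda>\<epsilon> x. \<bar>f \<epsilon> x\<bar>)"
  unfolding moderate_on_iff by simp

lemma negligible_on_abs: "negligible_on K f \<Longrightarrow> negligible_on K (\<lambda>\<epsilon> x. \<bar>f \<epsilon> x\<bar>)"
  unfolding negligible_on_iff by simp

section \<open>Quotients\<close>

lemma net_rel_equivI:
  assumes "\<And>u. u \<in> M \<Longrightarrow> u - u \<in> N"
    and "\<And>u v. u \<in> M \<Longrightarrow> v \<in> M \<Longrightarrow> u - v \<in> N \<Longrightarrow> v - u \<in> N"
    and "\<And>u v w. u \<in> M \<Longrightarrow> v \<in> M \<Longrightarrow> w \<in> M \<Longrightarrow> u - v \<in> N \<Longrightarrow> v - w \<in> N \<Longrightarrow> u - w \<in> N"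
  shows "equiv M (net_rel M N)"
proof (rule equivI)
  show "net_rel M N \<subseteq> M \<times> M" by (auto simp: net_rel_def)
  show "refl_on M (net_rel M N)" unfolding refl_on_def net_rel_def using assms(1) by simp
  show "sym (net_rel M N)" unfolding sym_def net_rel_def using assms(2) by blast
  show "trans (net_rel M N)" unfolding trans_def net_rel_def using assms(3) by blast
qed

lemma mem_net_class: "v \<in> net_class M N u \<longleftrightarrow> u \<in> M \<and> v \<in> M \<and> u - v \<in> N"
  by (auto simp: net_class_def net_rel_def)

lemma net_class_eq_iff:
  assumes "equiv M (net_rel M N)" "u \<in> M" "v \<in> M"
  shows "net_class M N u = net_class M N v \<longleftrightarrow> u - v \<in> N"
  unfolding net_class_def eq_equiv_class_iff[OF assms] using assms(2,3) by (simp add: net_rel_def)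

lemma rep_quotient:
  assumes "equiv M (net_rel M N)" "U \<in> M // net_rel M N"
  shows "rep U \<in> U" "rep U \<in> M" "net_class M N (rep U) = U"
proof -
  show 1: "rep U \<in> U"
    unfolding rep_def using in_quotient_imp_non_empty[OF assms] by (simp add: some_in_eq)
  show 2: "rep U \<in> M" using in_quotient_imp_subset[OF assms] 1 by blast
  obtain u where u: "u \<in> M" "U = net_rel M N `` {u}" using assms(2) by (rule quotientE)
  then show "net_class M N (rep U) = U"
    using 1 equiv_class_eq[OF assms(1), of u "rep U"] by (simp add: net_class_def)
qed

lemma net_class_quotient: "u \<in> M \<Longrightarrow> net_class M N u \<in> M // net_rel M N"
  unfolding net_class_def by (rule quotientI)

lemma quotient_memD:
  assumes "equiv M (net_rel M N)" "U \<in> M // net_rel M N" "u \<in> U"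
  shows "u \<in> M" "net_class M N u = U"
proof -
  show "u \<in> M" using in_quotient_imp_subset[OF assms(1,2)] assms(3) by blast
  obtain v where v: "v \<in> M" "U = net_rel M N `` {v}" using assms(2) by (rule quotientE)
  then show "net_class M N u = U"
    using assms(3) equiv_class_eq[OF assms(1), of v u] by (simp add: net_class_def)
qed

lemma rep_net_class:
  assumes "equiv M (net_rel M N)" "u \<in> M"
  shows "rep (net_class M N u) \<in> M" "rep (net_class M N u) - u \<in> N"
proof -
  note q = rep_quotient[OF assms(1) net_class_quotient[OF assms(2)]]
  show "rep (net_class M N u) \<in> M" by (rule q)
  show "rep (net_class M N u) - u \<in> N"
    using q(3) net_class_eq_iff[OF assms(1) q(2) assms(2)] by blast
qed

section \<open>The Colombeau algebras as quotients\<close>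

lemma moderate_iff: "u \<in> moderate \<Omega> D \<longleftrightarrow> (\<forall>\<epsilon>\<in>{0<..1}. u \<epsilon> \<in> Cinf \<Omega> D) \<and>
    (\<forall>K \<alpha>. compact K \<and> K \<subseteq> D \<longrightarrow> moderate_on K (\<lambda>\<epsilon>. ext_partial \<Omega> \<alpha> (u \<epsilon>)))"
  by (simp add: moderate_def moderate_on_def)

lemma negligible_nets_iff: "u \<in> negligible_nets \<Omega> D \<longleftrightarrow> (\<forall>\<epsilon>\<in>{0<..1}. u \<epsilon> \<in> Cinf \<Omega> D) \<and>
    (\<forall>K \<alpha>. compact K \<and> K \<subseteq> D \<longrightarrow> negligible_on K (\<lambda>\<epsilon>. ext_partial \<Omega> \<alpha> (u \<epsilon>)))"
  by (simp add: negligible_nets_def negligible_on_def)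

lemma negligible_nets_moderate: "u \<in> negligible_nets \<Omega> D \<Longrightarrow> u \<in> moderate \<Omega> D"
  by (simp add: negligible_nets_iff moderate_iff negligible_imp_moderate_on)

lemma moderate_onD: "u \<in> moderate \<Omega> D \<Longrightarrow> compact K \<Longrightarrow> K \<subseteq> D \<Longrightarrow>
    moderate_on K (\<lambda>\<epsilon>. ext_partial \<Omega> \<alpha> (u \<epsilon>))"
  by (simp add: moderate_iff)

lemma negligible_nets_onD: "u \<in> negligible_nets \<Omega> D \<Longrightarrow> compact K \<Longrightarrow> K \<subseteq> D \<Longrightarrow>
    negligible_on K (\<lambda>\<epsilon>. ext_partial \<Omega> \<alpha> (u \<epsilon>))"
  by (simp add: negligible_nets_iff)

lemma net_diff: "u - v = (\<lambda>\<epsilon> x. 1 * u \<epsilon> x + (- 1) * v \<epsilon> (x :: 'a) :: real)"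
  by (simp add: fun_eq_iff)

lemma abs_lincomb_le:
  assumes "\<bar>a\<bar> \<le> 1" "\<bar>b\<bar> \<le> (1::real)"
  shows "\<bar>a * x + b * y\<bar> \<le> \<bar>x\<bar> + \<bar>y\<bar>"
proof -
  have "\<bar>a * x\<bar> \<le> \<bar>x\<bar>" "\<bar>b * y\<bar> \<le> \<bar>y\<bar>"
    using assms by (auto simp: abs_mult intro: mult_left_le_one_le)
  then show ?thesis by linarith
qed

context smooth_domain begin

text \<open>The coefficients may depend on \<open>\<epsilon>\<close>: constant ones give differences, and \<open>u + s\<^sub>\<epsilon> v\<close> with
  \<open>s\<^sub>\<epsilon> \<in> [0,1]\<close> is the generalized point at which the second variation is evaluated.\<close>

lemma moderate_lincomb:
  assumes "u \<in> moderate \<Omega> D" "v \<in> moderate \<Omega> D"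
    and c: "\<And>\<epsilon>. \<epsilon> \<in> {0<..1} \<Longrightarrow> \<bar>a \<epsilon>\<bar> \<le> 1 \<and> \<bar>b \<epsilon>\<bar> \<le> 1"
  shows "(\<lambda>\<epsilon> x. a \<epsilon> * u \<epsilon> x + b \<epsilon> * v \<epsilon> x) \<in> moderate \<Omega> D"
  unfolding moderate_iff
proof (intro conjI ballI allI impI)
  show "(\<lambda>x. a \<epsilon> * u \<epsilon> x + b \<epsilon> * v \<epsilon> x) \<in> Cinf \<Omega> D" if "\<epsilon> \<in> {0<..1}" for \<epsilon>
    using assms(1,2) that by (auto simp: moderate_iff intro!: Cinf_lincomb)
  fix K \<alpha> assume K: "compact K \<and> K \<subseteq> D"
  have "moderate_on K (\<lambda>\<epsilon> x. \<bar>ext_partial \<Omega> \<alpha> (u \<epsilon>) x\<bar> + \<bar>ext_partial \<Omega> \<alpha> (v \<epsilon>) x\<bar>)"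
    using assms K by (intro moderate_on_add moderate_on_abs moderate_onD) auto
  then show "moderate_on K (\<lambda>\<epsilon>. ext_partial \<Omega> \<alpha> (\<lambda>x. a \<epsilon> * u \<epsilon> x + b \<epsilon> * v \<epsilon> x))"
  proof (rule moderate_on_le)
    fix \<epsilon> :: real and x assume \<epsilon>: "0 < \<epsilon>" "\<epsilon> \<le> 1" and x: "x \<in> K"
    have "u \<epsilon> \<in> Cinf \<Omega> D" "v \<epsilon> \<in> Cinf \<Omega> D" "x \<in> D"
      using assms \<epsilon> x K by (auto simp: moderate_iff)
    then show "\<bar>ext_partial \<Omega> \<alpha> (\<lambda>x. a \<epsilon> * u \<epsilon> x + b \<epsilon> * v \<epsilon> x) x\<bar>
        \<le> \<bar>ext_partial \<Omega> \<alpha> (u \<epsilon>) x\<bar> + \<bar>ext_partial \<Omega> \<alpha> (v \<epsilon>) x\<bar>"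
      using c[of \<epsilon>] \<epsilon> by (simp add: Cinf_lincomb abs_lincomb_le)
  qed
qed

lemma negligible_lincomb:
  assumes "u \<in> negligible_nets \<Omega> D" "v \<in> negligible_nets \<Omega> D"
    and c: "\<And>\<epsilon>. \<epsilon> \<in> {0<..1} \<Longrightarrow> \<bar>a \<epsilon>\<bar> \<le> 1 \<and> \<bar>b \<epsilon>\<bar> \<le> 1"
  shows "(\<lambda>\<epsilon> x. a \<epsilon> * u \<epsilon> x + b \<epsilon> * v \<epsilon> x) \<in> negligible_nets \<Omega> D"
  unfolding negligible_nets_iff
proof (intro conjI ballI allI impI)
  show "(\<lambda>x. a \<epsilon> * u \<epsilon> x + b \<epsilon> * v \<epsilon> x) \<in> Cinf \<Omega> D" if "\<epsilon> \<in> {0<..1}" for \<epsilon>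
    using assms(1,2) that by (auto simp: negligible_nets_iff intro!: Cinf_lincomb)
  fix K \<alpha> assume K: "compact K \<and> K \<subseteq> D"
  have "negligible_on K (\<lambda>\<epsilon> x. \<bar>ext_partial \<Omega> \<alpha> (u \<epsilon>) x\<bar> + \<bar>ext_partial \<Omega> \<alpha> (v \<epsilon>) x\<bar>)"
    using assms K by (intro negligible_on_add negligible_on_abs negligible_nets_onD) auto
  then show "negligible_on K (\<lambda>\<epsilon>. ext_partial \<Omega> \<alpha> (\<lambda>x. a \<epsilon> * u \<epsilon> x + b \<epsilon> * v \<epsilon> x))"
  proof (rule negligible_on_le)
    fix \<epsilon> :: real and x assume \<epsilon>: "0 < \<epsilon>" "\<epsilon> \<le> 1" and x: "x \<in> K"
    have "u \<epsilon> \<in> Cinf \<Omega> D" "v \<epsilon> \<in> Cinf \<Omega> D" "x \<in> D"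
      using assms \<epsilon> x K by (auto simp: negligible_nets_iff)
    then show "\<bar>ext_partial \<Omega> \<alpha> (\<lambda>x. a \<epsilon> * u \<epsilon> x + b \<epsilon> * v \<epsilon> x) x\<bar>
        \<le> \<bar>ext_partial \<Omega> \<alpha> (u \<epsilon>) x\<bar> + \<bar>ext_partial \<Omega> \<alpha> (v \<epsilon>) x\<bar>"
      using c[of \<epsilon>] \<epsilon> by (simp add: Cinf_lincomb abs_lincomb_le)
  qed
qed

lemma zero_negligible: "(\<lambda>\<epsilon> x. 0) \<in> negligible_nets \<Omega> D"
  unfolding negligible_nets_iff
proof (intro conjI ballI allI impI)
  fix K \<alpha> assume K: "compact K \<and> K \<subseteq> D"
  show "negligible_on K (\<lambda>\<epsilon>. ext_partial \<Omega> \<alpha> (\<lambda>x. 0))"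
    by (rule negligible_on_le[OF negligible_on_zero]) (use K ext_partial_zero in auto)
qed (rule Cinf_zero)

lemma zero_moderate: "(\<lambda>\<epsilon> x. 0) \<in> moderate \<Omega> D"
  by (rule negligible_nets_moderate[OF zero_negligible])

lemma negligible_diff:
  assumes "u \<in> negligible_nets \<Omega> D" "v \<in> negligible_nets \<Omega> D"
  shows "u - v \<in> negligible_nets \<Omega> D"
  unfolding net_diff[of u v]
  using negligible_lincomb[OF assms, of "\<lambda>_. 1" "\<lambda>_. - 1"] by simp

lemma moderate_diff:
  assumes "u \<in> moderate \<Omega> D" "v \<in> moderate \<Omega> D"
  shows "u - v \<in> moderate \<Omega> D"
  unfolding net_diff[of u v]
  using moderate_lincomb[OF assms, of "\<lambda>_. 1" "\<lambda>_. - 1"] by simp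

lemma negligible_minus: "u - v \<in> negligible_nets \<Omega> D \<Longrightarrow> v - u \<in> negligible_nets \<Omega> D"
  using negligible_diff[OF zero_negligible, of "u - v"] by (simp add: fun_diff_def)

lemma negligible_trans:
  assumes "u - v \<in> negligible_nets \<Omega> D" "v - w \<in> negligible_nets \<Omega> D"
  shows "u - w \<in> negligible_nets \<Omega> D"
  using negligible_diff[OF assms(1) negligible_minus[OF assms(2)]] by (simp add: fun_diff_def)

lemma equiv_gen: "equiv (moderate \<Omega> D) (net_rel (moderate \<Omega> D) (negligible_nets \<Omega> D))"
proof (rule net_rel_equivI)
  fix u :: "real \<Rightarrow> 'a \<Rightarrow> real"
  show "u - u \<in> negligible_nets \<Omega> D" using zero_negligible by (simp add: fun_diff_def)
qed (erule negligible_minus, erule (1) negligible_trans)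

lemma rep_gen:
  assumes "U \<in> gen \<Omega> D"
  shows "rep U \<in> U" "rep U \<in> moderate \<Omega> D" "gen_class \<Omega> D (rep U) = U"
  using rep_quotient[OF equiv_gen] assms by (auto simp: gen_def gen_class_def)

lemma gen_class_in: "u \<in> moderate \<Omega> D \<Longrightarrow> gen_class \<Omega> D u \<in> gen \<Omega> D"
  by (simp add: gen_def gen_class_def net_class_quotient)

lemma gen_class_eq_iff:
  "u \<in> moderate \<Omega> D \<Longrightarrow> v \<in> moderate \<Omega> D \<Longrightarrow>
     gen_class \<Omega> D u = gen_class \<Omega> D v \<longleftrightarrow> u - v \<in> negligible_nets \<Omega> D"
  unfolding gen_class_def by (rule net_class_eq_iff[OF equiv_gen])

lemma rep_gen_class:
  assumes "u \<in> moderate \<Omega> D"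
  shows "rep (gen_class \<Omega> D u) \<in> moderate \<Omega> D" "rep (gen_class \<Omega> D u) - u \<in> negligible_nets \<Omega> D"
  using rep_net_class[OF equiv_gen assms] by (auto simp: gen_class_def)

lemma gen_mem_diff:
  assumes "U \<in> gen \<Omega> D" "u \<in> U" "v \<in> U"
  shows "u \<in> moderate \<Omega> D" "u - v \<in> negligible_nets \<Omega> D"
proof -
  have q: "U \<in> moderate \<Omega> D // net_rel (moderate \<Omega> D) (negligible_nets \<Omega> D)"
    using assms(1) by (simp add: gen_def)
  note u = quotient_memD[OF equiv_gen q assms(2)] and v = quotient_memD[OF equiv_gen q assms(3)]
  show "u \<in> moderate \<Omega> D" by (rule u)
  show "u - v \<in> negligible_nets \<Omega> D"
    using net_class_eq_iff[OF equiv_gen u(1) v(1)] u(2) v(2) by simp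
qed

end

section \<open>Generalized numbers\<close>

lemma rt_moderate_iff: "x \<in> rt_moderate \<longleftrightarrow> moderate_on {()} (\<lambda>\<epsilon> _. x \<epsilon>)"
proof
  assume "x \<in> rt_moderate"
  then obtain N where "x \<in> O[at_right 0](\<lambda>\<epsilon>. (1 / \<epsilon>) ^ N)" by (auto simp: rt_moderate_def)
  then obtain c where "\<forall>\<^sub>F \<epsilon> in at_right 0. norm (x \<epsilon>) \<le> c * norm ((1 / \<epsilon>) ^ N)" by (rule landau_o.bigE)
  with eventually_at_right_0_le[OF zero_less_one]
  have "\<forall>\<^sub>F \<epsilon> in at_right 0. \<forall>_\<in>{()}. \<bar>x \<epsilon>\<bar> \<le> c * (1 / \<epsilon>) ^ N"
    by eventually_elim simp
  then show "moderate_on {()} (\<lambda>\<epsilon> _. x \<epsilon>)" unfolding moderate_on_def bigO_on_def by blast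
next
  assume "moderate_on {()} (\<lambda>\<epsilon> _. x \<epsilon>)"
  then obtain N where N: "\<forall>\<^sub>F \<epsilon> in at_right 0. \<forall>_\<in>{()}. \<bar>x \<epsilon>\<bar> \<le> (1 / \<epsilon>) ^ N"
    by (rule moderate_onE)
  have "x \<in> O[at_right 0](\<lambda>\<epsilon>. (1 / \<epsilon>) ^ N)"
    by (rule bigoI[of _ 1], rule eventually_mono[OF N]) (auto intro: order_trans[OF _ abs_ge_self])
  then show "x \<in> rt_moderate" by (auto simp: rt_moderate_def)
qed

lemma rt_negligible_iff: "x \<in> rt_negligible \<longleftrightarrow> negligible_on {()} (\<lambda>\<epsilon> _. x \<epsilon>)"
proof
  assume x: "x \<in> rt_negligible"
  show "negligible_on {()} (\<lambda>\<epsilon> _. x \<epsilon>)"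
    unfolding negligible_on_def bigO_on_def
  proof
    fix m
    have "x \<in> O[at_right 0](\<lambda>\<epsilon>. \<epsilon> ^ m)" using x by (auto simp: rt_negligible_def)
    then obtain c where "\<forall>\<^sub>F \<epsilon> in at_right 0. norm (x \<epsilon>) \<le> c * norm (\<epsilon> ^ m)" by (rule landau_o.bigE)
    with eventually_at_right_0_le[OF zero_less_one]
    have "\<forall>\<^sub>F \<epsilon> in at_right 0. \<forall>_\<in>{()}. \<bar>x \<epsilon>\<bar> \<le> c * \<epsilon> ^ m"
      by eventually_elim simp
    then show "\<exists>C. \<forall>\<^sub>F \<epsilon> in at_right 0. \<forall>_\<in>{()}. \<bar>x \<epsilon>\<bar> \<le> C * \<epsilon> ^ m" by blast
  qed
next
  assume x: "negligible_on {()} (\<lambda>\<epsilon> _. x \<epsilon>)"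
  have "x \<in> O[at_right 0](\<lambda>\<epsilon>. \<epsilon> ^ m)" for m
    by (rule bigoI[of _ 1], rule eventually_mono[OF negligible_onD[OF x, of m]])
      (auto intro: order_trans[OF _ abs_ge_self])
  then show "x \<in> rt_negligible" by (auto simp: rt_negligible_def)
qed

lemma rt_negligible_add:
  "x \<in> rt_negligible \<Longrightarrow> y \<in> rt_negligible \<Longrightarrow> (\<lambda>\<epsilon>. x \<epsilon> + y \<epsilon>) \<in> rt_negligible"
  unfolding rt_negligible_iff by (rule negligible_on_add)

lemma rt_negligible_minus: "x \<in> rt_negligible \<Longrightarrow> (\<lambda>\<epsilon>. - x \<epsilon>) \<in> rt_negligible"
  unfolding rt_negligible_iff negligible_on_iff by simp

lemma rt_negligible_diff:
  "x \<in> rt_negligible \<Longrightarrow> y \<in> rt_negligible \<Longrightarrow> (\<lambda>\<epsilon>. x \<epsilon> - y \<epsilon>) \<in> rt_negligible"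
  using rt_negligible_add[of x "\<lambda>\<epsilon>. - y \<epsilon>"] rt_negligible_minus[of y] by simp

lemma rt_negligible_abs: "x \<in> rt_negligible \<Longrightarrow> (\<lambda>\<epsilon>. \<bar>x \<epsilon>\<bar>) \<in> rt_negligible"
  unfolding rt_negligible_iff by (rule negligible_on_abs)

lemma zero_rt_negligible: "(\<lambda>\<epsilon>. 0) \<in> rt_negligible"
  unfolding rt_negligible_iff by (rule negligible_on_zero)

lemma rt_negligible_moderate: "x \<in> rt_negligible \<Longrightarrow> x \<in> rt_moderate"
  unfolding rt_negligible_iff rt_moderate_iff by (rule negligible_imp_moderate_on)

lemma rt_moderate_add:
  "x \<in> rt_moderate \<Longrightarrow> y \<in> rt_moderate \<Longrightarrow> (\<lambda>\<epsilon>. x \<epsilon> + y \<epsilon>) \<in> rt_moderate"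
  unfolding rt_moderate_iff by (rule moderate_on_add)

lemma rt_moderate_diff:
  "x \<in> rt_moderate \<Longrightarrow> y \<in> rt_moderate \<Longrightarrow> (\<lambda>\<epsilon>. x \<epsilon> - y \<epsilon>) \<in> rt_moderate"
  using moderate_on_add[of "{()}" "\<lambda>\<epsilon> _. x \<epsilon>" "\<lambda>\<epsilon> _. - y \<epsilon>"]
  unfolding rt_moderate_iff by (simp add: moderate_on_iff)

lemma equiv_rt: "equiv rt_moderate (net_rel rt_moderate rt_negligible)"
proof (rule net_rel_equivI)
  fix u v w :: "real \<Rightarrow> real"
  show "u - u \<in> rt_negligible" using zero_rt_negligible by (simp add: fun_diff_def)
  show "v - u \<in> rt_negligible" if "u - v \<in> rt_negligible"
    using rt_negligible_minus[OF that] by (simp add: fun_diff_def)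
  show "u - w \<in> rt_negligible" if "u - v \<in> rt_negligible" "v - w \<in> rt_negligible"
    using rt_negligible_add[OF that] by (simp add: fun_diff_def)
qed

lemma rep_rt_class:
  assumes "x \<in> rt_moderate"
  shows "rep (rt_class x) \<in> rt_moderate" "(\<lambda>\<epsilon>. rep (rt_class x) \<epsilon> - x \<epsilon>) \<in> rt_negligible"
  using rep_net_class[OF equiv_rt assms] by (auto simp: rt_class_def fun_diff_def)

lemma rt_class_zeroD:
  assumes "rt_class x = rt_zero"
  shows "x \<in> rt_negligible"
proof -
  have "(\<lambda>\<epsilon>. 0) \<in> rt_zero"
    unfolding rt_zero_def rt_class_def mem_net_class
    using zero_rt_negligible rt_negligible_moderate by (auto simp: fun_diff_def)
  then have "(\<lambda>\<epsilon>. 0) \<in> rt_class x" using assms by simp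
  then show ?thesis by (simp add: rt_class_def mem_net_class fun_diff_def)
qed

text \<open>The order on generalized numbers is the pointwise order of any representatives up to a negligible
  error; the following two lemmas are the two directions.\<close>

lemma rt_nonneg_classD:
  assumes "rt_nonneg (rt_class x)"
  obtains n where "n \<in> rt_negligible" "\<And>\<epsilon>. 0 < \<epsilon> \<Longrightarrow> \<epsilon> \<le> 1 \<Longrightarrow> 0 \<le> n \<epsilon> \<and> - n \<epsilon> \<le> x \<epsilon>"
proof -
  obtain y where y: "y \<in> rt_class x" "\<And>\<epsilon>. 0 < \<epsilon> \<Longrightarrow> \<epsilon> \<le> 1 \<Longrightarrow> 0 \<le> y \<epsilon>"
    using assms by (auto simp: rt_nonneg_def)
  then have "(\<lambda>\<epsilon>. \<bar>x \<epsilon> - y \<epsilon>\<bar>) \<in> rt_negligible"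
    by (intro rt_negligible_abs) (simp add: rt_class_def mem_net_class fun_diff_def)
  then show ?thesis
  proof (rule that)
    fix \<epsilon> :: real assume "0 < \<epsilon>" "\<epsilon> \<le> 1"
    then show "0 \<le> \<bar>x \<epsilon> - y \<epsilon>\<bar> \<and> - \<bar>x \<epsilon> - y \<epsilon>\<bar> \<le> x \<epsilon>" using y(2)[of \<epsilon>] by linarith
  qed
qed

lemma rt_nonneg_classI:
  assumes "x \<in> rt_moderate" "n \<in> rt_negligible" "\<And>\<epsilon>. 0 < \<epsilon> \<Longrightarrow> \<epsilon> \<le> 1 \<Longrightarrow> - n \<epsilon> \<le> x \<epsilon>"
  shows "rt_nonneg (rt_class x)"
proof -
  let ?y = "\<lambda>\<epsilon>. x \<epsilon> + \<bar>n \<epsilon>\<bar>"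
  have "?y \<in> rt_class x"
    unfolding rt_class_def mem_net_class
    using assms(1) rt_negligible_minus[OF rt_negligible_abs[OF assms(2)]]
      rt_moderate_add[OF assms(1) rt_negligible_moderate[OF rt_negligible_abs[OF assms(2)]]]
    by (simp add: fun_diff_def)
  moreover have "0 \<le> ?y \<epsilon>" if "0 < \<epsilon>" "\<epsilon> \<le> 1" for \<epsilon>
    using assms(3)[OF that] by linarith
  ultimately show ?thesis unfolding rt_nonneg_def by (intro bexI[of _ ?y]) auto
qed

section \<open>Boundary values\<close>

lemma smooth_domain_cylinder:
  assumes "boundary_chart \<Omega> U \<Phi> \<Psi> b"
  shows "smooth_domain (cylinder U \<Phi> b) (cylinder U \<Phi> b)"
proof
  have "open ((\<lambda>y. y - (y \<bullet> b) *\<^sub>R b) -` (\<Phi> ` U))"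
    using assms by (intro open_vimage) (auto simp: boundary_chart_def intro!: continuous_intros)
  then show "open (cylinder U \<Phi> b)" by (simp add: cylinder_def vimage_def)
qed (auto simp: closure_def)

lemma chart_expr_lincomb:
  "chart_expr \<Psi> b (\<lambda>\<epsilon> x. c \<epsilon> * u \<epsilon> x + d \<epsilon> * v \<epsilon> x)
     = (\<lambda>\<epsilon> y. c \<epsilon> * chart_expr \<Psi> b u \<epsilon> y + d \<epsilon> * chart_expr \<Psi> b v \<epsilon> y)"
  by (simp add: chart_expr_def fun_eq_iff)

lemma bd_moderate_lincomb:
  assumes "u \<in> bd_moderate \<Omega>" "v \<in> bd_moderate \<Omega>"
    and "\<And>\<epsilon>. \<epsilon> \<in> {0<..1} \<Longrightarrow> \<bar>a \<epsilon>\<bar> \<le> 1 \<and> \<bar>b \<epsilon>\<bar> \<le> 1"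
  shows "(\<lambda>\<epsilon> x. a \<epsilon> * u \<epsilon> x + b \<epsilon> * v \<epsilon> x) \<in> bd_moderate \<Omega>"
  unfolding bd_moderate_def mem_Collect_eq chart_expr_lincomb
  using assms by (intro allI impI smooth_domain.moderate_lincomb smooth_domain_cylinder)
    (auto simp: bd_moderate_def)

lemma bd_negligible_lincomb:
  assumes "u \<in> bd_negligible \<Omega>" "v \<in> bd_negligible \<Omega>"
    and "\<And>\<epsilon>. \<epsilon> \<in> {0<..1} \<Longrightarrow> \<bar>a \<epsilon>\<bar> \<le> 1 \<and> \<bar>b \<epsilon>\<bar> \<le> 1"
  shows "(\<lambda>\<epsilon> x. a \<epsilon> * u \<epsilon> x + b \<epsilon> * v \<epsilon> x) \<in> bd_negligible \<Omega>"
  unfolding bd_negligible_def mem_Collect_eq chart_expr_lincomb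
  using assms by (intro allI impI smooth_domain.negligible_lincomb smooth_domain_cylinder)
    (auto simp: bd_negligible_def)

lemma zero_bd_negligible: "(\<lambda>\<epsilon> x. 0) \<in> bd_negligible \<Omega>"
proof -
  have "chart_expr \<Psi> b (\<lambda>\<epsilon> x. 0) = (\<lambda>\<epsilon> y. 0)" for \<Psi> :: "'a \<Rightarrow> 'a" and b
    by (simp add: chart_expr_def fun_eq_iff)
  then show ?thesis
    unfolding bd_negligible_def
    by (auto intro: smooth_domain.zero_negligible smooth_domain_cylinder)
qed

lemma bd_negligible_moderate: "u \<in> bd_negligible \<Omega> \<Longrightarrow> u \<in> bd_moderate \<Omega>"
  unfolding bd_negligible_def bd_moderate_def by (auto intro: negligible_nets_moderate)

lemma bd_negligible_diff:
  assumes "u \<in> bd_negligible \<Omega>" "v \<in> bd_negligible \<Omega>"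
  shows "u - v \<in> bd_negligible \<Omega>"
  unfolding net_diff[of u v]
  using bd_negligible_lincomb[OF assms, of "\<lambda>_. 1" "\<lambda>_. - 1"] by simp

lemma equiv_bd: "equiv (bd_moderate \<Omega>) (net_rel (bd_moderate \<Omega>) (bd_negligible \<Omega>))"
proof (rule net_rel_equivI)
  fix u v w :: "real \<Rightarrow> 'a \<Rightarrow> real"
  show "u - u \<in> bd_negligible \<Omega>" using zero_bd_negligible by (simp add: fun_diff_def)
  show minus: "v - u \<in> bd_negligible \<Omega>" if "u - v \<in> bd_negligible \<Omega>" for u v
    using bd_negligible_diff[OF zero_bd_negligible that] by (simp add: fun_diff_def)
  show "u - w \<in> bd_negligible \<Omega>" if "u - v \<in> bd_negligible \<Omega>" "v - w \<in> bd_negligible \<Omega>"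
    using bd_negligible_diff[OF that(1) minus[OF that(2)]] by (simp add: fun_diff_def)
qed

text \<open>A net that is not moderate is related to no net at all, so that its class is empty and not an
  element of the quotient.\<close>

lemma gen_bd_memD:
  assumes "U \<in> gen_bd \<Omega>" "bd_class \<Omega> u = U"
  shows "u \<in> bd_moderate \<Omega>"
proof -
  have "U \<noteq> {}" using assms(1) in_quotient_imp_non_empty[OF equiv_bd] unfolding gen_bd_def by blast
  with assms(2) show ?thesis unfolding bd_class_def using mem_net_class by fast
qed

lemma gen_bd_zero_in: "gen_bd_zero \<Omega> \<in> gen_bd \<Omega>"
  unfolding gen_bd_zero_def bd_class_def gen_bd_def
  by (intro net_class_quotient bd_negligible_moderate zero_bd_negligible)

lemma bd_class_eq_iff:
  "u \<in> bd_moderate \<Omega> \<Longrightarrow> v \<in> bd_moderate \<Omega> \<Longrightarrow>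
    bd_class \<Omega> u = bd_class \<Omega> v \<longleftrightarrow> u - v \<in> bd_negligible \<Omega>"
  unfolding bd_class_def by (rule net_class_eq_iff[OF equiv_bd])

lemma bd_class_zeroD: "bd_class \<Omega> v = gen_bd_zero \<Omega> \<Longrightarrow> v \<in> bd_negligible \<Omega>"
  using bd_class_eq_iff[OF gen_bd_memD[OF gen_bd_zero_in] bd_negligible_moderate[OF zero_bd_negligible]]
  by (auto simp: gen_bd_zero_def fun_diff_def)

lemma bd_class_zeroI:
  assumes "v \<in> bd_negligible \<Omega>"
  shows "bd_class \<Omega> v = gen_bd_zero \<Omega>"
proof -
  have "v - (\<lambda>\<epsilon> x. 0) = v" by (simp add: fun_eq_iff)
  then show ?thesis
    using assms bd_class_eq_iff[OF bd_negligible_moderate[OF assms]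
        bd_negligible_moderate[OF zero_bd_negligible]] by (simp add: gen_bd_zero_def)
qed

lemma smooth_domain_closure: "open \<Omega> \<Longrightarrow> smooth_domain \<Omega> (closure \<Omega>)"
  by unfold_locales (auto intro: closure_subset[THEN subsetD])

text \<open>The chosen representative of \<open>w i\<close> and the one whose restriction represents \<open>u\<^sub>0 i\<close> may be
  different; computations use the former, boundary values the latter.\<close>

lemma admissible_memE:
  assumes "open \<Omega>" "w \<in> admissible \<Omega> u\<^sub>0" "\<And>i. u\<^sub>0 i \<in> gen_bd \<Omega>"
  obtains x where "x \<in> w i" "bd_class \<Omega> x = u\<^sub>0 i" "x \<in> bd_moderate \<Omega>"
    "x \<in> moderate \<Omega> (closure \<Omega>)" "rep (w i) - x \<in> negligible_nets \<Omega> (closure \<Omega>)"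
    "rep (w i) \<in> moderate \<Omega> (closure \<Omega>)"
proof -
  interpret smooth_domain \<Omega> "closure \<Omega>" by (rule smooth_domain_closure[OF assms(1)])
  have g: "w i \<in> gen \<Omega> (closure \<Omega>)" and "restricts_to \<Omega> (w i) (u\<^sub>0 i)"
    using assms(2) by (auto simp: admissible_def)
  then obtain x where x: "x \<in> w i" "bd_class \<Omega> x = u\<^sub>0 i" by (auto simp: restricts_to_def)
  show ?thesis
    using x gen_bd_memD[OF assms(3) x(2)] gen_mem_diff(1)[OF g x(1) x(1)]
      gen_mem_diff(2)[OF g rep_gen(1)[OF g] x(1)] rep_gen(2)[OF g] by (rule that)
qed

lemma admissible_diff:
  assumes "open \<Omega>" "u \<in> admissible \<Omega> u\<^sub>0" "w \<in> admissible \<Omega> u\<^sub>0" "\<And>i. u\<^sub>0 i \<in> gen_bd \<Omega>"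
  shows "(\<lambda>i. gen_class \<Omega> (closure \<Omega>) (rep (w i) - rep (u i))) \<in> admissible_zero \<Omega>"
  unfolding admissible_zero_def admissible_def mem_Collect_eq
proof (intro allI conjI)
  interpret smooth_domain \<Omega> "closure \<Omega>" by (rule smooth_domain_closure[OF assms(1)])
  fix i
  obtain x where x: "x \<in> u i" "bd_class \<Omega> x = u\<^sub>0 i" "x \<in> bd_moderate \<Omega>"
    "x \<in> moderate \<Omega> (closure \<Omega>)" "rep (u i) - x \<in> negligible_nets \<Omega> (closure \<Omega>)"
    "rep (u i) \<in> moderate \<Omega> (closure \<Omega>)"
    using assms(1,2,4) by (rule admissible_memE)
  obtain y where y: "y \<in> w i" "bd_class \<Omega> y = u\<^sub>0 i" "y \<in> bd_moderate \<Omega>"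
    "y \<in> moderate \<Omega> (closure \<Omega>)" "rep (w i) - y \<in> negligible_nets \<Omega> (closure \<Omega>)"
    "rep (w i) \<in> moderate \<Omega> (closure \<Omega>)"
    using assms(1,3,4) by (rule admissible_memE)
  have m: "rep (w i) - rep (u i) \<in> moderate \<Omega> (closure \<Omega>)" by (rule moderate_diff[OF y(6) x(6)])
  then show "gen_class \<Omega> (closure \<Omega>) (rep (w i) - rep (u i)) \<in> gen \<Omega> (closure \<Omega>)"
    by (rule gen_class_in)
  have "rep (w i) - rep (u i) - (y - x) \<in> negligible_nets \<Omega> (closure \<Omega>)"
    using negligible_diff[OF y(5) x(5)] by (simp add: fun_diff_def algebra_simps)
  then have "y - x \<in> gen_class \<Omega> (closure \<Omega>) (rep (w i) - rep (u i))"
    unfolding gen_class_def mem_net_class using m moderate_diff[OF y(4) x(4)] by simp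
  moreover have "bd_class \<Omega> (y - x) = gen_bd_zero \<Omega>"
    using bd_class_eq_iff[OF y(3) x(3)] x(2) y(2) by (intro bd_class_zeroI) simp
  ultimately show "restricts_to \<Omega> (gen_class \<Omega> (closure \<Omega>) (rep (w i) - rep (u i))) (gen_bd_zero \<Omega>)"
    unfolding restricts_to_def by blast
qed

text \<open>The affine space of admissible functions contains \<open>u + s v\<close> also for a generalized number \<open>s\<close>,
  which is what makes the uniform bound for the second variation possible.\<close>

lemma admissible_add_scaled:
  assumes "open \<Omega>" "u \<in> admissible \<Omega> u\<^sub>0" "v \<in> admissible_zero \<Omega>" "\<And>i. u\<^sub>0 i \<in> gen_bd \<Omega>"
    and s: "\<And>\<epsilon>. \<epsilon> \<in> {0<..1} \<Longrightarrow> \<bar>s \<epsilon>\<bar> \<le> 1"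
  shows "(\<lambda>i. gen_class \<Omega> (closure \<Omega>) (\<lambda>\<epsilon> x. rep (u i) \<epsilon> x + s \<epsilon> * rep (v i) \<epsilon> x)) \<in> admissible \<Omega> u\<^sub>0"
  unfolding admissible_def mem_Collect_eq
proof (intro allI conjI)
  interpret smooth_domain \<Omega> "closure \<Omega>" by (rule smooth_domain_closure[OF assms(1)])
  fix i
  obtain x where x: "x \<in> u i" "bd_class \<Omega> x = u\<^sub>0 i" "x \<in> bd_moderate \<Omega>"
    "x \<in> moderate \<Omega> (closure \<Omega>)" "rep (u i) - x \<in> negligible_nets \<Omega> (closure \<Omega>)"
    "rep (u i) \<in> moderate \<Omega> (closure \<Omega>)"
    using assms(1,2,4) by (rule admissible_memE)
  obtain y where y: "y \<in> v i" "bd_class \<Omega> y = gen_bd_zero \<Omega>" "y \<in> bd_moderate \<Omega>"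
    "y \<in> moderate \<Omega> (closure \<Omega>)" "rep (v i) - y \<in> negligible_nets \<Omega> (closure \<Omega>)"
    "rep (v i) \<in> moderate \<Omega> (closure \<Omega>)"
    using assms(1) assms(3)[unfolded admissible_zero_def] gen_bd_zero_in by (rule admissible_memE)
  let ?z = "\<lambda>\<epsilon> x. rep (u i) \<epsilon> x + s \<epsilon> * rep (v i) \<epsilon> x"
  let ?z' = "\<lambda>\<epsilon> t. x \<epsilon> t + s \<epsilon> * y \<epsilon> t"
  have m: "?z \<in> moderate \<Omega> (closure \<Omega>)" "?z' \<in> moderate \<Omega> (closure \<Omega>)"
    using moderate_lincomb[OF x(6) y(6), of "\<lambda>_. 1" s] moderate_lincomb[OF x(4) y(4), of "\<lambda>_. 1" s] s
    by auto
  then show "gen_class \<Omega> (closure \<Omega>) ?z \<in> gen \<Omega> (closure \<Omega>)"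
    by (intro gen_class_in)
  have "?z - ?z' \<in> negligible_nets \<Omega> (closure \<Omega>)"
    using negligible_lincomb[OF x(5) y(5), of "\<lambda>_. 1" s] s by (simp add: fun_diff_def algebra_simps)
  then have "?z' \<in> gen_class \<Omega> (closure \<Omega>) ?z"
    unfolding gen_class_def mem_net_class using m by simp
  moreover have "bd_class \<Omega> ?z' = u\<^sub>0 i"
  proof -
    have "?z' \<in> bd_moderate \<Omega>"
      using bd_moderate_lincomb[OF x(3) y(3), of "\<lambda>_. 1" s] s by auto
    moreover have "?z' - x \<in> bd_negligible \<Omega>"
      using bd_negligible_lincomb[OF bd_class_zeroD[OF y(2)] zero_bd_negligible, of s "\<lambda>_. 1"] s
      by (simp add: fun_diff_def)
    ultimately show ?thesis using bd_class_eq_iff x(2,3) by blast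
  qed
  ultimately show "restricts_to \<Omega> (gen_class \<Omega> (closure \<Omega>) ?z) (u\<^sub>0 i)"
    unfolding restricts_to_def by blast
qed

section \<open>Higher directional derivatives\<close>

text \<open>The multilinear form \<open>D\<^sup>kf(z)(d\<^sub>1, \<dots>, d\<^sub>k)\<close>, expanded in coordinates.\<close>

primrec dirderiv :: "'a::euclidean_space list \<Rightarrow> ('a \<Rightarrow> real) \<Rightarrow> 'a \<Rightarrow> real" where
  "dirderiv [] f z = f z"
| "dirderiv (d # ds) f z = (\<Sum>b\<in>Basis. (d \<bullet> b) * dirderiv ds (partial b f) z)"

text \<open>The sum of the absolute values of all partial derivatives of order \<open>k\<close>, mixed ones counted once for
  each order of differentiation.\<close>

primrec deriv_size :: "nat \<Rightarrow> ('a::euclidean_space \<Rightarrow> real) \<Rightarrow> 'a \<Rightarrow> real" where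
  "deriv_size 0 f z = \<bar>f z\<bar>"
| "deriv_size (Suc k) f z = (\<Sum>b\<in>Basis. deriv_size k (partial b f) z)"

lemma deriv_size_nonneg: "0 \<le> deriv_size k f z"
  by (induction k arbitrary: f) (auto intro: sum_nonneg)

text \<open>The recursion evaluates a function only at its end, and differentiating there along \<open>e\<close> adds
  \<open>e\<close> behind the other directions. In this position no symmetry of the form is needed.\<close>

lemma dirderiv_has_derivative:
  assumes "smooth S f" "open S" "z + t *\<^sub>R e \<in> S"
  shows "((\<lambda>t. dirderiv ds f (z + t *\<^sub>R e)) has_real_derivative
            dirderiv (ds @ [e]) f (z + t *\<^sub>R e)) (at t)"
  using assms(1)
proof (induction ds arbitrary: f)
  case Nil
  then show ?case using smooth_line_derivative[OF Nil assms(2,3)] by simp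
next
  case (Cons d ds)
  show ?case
    unfolding dirderiv.simps append_Cons
    by (intro DERIV_sum DERIV_cmult Cons.IH smooth_partial[OF Cons.prems])
qed

lemma dirderiv_continuous_on:
  assumes "smooth S f" "continuous_on T z" "z ` T \<subseteq> S" "continuous_on T d"
  shows "continuous_on T (\<lambda>x. dirderiv (replicate k (d x)) f (z x))"
  using assms(1)
proof (induction k arbitrary: f)
  case 0
  then show ?case
    using continuous_on_compose2[OF smooth_continuous_on[OF 0] assms(2,3)] by simp
next
  case (Suc k)
  show ?case
    unfolding replicate_Suc dirderiv.simps
    by (intro continuous_intros assms Suc.IH smooth_partial[OF Suc.prems])
qed

lemma abs_dirderiv_le:
  assumes "\<And>d. d \<in> set ds \<Longrightarrow> norm d \<le> R"
  shows "\<bar>dirderiv ds f z\<bar> \<le> R ^ length ds * deriv_size (length ds) f z"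
  using assms
proof (induction ds arbitrary: f)
  case (Cons d ds)
  have R: "norm d \<le> R" using Cons.prems[of d] by simp
  with norm_ge_zero[of d] have R0: "0 \<le> R" by linarith
  have "\<bar>dirderiv (d # ds) f z\<bar> \<le> (\<Sum>b\<in>Basis. \<bar>d \<bullet> b\<bar> * \<bar>dirderiv ds (partial b f) z\<bar>)"
    using sum_abs[of "\<lambda>b. (d \<bullet> b) * dirderiv ds (partial b f) z" Basis] by (simp add: abs_mult)
  also have "\<dots> \<le> (\<Sum>b\<in>Basis. R * (R ^ length ds * deriv_size (length ds) (partial b f) z))"
  proof (intro sum_mono mult_mono)
    fix b :: 'a assume "b \<in> Basis"
    then show "\<bar>d \<bullet> b\<bar> \<le> R" using Basis_le_norm[of b d] R by linarith
    show "\<bar>dirderiv ds (partial b f) z\<bar> \<le> R ^ length ds * deriv_size (length ds) (partial b f) z"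
      using Cons by simp
  qed (use R0 deriv_size_nonneg in auto)
  finally show ?case by (simp add: sum_distrib_left mult.assoc)
qed simp

text \<open>The mean value theorem along the segment from \<open>z\<close> to \<open>z + e\<close>. The direction \<open>e\<close> is estimated
  separately from the other directions because \<open>e\<close> will be negligible while these are only moderate.\<close>

lemma dirderiv_diff_le:
  assumes "smooth S f" "open S" "\<And>t. 0 \<le> t \<Longrightarrow> t \<le> 1 \<Longrightarrow> z + t *\<^sub>R e \<in> S"
    and "\<And>d. d \<in> set ds \<Longrightarrow> norm d \<le> R"
  shows "\<exists>t\<in>{0..1}. \<bar>dirderiv ds f (z + e) - dirderiv ds f z\<bar>
           \<le> R ^ length ds * norm e * deriv_size (Suc (length ds)) f (z + t *\<^sub>R e)"
proof -
  obtain t where t: "0 < t" "t < 1"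
    "dirderiv ds f (z + 1 *\<^sub>R e) - dirderiv ds f (z + 0 *\<^sub>R e)
       = (1 - 0) * dirderiv (ds @ [e]) f (z + t *\<^sub>R e)"
    using MVT2[of 0 1 "\<lambda>t. dirderiv ds f (z + t *\<^sub>R e)" "\<lambda>t. dirderiv (ds @ [e]) f (z + t *\<^sub>R e)"]
      dirderiv_has_derivative[OF assms(1,2)] assms(3) by auto
  have *: "\<bar>dirderiv (ds @ [e]) g y\<bar> \<le> R ^ length ds * norm e * deriv_size (Suc (length ds)) g y" for g y
    using assms(4)
  proof (induction ds arbitrary: g)
    case Nil
    show ?case using abs_dirderiv_le[of "[e]" "norm e" g y] by simp
  next
    case (Cons d ds)
    have R: "norm d \<le> R" using Cons.prems[of d] by simp
  with norm_ge_zero[of d] have R0: "0 \<le> R" by linarith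
    have "\<bar>dirderiv ((d # ds) @ [e]) g y\<bar> \<le> (\<Sum>b\<in>Basis. \<bar>d \<bullet> b\<bar> * \<bar>dirderiv (ds @ [e]) (partial b g) y\<bar>)"
      using sum_abs[of "\<lambda>b. (d \<bullet> b) * dirderiv (ds @ [e]) (partial b g) y" Basis] by (simp add: abs_mult)
    also have "\<dots> \<le> (\<Sum>b\<in>Basis. R * (R ^ length ds * norm e * deriv_size (Suc (length ds)) (partial b g) y))"
    proof (intro sum_mono mult_mono)
      fix b :: 'a assume "b \<in> Basis"
      then show "\<bar>d \<bullet> b\<bar> \<le> R" using Basis_le_norm[of b d] R by linarith
      show "\<bar>dirderiv (ds @ [e]) (partial b g) y\<bar>
          \<le> R ^ length ds * norm e * deriv_size (Suc (length ds)) (partial b g) y"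
        using Cons by (simp del: deriv_size.simps)
    qed (use R0 deriv_size_nonneg in auto)
    also have "\<dots> = R ^ length (d # ds) * norm e * deriv_size (Suc (length (d # ds))) g y"
      unfolding deriv_size.simps(2)[of "Suc (length ds)" g] length_Cons
      by (simp only: sum_distrib_left power_Suc mult_ac)
    finally show ?case .
  qed
  show ?thesis using t *[of f "z + t *\<^sub>R e"] by (intro bexI[of _ t]) auto
qed

section \<open>Locally bounded and tempered derivatives\<close>

text \<open>Two kinds of estimates are needed on the jet space: bounds on bounded sets for a single \<open>\<epsilon>\<close>, to
  differentiate under the integral, and tempered bounds for the asymptotics as \<open>\<epsilon> \<rightarrow> 0\<close>.\<close>

definition locally_bounded_on :: "'a::real_normed_vector set \<Rightarrow> ('a \<Rightarrow> real) \<Rightarrow> bool" where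
  "locally_bounded_on S f \<longleftrightarrow> (\<forall>R. \<exists>B. \<forall>z\<in>S. norm z \<le> R \<longrightarrow> \<bar>f z\<bar> \<le> B)"

definition tempered_on :: "'a::real_normed_vector set \<Rightarrow> (real \<Rightarrow> 'a \<Rightarrow> real) \<Rightarrow> bool" where
  "tempered_on S f \<longleftrightarrow> (\<exists>N::nat. moderate_on S (\<lambda>\<epsilon> z. f \<epsilon> z / (1 + norm z) ^ N))"

lemma locally_bounded_on_sum:
  "(\<And>i. i \<in> I \<Longrightarrow> locally_bounded_on S (f i)) \<Longrightarrow> locally_bounded_on S (\<lambda>z. \<Sum>i\<in>I. f i z)"
proof (induction I rule: infinite_finite_induct)
  case (insert i I)
  show ?case
    unfolding locally_bounded_on_def
  proof
    fix R
    obtain B where B: "\<forall>z\<in>S. norm z \<le> R \<longrightarrow> \<bar>f i z\<bar> \<le> B"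
      using insert.prems[of i] unfolding locally_bounded_on_def by blast
    obtain C where C: "\<forall>z\<in>S. norm z \<le> R \<longrightarrow> \<bar>\<Sum>i\<in>I. f i z\<bar> \<le> C"
      using insert unfolding locally_bounded_on_def by blast
    show "\<exists>B. \<forall>z\<in>S. norm z \<le> R \<longrightarrow> \<bar>\<Sum>i\<in>insert i I. f i z\<bar> \<le> B"
      using B C insert(1,2) by (intro exI[of _ "B + C"]) (simp, smt (verit))
  qed
qed (auto simp: locally_bounded_on_def)

text \<open>Raising the exponent makes the exponents of finitely many tempered nets equal.\<close>

lemma tempered_on_weaken:
  assumes "moderate_on S (\<lambda>\<epsilon> z. f \<epsilon> z / (1 + norm z) ^ M)" "M \<le> N"
  shows "moderate_on S (\<lambda>\<epsilon> z. f \<epsilon> z / (1 + norm z) ^ N)"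
proof (rule moderate_on_le[OF moderate_on_abs[OF assms(1)]])
  fix \<epsilon> :: real and z :: 'a
  have "(1 + norm z) ^ M \<le> (1 + norm z) ^ N" using assms(2) by (intro power_increasing) auto
  moreover have "0 < (1 + norm z) ^ M" by (intro zero_less_power add_pos_nonneg) auto
  ultimately show "\<bar>f \<epsilon> z / (1 + norm z) ^ N\<bar> \<le> \<bar>f \<epsilon> z / (1 + norm z) ^ M\<bar>"
    unfolding abs_divide by (intro frac_le) auto
qed

lemma tempered_on_sum:
  "(\<And>i. i \<in> I \<Longrightarrow> tempered_on S (f i)) \<Longrightarrow> tempered_on S (\<lambda>\<epsilon> z. \<Sum>i\<in>I. f i \<epsilon> z)"
proof (induction I rule: infinite_finite_induct)
  case (insert i I)
  obtain M where M: "moderate_on S (\<lambda>\<epsilon> z. f i \<epsilon> z / (1 + norm z) ^ M)"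
    using insert.prems[of i] unfolding tempered_on_def by blast
  obtain N where N: "moderate_on S (\<lambda>\<epsilon> z. (\<Sum>i\<in>I. f i \<epsilon> z) / (1 + norm z) ^ N)"
    using insert unfolding tempered_on_def by blast
  show ?case
    using moderate_on_add[OF tempered_on_weaken[OF M, of "M + N"] tempered_on_weaken[OF N, of "M + N"]]
      insert(1,2) unfolding tempered_on_def by (auto simp: add_divide_distrib intro: exI[of _ "M + N"])
qed (auto simp: tempered_on_def moderate_on_const)

lemma tempered_on_compose:
  assumes "tempered_on S f" "moderate_on K (\<lambda>\<epsilon> x. norm (z \<epsilon> x))"
    and "\<And>\<epsilon> x. 0 < \<epsilon> \<Longrightarrow> \<epsilon> \<le> 1 \<Longrightarrow> x \<in> K \<Longrightarrow> z \<epsilon> x \<in> S"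
  shows "moderate_on K (\<lambda>\<epsilon> x. f \<epsilon> (z \<epsilon> x))"
proof -
  obtain N where N: "moderate_on S (\<lambda>\<epsilon> z. f \<epsilon> z / (1 + norm z) ^ N)"
    using assms(1) unfolding tempered_on_def by blast
  have 1: "moderate_on K (\<lambda>\<epsilon> x. f \<epsilon> (z \<epsilon> x) / (1 + norm (z \<epsilon> x)) ^ N)"
    by (rule moderate_on_mono[OF N], rule eventually_mono[OF eventually_at_right_0_le[OF zero_less_one]])
      (use assms(3) in blast)
  have 2: "moderate_on K (\<lambda>\<epsilon> x. (1 + norm (z \<epsilon> x)) ^ N)"
    by (intro moderate_on_power moderate_on_add moderate_on_const assms(2))
  have "f \<epsilon> (z \<epsilon> x) / (1 + norm (z \<epsilon> x)) ^ N * (1 + norm (z \<epsilon> x)) ^ N = f \<epsilon> (z \<epsilon> x)" for \<epsilon> x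
  proof -
    have "1 + norm (z \<epsilon> x) \<noteq> 0" by (smt (verit) norm_ge_zero)
    then show ?thesis by simp
  qed
  then show ?thesis using moderate_on_mult[OF 1 2] by simp
qed

context smooth_domain begin

text \<open>The recursion of \<^const>\<open>deriv_size\<close> moves derivatives into the function, so the induction has to
  run over all iterated partial derivatives of \<open>f\<close>. In the base case they are rewritten as multi-index
  derivatives, which extend continuously to the closed set \<open>D\<close>.\<close>

lemma deriv_size_partials_locally_bounded:
  assumes "f \<in> Cinf \<Omega> D" "closed D" "set cs \<subseteq> Basis"
  shows "locally_bounded_on \<Omega> (deriv_size k (partials cs f))"
  using assms(3)
proof (induction k arbitrary: cs)
  case 0
  show ?case
    unfolding locally_bounded_on_def
  proof
    fix R
    have "compact (D \<inter> cball 0 R)" using assms(2) by (simp add: closed_Int_compact)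
    moreover have "continuous_on (D \<inter> cball 0 R) (ext_partial \<Omega> (count_list cs) f)"
      using Cinf_ext_partial[OF assms(1)] by (rule continuous_on_subset) auto
    ultimately have "bounded (ext_partial \<Omega> (count_list cs) f ` (D \<inter> cball 0 R))"
      by (intro compact_imp_bounded compact_continuous_image)
    then obtain B where B: "\<forall>z\<in>D \<inter> cball 0 R. \<bar>ext_partial \<Omega> (count_list cs) f z\<bar> \<le> B"
      unfolding bounded_iff by fastforce
    have "\<bar>deriv_size 0 (partials cs f) z\<bar> \<le> B" if "z \<in> \<Omega>" "norm z \<le> R" for z
    proof -
      have "partials cs f z = ext_partial \<Omega> (count_list cs) f z"
        using partials_eq_mpartial[OF Cinf_smooth[OF assms(1)] open_dom 0 that(1)]
        by (simp add: ext_partial_interior that(1))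
      then show ?thesis using B that dom_subset by auto
    qed
    then show "\<exists>B. \<forall>z\<in>\<Omega>. norm z \<le> R \<longrightarrow> \<bar>deriv_size 0 (partials cs f) z\<bar> \<le> B" by blast
  qed
next
  case (Suc k)
  have "locally_bounded_on \<Omega> (deriv_size k (partial b (partials cs f)))" if "b \<in> Basis" for b
    using Suc.IH[of "b # cs"] Suc.prems that by simp
  then show ?case unfolding deriv_size.simps by (rule locally_bounded_on_sum)
qed

lemma deriv_size_locally_bounded:
  "f \<in> Cinf \<Omega> D \<Longrightarrow> closed D \<Longrightarrow> locally_bounded_on \<Omega> (deriv_size k f)"
  using deriv_size_partials_locally_bounded[of f "[]"] by simp

lemma deriv_size_partials_tempered:
  assumes "\<And>\<epsilon>. \<epsilon> \<in> {0<..1} \<Longrightarrow> f \<epsilon> \<in> Cinf \<Omega> D"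
    and "\<And>\<beta>. tempered_on \<Omega> (\<lambda>\<epsilon>. mpartial \<beta> (f \<epsilon>))" "set cs \<subseteq> Basis"
  shows "tempered_on \<Omega> (\<lambda>\<epsilon>. deriv_size k (partials cs (f \<epsilon>)))"
  using assms(3)
proof (induction k arbitrary: cs)
  case 0
  obtain N where N: "moderate_on \<Omega> (\<lambda>\<epsilon> z. mpartial (count_list cs) (f \<epsilon>) z / (1 + norm z) ^ N)"
    using assms(2) unfolding tempered_on_def by blast
  have "moderate_on \<Omega> (\<lambda>\<epsilon> z. deriv_size 0 (partials cs (f \<epsilon>)) z / (1 + norm z) ^ N)"
  proof (rule moderate_on_le[OF moderate_on_abs[OF N]])
    fix \<epsilon> :: real and z assume "0 < \<epsilon>" "\<epsilon> \<le> 1" "z \<in> \<Omega>"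
    then show "\<bar>deriv_size 0 (partials cs (f \<epsilon>)) z / (1 + norm z) ^ N\<bar>
       \<le> \<bar>mpartial (count_list cs) (f \<epsilon>) z / (1 + norm z) ^ N\<bar>"
      using partials_eq_mpartial[OF Cinf_smooth[OF assms(1)] open_dom 0, of \<epsilon> z] by simp
  qed
  then show ?case unfolding tempered_on_def by blast
next
  case (Suc k)
  have "tempered_on \<Omega> (\<lambda>\<epsilon>. deriv_size k (partial b (partials cs (f \<epsilon>))))" if "b \<in> Basis" for b
    using Suc.IH[of "b # cs"] Suc.prems that by simp
  then show ?case unfolding deriv_size.simps by (rule tempered_on_sum)
qed

end

section \<open>Differentiation under the integral sign\<close>

lemma abs_set_integral_le:
  fixes f :: "'a \<Rightarrow> real"
  assumes "A \<in> sets M" "emeasure M A < \<infinity>" "0 \<le> B" "\<And>x. x \<in> A \<Longrightarrow> \<bar>f x\<bar> \<le> B"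
  shows "\<bar>LINT x:A|M. f x\<bar> \<le> B * measure M A"
proof (cases "set_integrable M A f")
  case True
  have "\<bar>LINT x:A|M. f x\<bar> \<le> (LINT x:A|M. \<bar>f x\<bar>)"
    using set_integral_norm_bound[OF True] by simp
  also have "\<dots> \<le> (LINT x:A|M. B)"
    using assms True by (intro set_integral_mono set_integrable_abs) (auto simp: set_integrable_def)
  also have "\<dots> = B * measure M A"
    using assms(1,2) by (simp add: set_lebesgue_integral_def)
  finally show ?thesis .
next
  case False
  then show ?thesis using assms(3)
    by (simp add: set_lebesgue_integral_def set_integrable_def not_integrable_integral_eq)
qed

lemma set_integrable_bounded_continuous:
  fixes f :: "'a::euclidean_space \<Rightarrow> real"
  assumes "open A" "bounded A" "continuous_on A f" "\<And>x. x \<in> A \<Longrightarrow> \<bar>f x\<bar> \<le> B"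
  shows "set_integrable lborel A f"
  unfolding set_integrable_def
proof (rule Bochner_Integration.integrable_bound)
  show "integrable lborel (\<lambda>x. indicator A x *\<^sub>R B)"
    using emeasure_bounded_finite[OF assms(2)] assms(1) by (intro integrable_scaleR_left) simp
  show "(\<lambda>x. indicator A x *\<^sub>R f x) \<in> borel_measurable lborel"
    using borel_measurable_continuous_on_indicator[of A f] assms(1,3) by simp
  show "AE x in lborel. norm (indicator A x *\<^sub>R f x) \<le> norm (indicator A x *\<^sub>R B)"
    by (rule AE_I2) (use assms(4) in \<open>force simp: indicator_def\<close>)
qed

text \<open>A bound for the second derivative that is uniform in \<open>x\<close> makes the error of the difference
  quotient \<open>O(h)\<close> uniformly in \<open>x\<close>, and this estimate can simply be integrated over a set of finite
  measure.\<close>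

lemma set_integral_has_derivative:
  fixes g0 g1 g2 :: "'a \<Rightarrow> real \<Rightarrow> real"
  assumes A: "A \<in> sets M" "emeasure M A < \<infinity>"
    and int: "\<And>s. set_integrable M A (\<lambda>x. g0 x s)" "\<And>s. set_integrable M A (\<lambda>x. g1 x s)"
    and d0: "\<And>x s. x \<in> A \<Longrightarrow> (g0 x has_real_derivative g1 x s) (at s)"
    and d1: "\<And>x s. x \<in> A \<Longrightarrow> (g1 x has_real_derivative g2 x s) (at s)"
    and B: "\<And>x t. x \<in> A \<Longrightarrow> \<bar>t - s\<bar> \<le> 1 \<Longrightarrow> \<bar>g2 x t\<bar> \<le> B" "0 \<le> B"
  shows "((\<lambda>s. LINT x:A|M. g0 x s) has_real_derivative (LINT x:A|M. g1 x s)) (at s)"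
proof -
  let ?I0 = "\<lambda>s. LINT x:A|M. g0 x s" and ?I1 = "LINT x:A|M. g1 x s"
  have taylor: "\<bar>g0 x (s + h) - g0 x s - h * g1 x s\<bar> \<le> B * h\<^sup>2" if x: "x \<in> A" and h: "\<bar>h\<bar> \<le> 1" for x h
  proof -
    \<comment> \<open>The mean value theorem without a case distinction on the sign of \<open>h\<close>.\<close>
    have mv: "\<exists>\<xi>. \<bar>\<xi> - s\<bar> \<le> \<bar>h\<bar> \<and> g (s + h) - g s = h * g' \<xi>"
      if "\<And>t. (g has_real_derivative g' t) (at t)" for g g' :: "real \<Rightarrow> real" and h
    proof (cases h "0 :: real" rule: linorder_cases)
      case less
      have "\<exists>\<xi>>s + h. \<xi> < s \<and> g s - g (s + h) = (s - (s + h)) * g' \<xi>"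
        using less that by (intro MVT2) auto
      then obtain \<xi> where "s + h < \<xi>" "\<xi> < s" "g s - g (s + h) = (s - (s + h)) * g' \<xi>" by blast
      then show ?thesis by (intro exI[of _ \<xi>]) auto
    next
      case greater
      have "\<exists>\<xi>>s. \<xi> < s + h \<and> g (s + h) - g s = ((s + h) - s) * g' \<xi>"
        using greater that by (intro MVT2) auto
      then obtain \<xi> where "s < \<xi>" "\<xi> < s + h" "g (s + h) - g s = ((s + h) - s) * g' \<xi>" by blast
      then show ?thesis by (intro exI[of _ \<xi>]) auto
    qed auto
    obtain \<xi> where \<xi>: "\<bar>\<xi> - s\<bar> \<le> \<bar>h\<bar>" "g0 x (s + h) - g0 x s = h * g1 x \<xi>"
      using mv[of "g0 x" "g1 x" h] d0[OF x] by blast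
    obtain \<eta> where \<eta>: "\<bar>\<eta> - s\<bar> \<le> \<bar>\<xi> - s\<bar>" "g1 x (s + (\<xi> - s)) - g1 x s = (\<xi> - s) * g2 x \<eta>"
      using mv[of "g1 x" "g2 x" "\<xi> - s"] d1[OF x] by blast
    have "g0 x (s + h) - g0 x s - h * g1 x s = h * (g1 x \<xi> - g1 x s)"
      using \<xi>(2) by (simp add: algebra_simps)
    also have "\<dots> = h * ((\<xi> - s) * g2 x \<eta>)" using \<eta>(2) by simp
    finally have "g0 x (s + h) - g0 x s - h * g1 x s = h * ((\<xi> - s) * g2 x \<eta>)" .
    then have "\<bar>g0 x (s + h) - g0 x s - h * g1 x s\<bar> = \<bar>h\<bar> * (\<bar>\<xi> - s\<bar> * \<bar>g2 x \<eta>\<bar>)"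
      by (simp add: abs_mult)
    also have "\<dots> \<le> \<bar>h\<bar> * (\<bar>h\<bar> * B)"
      using \<xi>(1) \<eta>(1) x h B by (intro mult_left_mono mult_mono) auto
    finally show ?thesis by (simp add: power2_eq_square mult_ac)
  qed
  have est: "\<bar>(?I0 (s + h) - ?I0 s) / h - ?I1\<bar> \<le> B * measure M A * \<bar>h\<bar>" if h: "\<bar>h\<bar> \<le> 1" "h \<noteq> 0" for h
  proof -
    have "?I0 (s + h) - ?I0 s - h * ?I1 = (LINT x:A|M. g0 x (s + h) - g0 x s - h * g1 x s)"
      using int by (simp add: set_integral_diff set_integral_mult_right)
    then have "\<bar>?I0 (s + h) - ?I0 s - h * ?I1\<bar> \<le> B * h\<^sup>2 * measure M A"
      using abs_set_integral_le[OF A, of "B * h\<^sup>2"] taylor h(1) B(2) by simp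
    then have "\<bar>?I0 (s + h) - ?I0 s - h * ?I1\<bar> / \<bar>h\<bar> \<le> B * h\<^sup>2 * measure M A / \<bar>h\<bar>"
      by (intro divide_right_mono) auto
    moreover have "B * h\<^sup>2 * measure M A / \<bar>h\<bar> = B * measure M A * \<bar>h\<bar>"
      using h(2) by (auto simp: field_simps power2_eq_square abs_if)
    moreover have "(?I0 (s + h) - ?I0 s) / h - ?I1 = (?I0 (s + h) - ?I0 s - h * ?I1) / h"
      using h(2) by (simp add: field_simps)
    ultimately show ?thesis by (simp add: abs_divide)
  qed
  have "((\<lambda>h. (?I0 (s + h) - ?I0 s) / h - ?I1) \<longlongrightarrow> 0) (at 0)"
  proof (rule Lim_null_comparison)
    have "\<forall>\<^sub>F h :: real in at 0. \<bar>h\<bar> < 1 \<and> h \<noteq> 0"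
      by (auto simp: eventually_at dist_real_def intro: exI[of _ 1])
    then show "\<forall>\<^sub>F h in at 0. norm ((?I0 (s + h) - ?I0 s) / h - ?I1) \<le> B * measure M A * \<bar>h\<bar>"
      by eventually_elim (use est in auto)
    show "((\<lambda>h. B * measure M A * \<bar>h\<bar>) \<longlongrightarrow> 0) (at 0)"
      by (auto intro!: tendsto_eq_intros)
  qed
  then show ?thesis unfolding DERIV_def using LIM_zero_iff by blast
qed

lemma moderate_on_set_integral:
  assumes "A \<in> sets M" "emeasure M A < \<infinity>" "moderate_on (A \<times> K) (\<lambda>\<epsilon> (x, s). g \<epsilon> x s)"
  shows "moderate_on K (\<lambda>\<epsilon> s. LINT x:A|M. g \<epsilon> x s)"
proof -
  obtain N where "\<forall>\<^sub>F \<epsilon> in at_right 0. \<forall>p\<in>A \<times> K. \<bar>(\<lambda>(x, s). g \<epsilon> x s) p\<bar> \<le> (1 / \<epsilon>) ^ N"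
    using assms(3) by (rule moderate_onE)
  with eventually_at_right_0_le[OF zero_less_one]
  have "\<forall>\<^sub>F \<epsilon> in at_right 0. \<forall>s\<in>K. \<bar>LINT x:A|M. g \<epsilon> x s\<bar> \<le> measure M A * (1 / \<epsilon>) ^ N"
  proof eventually_elim
    case (elim \<epsilon>)
    show ?case
      using abs_set_integral_le[OF assms(1,2), of "(1 / \<epsilon>) ^ N"] elim by (auto simp: mult.commute)
  qed
  then show ?thesis unfolding moderate_on_def bigO_on_def by blast
qed

lemma negligible_on_set_integral:
  assumes "A \<in> sets M" "emeasure M A < \<infinity>" "negligible_on (A \<times> K) (\<lambda>\<epsilon> (x, s). g \<epsilon> x s)"
  shows "negligible_on K (\<lambda>\<epsilon> s. LINT x:A|M. g \<epsilon> x s)"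
  unfolding negligible_on_def bigO_on_def
proof
  fix m
  have "\<forall>\<^sub>F \<epsilon> in at_right 0. \<forall>p\<in>A \<times> K. \<bar>(\<lambda>(x, s). g \<epsilon> x s) p\<bar> \<le> \<epsilon> ^ m"
    using assms(3) by (rule negligible_onD)
  with eventually_at_right_0_le[OF zero_less_one]
  have "\<forall>\<^sub>F \<epsilon> in at_right 0. \<forall>s\<in>K. \<bar>LINT x:A|M. g \<epsilon> x s\<bar> \<le> measure M A * \<epsilon> ^ m"
  proof eventually_elim
    case (elim \<epsilon>)
    show ?case
      using abs_set_integral_le[OF assms(1,2), of "\<epsilon> ^ m"] elim by (auto simp: mult.commute)
  qed
  then show "\<exists>C. \<forall>\<^sub>F \<epsilon> in at_right 0. \<forall>s\<in>K. \<bar>LINT x:A|M. g \<epsilon> x s\<bar> \<le> C * \<epsilon> ^ m" by blast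
qed

section \<open>Jets\<close>

lemma jet_continuous_on:
  assumes "open \<Omega>" "\<And>i. u i \<in> Cinf \<Omega> (closure \<Omega>)"
  shows "continuous_on (closure \<Omega>) (jet \<Omega> u)"
  unfolding jet_def
  using smooth_domain.Cinf_ext_partial[OF smooth_domain_closure[OF assms(1)] assms(2)]
  by (intro continuous_on_vec_lambda) auto

lemma jet_lincomb:
  assumes "open \<Omega>" "\<And>i. u i \<in> Cinf \<Omega> (closure \<Omega>)" "\<And>i. v i \<in> Cinf \<Omega> (closure \<Omega>)" "x \<in> closure \<Omega>"
  shows "jet \<Omega> (\<lambda>i x. c * u i x + d * v i x) x = c *\<^sub>R jet \<Omega> u x + d *\<^sub>R jet \<Omega> v x"
  unfolding jet_def vec_eq_iff
  using smooth_domain.Cinf_lincomb(2)[OF smooth_domain_closure[OF assms(1)] assms(2,3,4)] by simp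

lemma moderate_on_norm_jet:
  assumes "bounded \<Omega>" "\<And>i. u i \<in> moderate \<Omega> (closure \<Omega>)"
  shows "moderate_on (closure \<Omega>) (\<lambda>\<epsilon> x. norm (jet \<Omega> (\<lambda>i. u i \<epsilon>) x
            :: real ^ ('q::finite \<times> ('p::finite, 'n::finite) jet_index)))"
proof (rule moderate_on_le)
  show "moderate_on (closure \<Omega>) (\<lambda>\<epsilon> x. \<Sum>k\<in>UNIV. \<bar>(jet \<Omega> (\<lambda>i. u i \<epsilon>) x
            :: real ^ ('q \<times> ('p, 'n) jet_index)) $ k\<bar>)"
    unfolding jet_def
    using assms by (auto intro!: moderate_on_sum moderate_on_abs moderate_onD)
qed (use norm_le_l1_cart in simp)

lemma negligible_on_norm_jet:
  assumes "bounded \<Omega>" "\<And>i. u i \<in> negligible_nets \<Omega> (closure \<Omega>)"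
  shows "negligible_on (closure \<Omega>) (\<lambda>\<epsilon> x. norm (jet \<Omega> (\<lambda>i. u i \<epsilon>) x
            :: real ^ ('q::finite \<times> ('p::finite, 'n::finite) jet_index)))"
proof (rule negligible_on_le)
  show "negligible_on (closure \<Omega>) (\<lambda>\<epsilon> x. \<Sum>k\<in>UNIV. \<bar>(jet \<Omega> (\<lambda>i. u i \<epsilon>) x
            :: real ^ ('q \<times> ('p, 'n) jet_index)) $ k\<bar>)"
    unfolding jet_def
    using assms by (auto intro!: negligible_on_sum negligible_on_abs negligible_nets_onD)
qed (use norm_le_l1_cart in simp)

lemma smooth_domain_jet: "open \<Omega> \<Longrightarrow> smooth_domain (\<Omega> \<times> UNIV) (closure \<Omega> \<times> UNIV)"
  by unfold_locales (auto simp: open_Times closure_Times intro: closure_subset[THEN subsetD])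

lemma closed_jet: "closed (closure \<Omega> \<times> UNIV)"
  by (simp add: closed_Times)

section \<open>Variations of the classical functional\<close>

text \<open>The \<open>k\<close>-th derivative of \<open>s \<mapsto> \<L>(u + s v)\<close> at \<open>0\<close>, for a classical Lagrangian \<open>l\<close>: the integrand is
  differentiated \<open>k\<close> times in the direction \<open>(0, v\<^sup>(\<^sup>n\<^sup>)(x))\<close> of the jet space.\<close>

definition variation :: "nat \<Rightarrow> (real ^ 'p) set
    \<Rightarrow> (('p::finite, 'q::finite, 'n::finite) jet_space \<Rightarrow> real)
    \<Rightarrow> ('q \<Rightarrow> real ^ 'p \<Rightarrow> real) \<Rightarrow> ('q \<Rightarrow> real ^ 'p \<Rightarrow> real) \<Rightarrow> real" where
  "variation k \<Omega> l u v =
     (LINT x:\<Omega>|lborel. dirderiv (replicate k (0, jet \<Omega> v x)) l (x, jet \<Omega> u x))"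

lemma variation_0: "variation 0 \<Omega> l u v = classical_functional \<Omega> l u"
  by (simp add: variation_def classical_functional_def)

lemma jet_line:
  assumes "open \<Omega>" "\<And>i. u i \<in> Cinf \<Omega> (closure \<Omega>)" "\<And>i. v i \<in> Cinf \<Omega> (closure \<Omega>)" "x \<in> \<Omega>"
  shows "(x, jet \<Omega> (\<lambda>i x. u i x + s * v i x) x) = (x, jet \<Omega> u x) + s *\<^sub>R (0, jet \<Omega> v x)"
  using jet_lincomb[OF assms(1), of u v x 1 s] assms closure_subset[of \<Omega>] by auto

text \<open>What differentiation under the integral requires. The jets are bounded on \<open>\<Omega>\<close> because they are
  continuous on its compact closure, so the points at which \<open>l\<close> is evaluated stay in a bounded set as
  long as the line parameter does.\<close>

lemma variation_integrand:
  fixes l :: "('p::finite, 'q::finite, 'n::finite) jet_space \<Rightarrow> real"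
  assumes \<Omega>: "open \<Omega>" "bounded \<Omega>" and l: "l \<in> Cinf (\<Omega> \<times> UNIV) (closure \<Omega> \<times> UNIV)"
    and u: "\<And>i. u i \<in> Cinf \<Omega> (closure \<Omega>)" and v: "\<And>i. v i \<in> Cinf \<Omega> (closure \<Omega>)"
  defines "g \<equiv> \<lambda>k x s. dirderiv (replicate k (0, jet \<Omega> v x)) l ((x, jet \<Omega> u x) + s *\<^sub>R (0, jet \<Omega> v x))"
  shows "set_integrable lborel \<Omega> (\<lambda>x. g k x s)"
    and "x \<in> \<Omega> \<Longrightarrow> (g k x has_real_derivative g (Suc k) x s) (at s)"
    and "\<exists>B\<ge>0. \<forall>x\<in>\<Omega>. \<forall>t. \<bar>t - s\<bar> \<le> 1 \<longrightarrow> \<bar>g k x t\<bar> \<le> B"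
proof -
  interpret J: smooth_domain "\<Omega> \<times> UNIV" "closure \<Omega> \<times> UNIV"
    by (rule smooth_domain_jet[OF \<Omega>(1)])
  have cl: "compact (closure \<Omega>)" using \<Omega>(2) by simp
  have bdd: "\<exists>B. \<forall>x\<in>\<Omega>. norm (jet \<Omega> w x :: real ^ ('q \<times> ('p, 'n) jet_index)) \<le> B"
    if "\<And>i. w i \<in> Cinf \<Omega> (closure \<Omega>)" for w
    using compact_imp_bounded[OF compact_continuous_image[OF jet_continuous_on[OF \<Omega>(1) that] cl]]
      closure_subset[of \<Omega>] unfolding bounded_iff by fast
  obtain Bu where Bu: "\<And>x. x \<in> \<Omega> \<Longrightarrow> norm (jet \<Omega> u x :: real ^ ('q \<times> ('p, 'n) jet_index)) \<le> Bu"
    using bdd[of u] u by blast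
  obtain Bv where Bv: "\<And>x. x \<in> \<Omega> \<Longrightarrow> norm (jet \<Omega> v x :: real ^ ('q \<times> ('p, 'n) jet_index)) \<le> Bv"
    using bdd[of v] v by blast
  obtain Bx where Bx: "\<And>x. x \<in> \<Omega> \<Longrightarrow> norm x \<le> Bx" using \<Omega>(2) unfolding bounded_iff by blast
  have bound: "\<exists>B\<ge>0. \<forall>x\<in>\<Omega>. \<forall>t. \<bar>t - s\<bar> \<le> 1 \<longrightarrow> \<bar>g k x t\<bar> \<le> B" for k s
  proof -
    let ?V = "max 0 Bv"
    let ?R = "Bx + Bu + (\<bar>s\<bar> + 1) * ?V"
    obtain C where C: "\<And>z. z \<in> \<Omega> \<times> UNIV \<Longrightarrow> norm z \<le> ?R \<Longrightarrow> \<bar>deriv_size k l z\<bar> \<le> C"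
      using J.deriv_size_locally_bounded[OF l closed_jet] unfolding locally_bounded_on_def by blast
    have "\<bar>g k x t\<bar> \<le> ?V ^ k * max 0 C" if x: "x \<in> \<Omega>" and t: "\<bar>t - s\<bar> \<le> 1" for x t
    proof -
      let ?z = "(x, jet \<Omega> u x) + t *\<^sub>R (0, jet \<Omega> v x) :: ('p, 'q, 'n) jet_space"
      have nv: "norm ((0, jet \<Omega> v x) :: ('p, 'q, 'n) jet_space) \<le> ?V"
        using Bv[OF x] by (simp add: norm_Pair le_max_iff_disj)
      have "norm ?z \<le> norm ((x, jet \<Omega> u x) :: ('p, 'q, 'n) jet_space)
          + norm (t *\<^sub>R ((0, jet \<Omega> v x) :: ('p, 'q, 'n) jet_space))"
        by (rule norm_triangle_ineq)
      also have "norm ((x, jet \<Omega> u x) :: ('p, 'q, 'n) jet_space) \<le> Bx + Bu"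
        using norm_Pair_le[of x "jet \<Omega> u x :: real ^ ('q \<times> ('p, 'n) jet_index)"] Bx[OF x] Bu[OF x]
        by linarith
      also have "norm (t *\<^sub>R ((0, jet \<Omega> v x) :: ('p, 'q, 'n) jet_space)) \<le> (\<bar>s\<bar> + 1) * ?V"
        unfolding norm_scaleR using nv t by (intro mult_mono) auto
      finally have "norm ?z \<le> ?R" by simp
      moreover have "?z \<in> \<Omega> \<times> UNIV" using x by simp
      ultimately have "\<bar>deriv_size k l ?z\<bar> \<le> C" by (intro C)
      then have "deriv_size k l ?z \<le> max 0 C" by linarith
      moreover have "\<bar>g k x t\<bar> \<le> ?V ^ k * deriv_size k l ?z"
        unfolding g_def
        using abs_dirderiv_le[of "replicate k ((0, jet \<Omega> v x) :: ('p, 'q, 'n) jet_space)" ?V l ?z] nv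
        by simp
      ultimately show ?thesis
        by (smt (verit) max.cobounded1 mult_left_mono zero_le_power)
    qed
    then show ?thesis by (intro exI[of _ "?V ^ k * max 0 C"]) auto
  qed
  then show "\<exists>B\<ge>0. \<forall>x\<in>\<Omega>. \<forall>t. \<bar>t - s\<bar> \<le> 1 \<longrightarrow> \<bar>g k x t\<bar> \<le> B" .
  have ju: "continuous_on \<Omega> (jet \<Omega> u :: _ \<Rightarrow> real ^ ('q \<times> ('p, 'n) jet_index))"
    "continuous_on \<Omega> (jet \<Omega> v :: _ \<Rightarrow> real ^ ('q \<times> ('p, 'n) jet_index))"
    using jet_continuous_on[OF \<Omega>(1)] u v closure_subset by (blast intro: continuous_on_subset)+
  have "continuous_on \<Omega> (\<lambda>x. g k x s)"
    unfolding g_def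
    by (rule dirderiv_continuous_on[OF J.Cinf_smooth[OF l]]) (auto intro!: continuous_intros ju)
  moreover obtain B where "\<forall>x\<in>\<Omega>. \<forall>t. \<bar>t - s\<bar> \<le> 1 \<longrightarrow> \<bar>g k x t\<bar> \<le> B" using bound by blast
  ultimately show "set_integrable lborel \<Omega> (\<lambda>x. g k x s)"
    by (intro set_integrable_bounded_continuous[OF \<Omega>, of _ B]) auto
  show "(g k x has_real_derivative g (Suc k) x s) (at s)" if "x \<in> \<Omega>"
    unfolding g_def
    using dirderiv_has_derivative[OF J.Cinf_smooth[OF l] J.open_dom,
        of "(x, jet \<Omega> u x)" s "(0, jet \<Omega> v x)" "replicate k (0, jet \<Omega> v x)"] that
    by (simp add: replicate_append_same del: dirderiv.simps)
qed

lemma open_bounded_finite_measure: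
  assumes "open (\<Omega> :: 'a::euclidean_space set)" "bounded \<Omega>"
  shows "\<Omega> \<in> sets lborel" "emeasure lborel \<Omega> < \<infinity>"
  using assms emeasure_bounded_finite[OF assms(2)] by auto

lemma variation_line:
  assumes "open \<Omega>" "\<And>i. u i \<in> Cinf \<Omega> (closure \<Omega>)" "\<And>i. v i \<in> Cinf \<Omega> (closure \<Omega>)"
  shows "variation k \<Omega> l (\<lambda>i x. u i x + s * v i x) v
    = (LINT x:\<Omega>|lborel. dirderiv (replicate k (0, jet \<Omega> v x)) l ((x, jet \<Omega> u x) + s *\<^sub>R (0, jet \<Omega> v x)))"
  unfolding variation_def
  using assms by (intro set_lebesgue_integral_cong) (auto simp only: jet_line sets_lborel borel_open)

lemma variation_has_derivative:
  fixes l :: "('p::finite, 'q::finite, 'n::finite) jet_space \<Rightarrow> real"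
  assumes \<Omega>: "open \<Omega>" "bounded \<Omega>" and l: "l \<in> Cinf (\<Omega> \<times> UNIV) (closure \<Omega> \<times> UNIV)"
    and u: "\<And>i. u i \<in> Cinf \<Omega> (closure \<Omega>)" and v: "\<And>i. v i \<in> Cinf \<Omega> (closure \<Omega>)"
  shows "((\<lambda>s. variation k \<Omega> l (\<lambda>i x. u i x + s * v i x) v) has_real_derivative
      variation (Suc k) \<Omega> l (\<lambda>i x. u i x + s * v i x) v) (at s)"
  unfolding variation_line[OF \<Omega>(1), of u v, OF u v]
proof -
  note int = variation_integrand[OF \<Omega> l, of u v, OF u v]
  obtain B where "0 \<le> B" "\<forall>x\<in>\<Omega>. \<forall>t. \<bar>t - s\<bar> \<le> 1 \<longrightarrow> \<bar>dirderiv (replicate (Suc (Suc k))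
      (0, jet \<Omega> v x)) l ((x, jet \<Omega> u x) + t *\<^sub>R (0, jet \<Omega> v x))\<bar> \<le> B"
    using int(3)[where k="Suc (Suc k)" and s=s] by blast
  then show "((\<lambda>s. LINT x:\<Omega>|lborel. dirderiv (replicate k (0, jet \<Omega> v x)) l
        ((x, jet \<Omega> u x) + s *\<^sub>R (0, jet \<Omega> v x))) has_real_derivative
      (LINT x:\<Omega>|lborel. dirderiv (replicate (Suc k) (0, jet \<Omega> v x)) l
        ((x, jet \<Omega> u x) + s *\<^sub>R (0, jet \<Omega> v x)))) (at s)"
    by (intro set_integral_has_derivative[OF open_bounded_finite_measure[OF \<Omega>] int(1) int(1)
          int(2) int(2)]) auto
qed

lemma temp_moderate_tempered:
  assumes "open \<Omega>" "L \<in> temp_moderate \<Omega>"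
  shows "tempered_on (\<Omega> \<times> UNIV) (\<lambda>\<epsilon>. deriv_size k (L \<epsilon>))"
    and "\<epsilon> \<in> {0<..1} \<Longrightarrow> L \<epsilon> \<in> Cinf (\<Omega> \<times> UNIV) (closure \<Omega> \<times> UNIV)"
proof -
  interpret J: smooth_domain "\<Omega> \<times> UNIV" "closure \<Omega> \<times> UNIV"
    by (rule smooth_domain_jet[OF assms(1)])
  show C: "L \<epsilon> \<in> Cinf (\<Omega> \<times> UNIV) (closure \<Omega> \<times> UNIV)" if "\<epsilon> \<in> {0<..1}" for \<epsilon>
    using assms(2) that by (auto simp: temp_moderate_def)
  have "tempered_on (\<Omega> \<times> UNIV) (\<lambda>\<epsilon>. mpartial \<beta> (L \<epsilon>))" for \<beta>
  proof -
    obtain N where N: "moderate_on (closure \<Omega> \<times> UNIV)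
        (\<lambda>\<epsilon> z. ext_partial (\<Omega> \<times> UNIV) \<beta> (L \<epsilon>) z / (1 + norm z) ^ N)"
      using assms(2) unfolding temp_moderate_def moderate_on_def by blast
    have "moderate_on (\<Omega> \<times> UNIV) (\<lambda>\<epsilon> z. mpartial \<beta> (L \<epsilon>) z / (1 + norm z) ^ N)"
    proof (rule moderate_on_mono[OF N], rule always_eventually, intro allI ballI)
      fix \<epsilon> z assume z: "z \<in> \<Omega> \<times> (UNIV :: (real ^ ('b \<times> ('a, 'c) jet_index)) set)"
      then show "\<exists>y\<in>closure \<Omega> \<times> UNIV. \<bar>mpartial \<beta> (L \<epsilon>) z / (1 + norm z) ^ N\<bar>
          \<le> \<bar>ext_partial (\<Omega> \<times> UNIV) \<beta> (L \<epsilon>) y / (1 + norm y) ^ N\<bar>"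
        using J.dom_subset J.ext_partial_interior[OF z, of \<beta> "L \<epsilon>"] by (intro bexI[of _ z]) auto
    qed
    then show ?thesis unfolding tempered_on_def by blast
  qed
  then show "tempered_on (\<Omega> \<times> UNIV) (\<lambda>\<epsilon>. deriv_size k (L \<epsilon>))"
    using J.deriv_size_partials_tempered[of L "[]"] C by simp
qed

lemma moderate_on_fst:
  "moderate_on A (\<lambda>\<epsilon> x. f \<epsilon> x) \<Longrightarrow> A' \<subseteq> A \<Longrightarrow> moderate_on (A' \<times> K) (\<lambda>\<epsilon> p. f \<epsilon> (fst p))"
  by (erule moderate_on_mono) (auto intro!: always_eventually)

lemma negligible_on_fst:
  "negligible_on A (\<lambda>\<epsilon> x. f \<epsilon> x) \<Longrightarrow> A' \<subseteq> A \<Longrightarrow> negligible_on (A' \<times> K) (\<lambda>\<epsilon> p. f \<epsilon> (fst p))"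
  by (erule negligible_on_mono) (auto intro!: always_eventually)

lemma moderate_on_bounded: "(\<And>x. x \<in> K \<Longrightarrow> \<bar>f x\<bar> \<le> B) \<Longrightarrow> moderate_on K (\<lambda>\<epsilon>. f)"
  by (rule moderate_on_le[OF moderate_on_const[of K B]])

text \<open>The base points \<open>(x, (u\<^sub>\<epsilon> + s v\<^sub>\<epsilon>)\<^sup>(\<^sup>n\<^sup>)(x))\<close> are of moderate size, so the polynomial growth in
  the fibre that temperedness permits costs only further powers of \<open>1 / \<epsilon>\<close>.\<close>

lemma variation_line_moderate:
  fixes L :: "real \<Rightarrow> ('p::finite, 'q::finite, 'n::finite) jet_space \<Rightarrow> real"
  assumes \<Omega>: "open \<Omega>" "bounded \<Omega>" and L: "L \<in> temp_moderate \<Omega>"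
    and u: "\<And>i. u i \<in> moderate \<Omega> (closure \<Omega>)" and v: "\<And>i. v i \<in> moderate \<Omega> (closure \<Omega>)"
    and K: "bounded K"
  shows "moderate_on K (\<lambda>\<epsilon> s. variation k \<Omega> (L \<epsilon>) (\<lambda>i x. u i \<epsilon> x + s * v i \<epsilon> x) (\<lambda>i. v i \<epsilon>))"
proof -
  let ?y = "\<lambda>\<epsilon> x. jet \<Omega> (\<lambda>i. u i \<epsilon>) x :: real ^ ('q \<times> ('p, 'n) jet_index)"
  let ?d = "\<lambda>\<epsilon> x. jet \<Omega> (\<lambda>i. v i \<epsilon>) x :: real ^ ('q \<times> ('p, 'n) jet_index)"
  let ?g = "\<lambda>\<epsilon> x s. dirderiv (replicate k (0, ?d \<epsilon> x)) (L \<epsilon>) ((x, ?y \<epsilon> x) + s *\<^sub>R (0, ?d \<epsilon> x))"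
  let ?z = "\<lambda>\<epsilon> p. (fst p, ?y \<epsilon> (fst p)) + snd p *\<^sub>R (0, ?d \<epsilon> (fst p))"
  obtain BK where BK: "\<And>s. s \<in> K \<Longrightarrow> \<bar>s\<bar> \<le> BK" using K unfolding bounded_iff by auto
  obtain Bx where Bx: "\<And>x. x \<in> \<Omega> \<Longrightarrow> norm x \<le> Bx" using \<Omega>(2) unfolding bounded_iff by blast
  note sub = closure_subset[of \<Omega>]
  have y: "moderate_on (\<Omega> \<times> K) (\<lambda>\<epsilon> p. norm (?y \<epsilon> (fst p)))"
    by (rule moderate_on_fst[OF moderate_on_norm_jet[OF \<Omega>(2) u] sub])
  have d: "moderate_on (\<Omega> \<times> K) (\<lambda>\<epsilon> p. norm (?d \<epsilon> (fst p)))"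
    by (rule moderate_on_fst[OF moderate_on_norm_jet[OF \<Omega>(2) v] sub])
  have z: "moderate_on (\<Omega> \<times> K) (\<lambda>\<epsilon> p. norm (?z \<epsilon> p))"
  proof (rule moderate_on_le)
    show "moderate_on (\<Omega> \<times> K) (\<lambda>\<epsilon> p. Bx + norm (?y \<epsilon> (fst p)) + BK * norm (?d \<epsilon> (fst p)))"
      by (intro moderate_on_add moderate_on_mult moderate_on_const y d)
    fix \<epsilon> p assume p: "p \<in> \<Omega> \<times> K"
    have "norm (?z \<epsilon> p) \<le> norm (fst p) + norm (?y \<epsilon> (fst p) + snd p *\<^sub>R ?d \<epsilon> (fst p))"
      using norm_Pair_le[of "fst p" "?y \<epsilon> (fst p) + snd p *\<^sub>R ?d \<epsilon> (fst p)"] by simp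
    also have "\<dots> \<le> norm (fst p) + (norm (?y \<epsilon> (fst p)) + \<bar>snd p\<bar> * norm (?d \<epsilon> (fst p)))"
      using norm_triangle_ineq[of "?y \<epsilon> (fst p)" "snd p *\<^sub>R ?d \<epsilon> (fst p)"] by simp
    also have "\<dots> \<le> Bx + (norm (?y \<epsilon> (fst p)) + BK * norm (?d \<epsilon> (fst p)))"
      using p Bx BK by (intro add_mono mult_right_mono) auto
    finally show "\<bar>norm (?z \<epsilon> p)\<bar> \<le> Bx + norm (?y \<epsilon> (fst p)) + BK * norm (?d \<epsilon> (fst p))" by simp
  qed
  have "moderate_on (\<Omega> \<times> K) (\<lambda>\<epsilon> p. norm (?d \<epsilon> (fst p)) ^ k * deriv_size k (L \<epsilon>) (?z \<epsilon> p))"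
    by (intro moderate_on_mult moderate_on_power d
        tempered_on_compose[OF temp_moderate_tempered(1)[OF \<Omega>(1) L] z]) auto
  then have "moderate_on (\<Omega> \<times> K) (\<lambda>\<epsilon> (x, s). ?g \<epsilon> x s)"
  proof (rule moderate_on_le)
    fix \<epsilon> p
    show "\<bar>case p of (x, s) \<Rightarrow> ?g \<epsilon> x s\<bar> \<le> norm (?d \<epsilon> (fst p)) ^ k * deriv_size k (L \<epsilon>) (?z \<epsilon> p)"
      using abs_dirderiv_le[of "replicate k (0, ?d \<epsilon> (fst p))" "norm (?d \<epsilon> (fst p))" "L \<epsilon>" "?z \<epsilon> p"]
      by (auto simp: norm_Pair split: prod.splits)
  qed
  then have "moderate_on K (\<lambda>\<epsilon> s. LINT x:\<Omega>|lborel. ?g \<epsilon> x s)"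
    by (rule moderate_on_set_integral[OF open_bounded_finite_measure[OF \<Omega>]])
  moreover have "variation k \<Omega> (L \<epsilon>) (\<lambda>i x. u i \<epsilon> x + s * v i \<epsilon> x) (\<lambda>i. v i \<epsilon>)
      = (LINT x:\<Omega>|lborel. ?g \<epsilon> x s)" if "0 < \<epsilon>" "\<epsilon> \<le> 1" for \<epsilon> s
    using u v that by (intro variation_line[OF \<Omega>(1)]) (auto simp: moderate_iff)
  ultimately show ?thesis by (subst moderate_on_cong) auto
qed

text \<open>Independence of the representative: on the segment between the two jets the derivatives of order
  \<open>k + 1\<close> are moderate, and the length of the segment is negligible.\<close>

lemma variation_negligible:
  fixes L :: "real \<Rightarrow> ('p::finite, 'q::finite, 'n::finite) jet_space \<Rightarrow> real"
  assumes \<Omega>: "open \<Omega>" "bounded \<Omega>" and L: "L \<in> temp_moderate \<Omega>"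
    and u: "\<And>i. u i \<in> moderate \<Omega> (closure \<Omega>)" and v: "\<And>i. v i \<in> moderate \<Omega> (closure \<Omega>)"
    and w: "\<And>i. w i \<in> moderate \<Omega> (closure \<Omega>)"
    and uw: "\<And>i. w i - u i \<in> negligible_nets \<Omega> (closure \<Omega>)"
  shows "(\<lambda>\<epsilon>. variation k \<Omega> (L \<epsilon>) (\<lambda>i. w i \<epsilon>) (\<lambda>i. v i \<epsilon>)
      - variation k \<Omega> (L \<epsilon>) (\<lambda>i. u i \<epsilon>) (\<lambda>i. v i \<epsilon>)) \<in> rt_negligible"
proof -
  interpret J: smooth_domain "\<Omega> \<times> UNIV :: ('p, 'q, 'n) jet_space set" "closure \<Omega> \<times> UNIV"
    by (rule smooth_domain_jet[OF \<Omega>(1)])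
  let ?y = "\<lambda>\<epsilon> x. jet \<Omega> (\<lambda>i. u i \<epsilon>) x :: real ^ ('q \<times> ('p, 'n) jet_index)"
  let ?d = "\<lambda>\<epsilon> x. jet \<Omega> (\<lambda>i. v i \<epsilon>) x :: real ^ ('q \<times> ('p, 'n) jet_index)"
  let ?e = "\<lambda>\<epsilon> x. jet \<Omega> (\<lambda>i. (w i - u i) \<epsilon>) x :: real ^ ('q \<times> ('p, 'n) jet_index)"
  let ?S = "\<Omega> \<times> {0..1::real}"
  let ?z = "\<lambda>\<epsilon> p. (fst p, ?y \<epsilon> (fst p)) + snd p *\<^sub>R (0, ?e \<epsilon> (fst p))"
  obtain Bx where Bx: "\<And>x. x \<in> \<Omega> \<Longrightarrow> norm x \<le> Bx" using \<Omega>(2) unfolding bounded_iff by blast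
  note sub = closure_subset[of \<Omega>]
  have Cu: "u i \<epsilon> \<in> Cinf \<Omega> (closure \<Omega>)" "v i \<epsilon> \<in> Cinf \<Omega> (closure \<Omega>)" "w i \<epsilon> \<in> Cinf \<Omega> (closure \<Omega>)"
    if "0 < \<epsilon>" "\<epsilon> \<le> 1" for \<epsilon> i
    using u v w that by (auto simp: moderate_iff)
  have y: "moderate_on ?S (\<lambda>\<epsilon> p. norm (?y \<epsilon> (fst p)))"
    by (rule moderate_on_fst[OF moderate_on_norm_jet[OF \<Omega>(2) u] sub])
  have d: "moderate_on ?S (\<lambda>\<epsilon> p. norm (?d \<epsilon> (fst p)))"
    by (rule moderate_on_fst[OF moderate_on_norm_jet[OF \<Omega>(2) v] sub])
  have e: "negligible_on ?S (\<lambda>\<epsilon> p. norm (?e \<epsilon> (fst p)))"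
    by (rule negligible_on_fst[OF negligible_on_norm_jet[OF \<Omega>(2) uw] sub])
  have z: "moderate_on ?S (\<lambda>\<epsilon> p. norm (?z \<epsilon> p))"
  proof (rule moderate_on_le)
    show "moderate_on ?S (\<lambda>\<epsilon> p. Bx + norm (?y \<epsilon> (fst p)) + norm (?e \<epsilon> (fst p)))"
      by (intro moderate_on_add moderate_on_const y negligible_imp_moderate_on[OF e])
    fix \<epsilon> p assume p: "p \<in> ?S"
    have "norm (?z \<epsilon> p) \<le> norm (fst p) + norm (?y \<epsilon> (fst p) + snd p *\<^sub>R ?e \<epsilon> (fst p))"
      using norm_Pair_le[of "fst p" "?y \<epsilon> (fst p) + snd p *\<^sub>R ?e \<epsilon> (fst p)"] by simp
    also have "\<dots> \<le> norm (fst p) + (norm (?y \<epsilon> (fst p)) + \<bar>snd p\<bar> * norm (?e \<epsilon> (fst p)))"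
      using norm_triangle_ineq[of "?y \<epsilon> (fst p)" "snd p *\<^sub>R ?e \<epsilon> (fst p)"] by simp
    also have "\<dots> \<le> Bx + (norm (?y \<epsilon> (fst p)) + 1 * norm (?e \<epsilon> (fst p)))"
      using p Bx by (intro add_mono mult_right_mono) auto
    finally show "\<bar>norm (?z \<epsilon> p)\<bar> \<le> Bx + norm (?y \<epsilon> (fst p)) + norm (?e \<epsilon> (fst p))" by simp
  qed
  let ?f = "\<lambda>\<epsilon> p. (norm (?d \<epsilon> (fst p)) ^ k * deriv_size (Suc k) (L \<epsilon>) (?z \<epsilon> p)) * norm (?e \<epsilon> (fst p))"
  have f: "negligible_on ?S ?f"
    by (intro negligible_on_mult moderate_on_mult moderate_on_power d e
        tempered_on_compose[OF temp_moderate_tempered(1)[OF \<Omega>(1) L] z]) auto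
  let ?h = "\<lambda>\<epsilon> x. dirderiv (replicate k (0, ?d \<epsilon> x)) (L \<epsilon>)"
  let ?w = "\<lambda>\<epsilon> x. jet \<Omega> (\<lambda>i. w i \<epsilon>) x :: real ^ ('q \<times> ('p, 'n) jet_index)"
  have diff: "negligible_on (\<Omega> \<times> {()}) (\<lambda>\<epsilon> (x, _). ?h \<epsilon> x (x, ?w \<epsilon> x) - ?h \<epsilon> x (x, ?y \<epsilon> x))"
  proof (rule negligible_on_mono[OF f], rule eventually_mono[OF eventually_at_right_0_le[OF zero_less_one]],
      intro ballI)
    fix \<epsilon> :: real and p assume \<epsilon>: "0 < \<epsilon> \<and> \<epsilon> \<le> 1" and p: "p \<in> \<Omega> \<times> {()}"
    define x where "x = fst p"
    have x: "x \<in> \<Omega>" using p by (auto simp: x_def)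
    have "(\<lambda>i. (w i - u i) \<epsilon>) = (\<lambda>i x. 1 * w i \<epsilon> x + (- 1) * u i \<epsilon> x)"
      by (simp add: fun_eq_iff)
    then have "?e \<epsilon> x = 1 *\<^sub>R ?w \<epsilon> x + (- 1) *\<^sub>R ?y \<epsilon> x"
      using jet_lincomb[OF \<Omega>(1), of "\<lambda>i. w i \<epsilon>" "\<lambda>i. u i \<epsilon>" x 1 "- 1"] Cu \<epsilon> x sub by auto
    then have we: "(x, ?w \<epsilon> x) = (x, ?y \<epsilon> x) + (0, ?e \<epsilon> x)" by simp
    have "\<exists>t\<in>{0..1}. \<bar>?h \<epsilon> x ((x, ?y \<epsilon> x) + (0, ?e \<epsilon> x)) - ?h \<epsilon> x (x, ?y \<epsilon> x)\<bar>
      \<le> norm (?d \<epsilon> x) ^ length (replicate k (0 :: real ^ 'p, ?d \<epsilon> x)) * norm (0 :: real ^ 'p, ?e \<epsilon> x) *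
        deriv_size (Suc (length (replicate k (0 :: real ^ 'p, ?d \<epsilon> x)))) (L \<epsilon>) ((x, ?y \<epsilon> x) + t *\<^sub>R (0, ?e \<epsilon> x))"
      using \<epsilon> x
      by (intro dirderiv_diff_le[OF J.Cinf_smooth[OF temp_moderate_tempered(2)[OF \<Omega>(1) L]] J.open_dom])
        (auto simp: norm_Pair)
    then obtain t where "t \<in> {0..1}" "\<bar>?h \<epsilon> x (x, ?w \<epsilon> x) - ?h \<epsilon> x (x, ?y \<epsilon> x)\<bar> \<le> ?f \<epsilon> (x, t)"
      unfolding we by (auto simp: norm_Pair mult_ac simp del: deriv_size.simps)
    then show "\<exists>y\<in>?S. \<bar>case p of (x, _) \<Rightarrow> ?h \<epsilon> x (x, ?w \<epsilon> x) - ?h \<epsilon> x (x, ?y \<epsilon> x)\<bar> \<le> \<bar>?f \<epsilon> y\<bar>"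
      using x by (intro bexI[of _ "(x, t)"]) (auto simp: x_def split: prod.splits simp del: deriv_size.simps)
  qed
  have "negligible_on {()} (\<lambda>\<epsilon> _. LINT x:\<Omega>|lborel. ?h \<epsilon> x (x, ?w \<epsilon> x) - ?h \<epsilon> x (x, ?y \<epsilon> x))"
    by (rule negligible_on_set_integral[OF open_bounded_finite_measure[OF \<Omega>] diff])
  moreover have "(LINT x:\<Omega>|lborel. ?h \<epsilon> x (x, ?w \<epsilon> x) - ?h \<epsilon> x (x, ?y \<epsilon> x))
     = variation k \<Omega> (L \<epsilon>) (\<lambda>i. w i \<epsilon>) (\<lambda>i. v i \<epsilon>)
      - variation k \<Omega> (L \<epsilon>) (\<lambda>i. u i \<epsilon>) (\<lambda>i. v i \<epsilon>)" if "0 < \<epsilon>" "\<epsilon> \<le> 1" for \<epsilon>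
  proof -
    have \<epsilon>: "\<epsilon> \<in> {0<..1}" using that by simp
    note I = variation_integrand(1)[OF \<Omega> temp_moderate_tempered(2)[OF \<Omega>(1) L \<epsilon>], where s = 0 and k = k]
    show ?thesis
      unfolding variation_def
      using I[of "\<lambda>i. w i \<epsilon>" "\<lambda>i. v i \<epsilon>"] I[of "\<lambda>i. u i \<epsilon>" "\<lambda>i. v i \<epsilon>"] Cu[OF that]
      by (intro set_integral_diff(2)) auto
  qed
  ultimately show ?thesis unfolding rt_negligible_iff by (subst (asm) negligible_on_cong) auto
qed

section \<open>Nets on the real line\<close>

text \<open>On the real line there is a single basis direction, and multi-index derivatives are iterates of
  \<^const>\<open>deriv\<close>.\<close>

lemma partial_real: "partial (1::real) = deriv"
proof (intro ext)
  fix f :: "real \<Rightarrow> real" and x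
  have "(f has_real_derivative D) (at x) \<longleftrightarrow> ((\<lambda>t. f (x + t *\<^sub>R 1)) has_real_derivative D) (at 0)" for D
    using DERIV_shift[of f D 0 x] by (simp add: add.commute)
  then show "partial 1 f x = deriv f x" by (simp add: partial_def deriv_def)
qed

lemma mpartial_real: "mpartial \<alpha> (f :: real \<Rightarrow> real) = (deriv ^^ \<alpha> 1) f"
proof -
  have singleton: "xs = [c]" if "distinct xs" "set xs = {c}" for xs and c :: real
    using that by (cases xs; cases "tl xs") auto
  have b: "(basis_list :: real list) = [1]"
    by (rule singleton[OF basis_list(1)]) (simp only: basis_list(2) Basis_real_def)
  have "mindex_word \<alpha> = replicate (\<alpha> 1) 1" by (simp add: mindex_word_def b)
  then show ?thesis by (simp add: mpartial_eq_partials foldr_replicate partial_real)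
qed

text \<open>Explicit higher derivatives of a smooth function. Those of \<open>s \<mapsto> \<L>(u + s v)\<close> are known as integrals,
  and estimates for them then apply to the iterates of \<^const>\<open>deriv\<close>.\<close>

locale derivative_chain =
  fixes F :: "nat \<Rightarrow> real \<Rightarrow> real"
  assumes chain: "\<And>k x. (F k has_real_derivative F (Suc k) x) (at x)"
begin

lemma deriv_chain: "(deriv ^^ j) (F k) = F (j + k)"
proof (induction j)
  case (Suc j)
  have "deriv (F (j + k)) = F (Suc (j + k))" using DERIV_imp_deriv[OF chain] by blast
  then show ?case using Suc by simp
qed simp

lemma continuous_chain: "continuous_on A (F k)"
  using DERIV_isCont[OF chain] by (intro continuous_at_imp_continuous_on) blast

lemma smooth_chain: "smooth S (F k)"
proof -
  have "Ck j S (F k)" for j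
  proof (induction j arbitrary: k)
    case 0
    show ?case by (simp add: continuous_chain)
  next
    case (Suc j)
    have "F k differentiable_on S"
      using chain unfolding differentiable_on_def
      by (meson DERIV_deriv_iff_real_differentiable differentiable_at_withinI real_differentiable_def)
    moreover have "partial 1 (F k) = F (Suc k)"
      using deriv_chain[of 1 k] by (simp add: partial_real)
    ultimately show ?case using Suc.IH[of "Suc k"] by simp
  qed
  then show ?thesis by (simp add: smooth_def)
qed

lemma Cinf_chain:
  assumes "smooth_domain \<Omega> D"
  shows "F k \<in> Cinf \<Omega> D" "x \<in> D \<Longrightarrow> ext_partial \<Omega> \<alpha> (F k) x = F (\<alpha> 1 + k) x"
proof -
  interpret smooth_domain \<Omega> D by fact
  show "F k \<in> Cinf \<Omega> D"
    unfolding Cinf_def mpartial_real deriv_chain mem_Collect_eq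
  proof (intro conjI allI smooth_chain continuous_chain)
    fix \<alpha> :: "real \<Rightarrow> nat"
    show "\<exists>g. continuous_on D g \<and> (\<forall>x\<in>\<Omega>. g x = F (\<alpha> 1 + k) x)"
      by (intro exI[of _ "F (\<alpha> 1 + k)"] conjI continuous_chain) simp
  qed
  show "ext_partial \<Omega> \<alpha> (F k) x = F (\<alpha> 1 + k) x" if "x \<in> D"
    using that by (intro ext_partial_unique continuous_chain) (auto simp: mpartial_real deriv_chain)
qed

end

interpretation line: smooth_domain "UNIV :: real set" UNIV
  by unfold_locales auto

lemma ext_partial_UNIV: "ext_partial UNIV \<alpha> f = mpartial \<alpha> f"
  by (simp add: ext_partial_def fun_eq_iff)

lemma derivative_chain_smooth:
  fixes f :: "real \<Rightarrow> real"
  assumes "smooth UNIV f"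
  shows "derivative_chain (\<lambda>k. (deriv ^^ k) f)"
proof
  fix k x
  have "smooth UNIV (partials (replicate k 1) f)"
    using assms by (rule smooth_partials) auto
  then have sm: "smooth UNIV ((deriv ^^ k) f)" by (simp add: foldr_replicate partial_real)
  show "((deriv ^^ k) f has_real_derivative (deriv ^^ Suc k) f x) (at x)"
    using smooth_basis_line_derivative[OF sm open_UNIV, of 0 x 1] by (simp add: partial_real)
qed

lemma moderate_deriv:
  assumes "u \<in> moderate UNIV (UNIV :: real set)"
  shows "(\<lambda>\<epsilon>. deriv (u \<epsilon>)) \<in> moderate UNIV UNIV"
  unfolding moderate_iff
proof (intro conjI ballI allI impI)
  fix \<epsilon> :: real assume "\<epsilon> \<in> {0<..1}"
  then interpret derivative_chain "\<lambda>k. (deriv ^^ k) (u \<epsilon>)"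
    using assms by (intro derivative_chain_smooth line.Cinf_smooth) (auto simp: moderate_iff)
  show "deriv (u \<epsilon>) \<in> Cinf UNIV UNIV" using Cinf_chain(1)[OF line.smooth_domain_axioms, of 1] by simp
next
  fix K :: "real set" and \<alpha> :: "real \<Rightarrow> nat" assume "compact K \<and> K \<subseteq> UNIV"
  then have "moderate_on K (\<lambda>\<epsilon>. ext_partial UNIV (\<lambda>_. Suc (\<alpha> 1)) (u \<epsilon>))"
    using assms by (intro moderate_onD) auto
  then show "moderate_on K (\<lambda>\<epsilon>. ext_partial UNIV \<alpha> (deriv (u \<epsilon>)))"
    by (simp add: ext_partial_UNIV mpartial_real funpow_Suc_right del: funpow.simps)
qed

lemma negligible_deriv:
  assumes "u \<in> negligible_nets UNIV (UNIV :: real set)"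
  shows "(\<lambda>\<epsilon>. deriv (u \<epsilon>)) \<in> negligible_nets UNIV UNIV"
  unfolding negligible_nets_iff
proof (intro conjI ballI allI impI)
  fix \<epsilon> :: real assume "\<epsilon> \<in> {0<..1}"
  then show "deriv (u \<epsilon>) \<in> Cinf UNIV UNIV"
    using moderate_deriv[OF negligible_nets_moderate[OF assms]] by (simp add: moderate_iff)
next
  fix K :: "real set" and \<alpha> :: "real \<Rightarrow> nat" assume "compact K \<and> K \<subseteq> UNIV"
  then have "negligible_on K (\<lambda>\<epsilon>. ext_partial UNIV (\<lambda>_. Suc (\<alpha> 1)) (u \<epsilon>))"
    using assms by (intro negligible_nets_onD) auto
  then show "negligible_on K (\<lambda>\<epsilon>. ext_partial UNIV \<alpha> (deriv (u \<epsilon>)))"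
    by (simp add: ext_partial_UNIV mpartial_real funpow_Suc_right del: funpow.simps)
qed

lemma negligible_nets_cong:
  assumes "u \<in> negligible_nets \<Omega> D" "\<And>\<epsilon>. 0 < \<epsilon> \<Longrightarrow> \<epsilon> \<le> 1 \<Longrightarrow> u \<epsilon> = v \<epsilon>"
  shows "v \<in> negligible_nets \<Omega> D"
proof -
  have "negligible_on K (\<lambda>\<epsilon>. ext_partial \<Omega> \<alpha> (v \<epsilon>)) \<longleftrightarrow> negligible_on K (\<lambda>\<epsilon>. ext_partial \<Omega> \<alpha> (u \<epsilon>))" for K \<alpha>
    by (rule negligible_on_cong) (simp add: assms(2))
  with assms show ?thesis by (simp add: negligible_nets_iff)
qed

text \<open>Differentiation in the algebra may be carried out on any given representative, although
  \<^const>\<open>gen_deriv\<close> picks one by choice.\<close>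

lemma gen_deriv_class:
  assumes "f \<in> moderate UNIV (UNIV :: real set)"
  shows "gen_deriv (gen_class UNIV UNIV f) = gen_class UNIV UNIV (\<lambda>\<epsilon>. deriv (f \<epsilon>))"
proof -
  let ?g = "rep (gen_class UNIV UNIV f)"
  note g = line.rep_gen_class[OF assms]
  have "(\<lambda>\<epsilon>. deriv ((?g - f) \<epsilon>)) \<in> negligible_nets UNIV UNIV" by (rule negligible_deriv[OF g(2)])
  moreover have "deriv ((?g - f) \<epsilon>) = ((\<lambda>\<epsilon>. deriv (?g \<epsilon>)) - (\<lambda>\<epsilon>. deriv (f \<epsilon>))) \<epsilon>" if "0 < \<epsilon>" "\<epsilon> \<le> 1" for \<epsilon>
  proof -
    have sm: "smooth UNIV (?g \<epsilon>)" "smooth UNIV (f \<epsilon>)"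
      using g(1) assms that by (auto simp: moderate_iff intro!: line.Cinf_smooth)
    have eq: "(?g - f) \<epsilon> = (\<lambda>x. 1 * ?g \<epsilon> x + (- 1) * f \<epsilon> x)" by (simp add: fun_eq_iff)
    show ?thesis
      unfolding eq using partial_lincomb[OF sm, of _ 1 1 "- 1"]
      by (simp add: partial_real fun_eq_iff)
  qed
  ultimately have "(\<lambda>\<epsilon>. deriv (?g \<epsilon>)) - (\<lambda>\<epsilon>. deriv (f \<epsilon>)) \<in> negligible_nets UNIV UNIV"
    by (rule negligible_nets_cong)
  then show ?thesis
    unfolding gen_deriv_def using line.gen_class_eq_iff moderate_deriv g(1) assms by blast
qed

lemma rt_class_eqI:
  assumes "y \<in> rt_moderate" "(\<lambda>\<epsilon>. x \<epsilon> - y \<epsilon>) \<in> rt_negligible"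
  shows "rt_class x = rt_class y"
proof -
  have "x \<in> rt_moderate"
    using rt_moderate_add[OF assms(1) rt_negligible_moderate[OF assms(2)]] by simp
  then show ?thesis
    unfolding rt_class_def using net_class_eq_iff[OF equiv_rt _ assms(1), of x] assms(2)
    by (simp add: fun_diff_def)
qed

lemma moderate_at: "f \<in> moderate UNIV (UNIV :: real set) \<Longrightarrow> (\<lambda>\<epsilon>. f \<epsilon> a) \<in> rt_moderate"
  using moderate_onD[of f UNIV UNIV "{a}" "\<lambda>_. 0"]
  by (simp add: rt_moderate_iff moderate_on_iff ext_partial_def mpartial_real)

lemma negligible_at: "f \<in> negligible_nets UNIV (UNIV :: real set) \<Longrightarrow> (\<lambda>\<epsilon>. f \<epsilon> a) \<in> rt_negligible"
  using negligible_nets_onD[of f UNIV UNIV "{a}" "\<lambda>_. 0"]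
  by (simp add: rt_negligible_iff negligible_on_iff ext_partial_def mpartial_real)

lemma gen_at_class:
  assumes "f \<in> moderate UNIV (UNIV :: real set)"
  shows "gen_at (gen_class UNIV UNIV f) a = rt_class (\<lambda>\<epsilon>. f \<epsilon> a)"
  unfolding gen_at_def
  using negligible_at[OF line.rep_gen_class(2)[OF assms], of a]
  by (intro rt_class_eqI moderate_at assms) simp

section \<open>Interpolation and convexity\<close>

text \<open>A difference quotient of \<open>g0\<close> over an interval of length \<open>t\<close> that contains \<open>x\<close> is a value of \<open>g1\<close>
  at distance at most \<open>t\<close> from \<open>x\<close>. Small \<open>g0\<close> and a bound for \<open>g2\<close> thus make \<open>g1\<close> small.\<close>

lemma landau_inequality:
  fixes g0 g1 g2 :: "real \<Rightarrow> real"
  assumes d0: "\<And>x. (g0 has_real_derivative g1 x) (at x)" and d1: "\<And>x. (g1 has_real_derivative g2 x) (at x)"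
    and A: "\<And>x. x \<in> {0..1} \<Longrightarrow> \<bar>g0 x\<bar> \<le> A" and B: "\<And>x. x \<in> {0..1} \<Longrightarrow> \<bar>g2 x\<bar> \<le> B"
    and t: "0 < t" "t \<le> 1 / 2" and x: "x \<in> {0..1}"
  shows "\<bar>g1 x\<bar> \<le> 2 * A / t + B * t"
proof -
  \<comment> \<open>The interval is placed to the right or left of \<open>x\<close> so that it stays inside \<open>[0,1]\<close>.\<close>
  define a where "a = (if x \<le> 1 / 2 then x else x - t)"
  have a: "0 \<le> a" "a + t \<le> 1" "a \<le> x" "x \<le> a + t" using t x by (auto simp: a_def)
  have "\<exists>\<xi>>a. \<xi> < a + t \<and> g0 (a + t) - g0 a = (a + t - a) * g1 \<xi>"
    using t d0 by (intro MVT2) auto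
  then obtain \<xi> where \<xi>: "a < \<xi>" "\<xi> < a + t" "g0 (a + t) - g0 a = t * g1 \<xi>" by auto
  have "\<bar>t * g1 \<xi>\<bar> \<le> 2 * A"
    using A[of a] A[of "a + t"] a t unfolding \<xi>(3)[symmetric] by auto
  then have 1: "\<bar>g1 \<xi>\<bar> \<le> 2 * A / t" using t by (simp add: abs_mult field_simps)
  have "norm (g1 x - g1 \<xi>) \<le> B * norm (x - \<xi>)"
    by (rule field_differentiable_bound[of "{0..1}" g1 g2])
      (use d1 B x \<xi> a in \<open>auto intro: has_field_derivative_at_within\<close>)
  also have "\<dots> \<le> B * t"
    using B[OF x] \<xi> a by (intro mult_left_mono) auto
  finally show ?thesis using 1 by auto
qed

text \<open>Landau's inequality with a step that is a power of \<open>\<epsilon>\<close>: large enough for the negligible net to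
  survive the division by it, small enough to compensate the growth of the second derivative.\<close>

lemma negligible_on_derivative:
  assumes chain: "\<And>\<epsilon>. \<epsilon> \<in> {0<..1} \<Longrightarrow> derivative_chain (\<lambda>k. H k \<epsilon>)"
    and m: "\<And>k. moderate_on {0..1} (H k)" and n: "negligible_on {0..1} (H k)"
  shows "negligible_on {0..1} (H (Suc k))"
  unfolding negligible_on_def bigO_on_def
proof
  fix m :: nat
  obtain N where N: "\<forall>\<^sub>F \<epsilon> in at_right 0. \<forall>x\<in>{0..1}. \<bar>H (Suc (Suc k)) \<epsilon> x\<bar> \<le> (1 / \<epsilon>) ^ N"
    using m by (rule moderate_onE)
  have "\<forall>\<^sub>F \<epsilon> in at_right 0. \<forall>x\<in>{0..1}. \<bar>H k \<epsilon> x\<bar> \<le> \<epsilon> ^ (N + 2 * m)"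
    using n by (rule negligible_onD)
  with N eventually_at_right_0_le[OF zero_less_one]
  have "\<forall>\<^sub>F \<epsilon> in at_right 0. \<forall>x\<in>{0..1}. \<bar>H (Suc k) \<epsilon> x\<bar> \<le> 5 * \<epsilon> ^ m"
  proof eventually_elim
    case (elim \<epsilon>)
    then interpret derivative_chain "\<lambda>k. H k \<epsilon>" by (intro chain) auto
    show ?case
    proof
      fix x :: real assume x: "x \<in> {0..1}"
      \<comment> \<open>The factor \<open>\<epsilon> ^ N\<close> cancels the bound for the second derivative and leaves order \<open>m\<close>.\<close>
      let ?t = "\<epsilon> ^ (N + m) / 2"
      have "\<epsilon> ^ (N + m) \<le> 1" using elim by (intro power_le_one) auto
      then have "\<bar>H (Suc k) \<epsilon> x\<bar> \<le> 2 * \<epsilon> ^ (N + 2 * m) / ?t + (1 / \<epsilon>) ^ N * ?t"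
        using elim x by (intro landau_inequality[OF chain chain]) auto
      also have "2 * \<epsilon> ^ (N + 2 * m) / ?t = 4 * \<epsilon> ^ m"
      proof -
        have "N + 2 * m = (N + m) + m" by simp
        then have "\<epsilon> ^ (N + 2 * m) = \<epsilon> ^ (N + m) * \<epsilon> ^ m" by (simp only: power_add)
        then show ?thesis using elim by simp
      qed
      also have "(1 / \<epsilon>) ^ N * ?t = \<epsilon> ^ m / 2"
        using elim by (simp add: power_add power_one_over)
      finally show "\<bar>H (Suc k) \<epsilon> x\<bar> \<le> 5 * \<epsilon> ^ m" using elim zero_le_power[of \<epsilon> m] by linarith
    qed
  qed
  then show "\<exists>C. \<forall>\<^sub>F \<epsilon> in at_right 0. \<forall>x\<in>{0..1}. \<bar>H (Suc k) \<epsilon> x\<bar> \<le> C * \<epsilon> ^ m" by blast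
qed

lemma negligible_on_all_derivatives:
  assumes "\<And>\<epsilon>. \<epsilon> \<in> {0<..1} \<Longrightarrow> derivative_chain (\<lambda>k. H k \<epsilon>)"
    and "\<And>k. moderate_on {0..1} (H k)" "negligible_on {0..1} (H 0)"
  shows "negligible_on {0..1} (H k)"
  using assms by (induction k) (auto intro: negligible_on_derivative)

text \<open>The quadratic term makes \<open>h\<close> convex, and the affine term makes \<open>h\<close> and its derivative vanish at
  \<open>0\<close>; hence the derivative of \<open>h\<close> is nonnegative on \<open>[0,1]\<close>.\<close>

lemma almost_convex_taylor:
  fixes f f1 f2 :: "real \<Rightarrow> real"
  assumes d0: "\<And>x. (f has_real_derivative f1 x) (at x)" and d1: "\<And>x. (f1 has_real_derivative f2 x) (at x)"
    and n: "\<And>s. s \<in> {0..1} \<Longrightarrow> - n \<le> f2 s" and s: "s \<in> {0..1}"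
  defines "h \<equiv> \<lambda>s. f s - f 0 - f1 0 * s + n * s\<^sup>2 / 2"
  shows "0 \<le> h s" "h s \<le> h 1"
proof -
  have h: "(h has_real_derivative f1 s - f1 0 + n * s) (at s)" for s
    unfolding h_def by (auto intro!: derivative_eq_intros d0)
  have h': "((\<lambda>s. f1 s - f1 0 + n * s) has_real_derivative f2 s + n) (at s)" for s
    by (auto intro!: derivative_eq_intros d1[unfolded One_nat_def])
  have pos: "0 \<le> f1 s - f1 0 + n * s" if "s \<in> {0..1}" for s
  proof -
    have "f1 0 - f1 0 + n * 0 \<le> f1 s - f1 0 + n * s"
    proof (rule DERIV_nonneg_imp_nondecreasing[of 0 s "\<lambda>s. f1 s - f1 0 + n * s"])
      fix x assume "0 \<le> x" "x \<le> s"
      then show "\<exists>y. ((\<lambda>s. f1 s - f1 0 + n * s) has_real_derivative y) (at x) \<and> 0 \<le> y"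
        using h'[of x] n[of x] that by (intro exI[of _ "f2 x + n"]) auto
    qed (use that in auto)
    then show ?thesis by simp
  qed
  have mono: "h a \<le> h b" if "0 \<le> a" "a \<le> b" "b \<le> 1" for a b
  proof (rule DERIV_nonneg_imp_nondecreasing[OF that(2)])
    fix x assume "a \<le> x" "x \<le> b"
    then show "\<exists>y. (h has_real_derivative y) (at x) \<and> 0 \<le> y"
      using h[of x] pos[of x] that by (intro exI[of _ "f1 x - f1 0 + n * x"]) auto
  qed
  have "h 0 = 0" by (simp add: h_def)
  then show "0 \<le> h s" "h s \<le> h 1" using mono[of 0 s] mono[of s 1] s by auto
qed

section \<open>Variations as generalized numbers\<close>

locale generalized_functional =
  fixes \<Omega> :: "(real ^ 'p::finite) set"
    and L :: "(real \<Rightarrow> ('p, 'q::finite, 'n::finite) jet_space \<Rightarrow> real) set"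
  assumes \<Omega>: "open \<Omega>" "bounded \<Omega>" and L: "L \<in> gen_temp \<Omega>"
begin

sublocale closed_domain: smooth_domain \<Omega> "closure \<Omega>"
  by (rule smooth_domain_closure[OF \<Omega>(1)])

text \<open>The class \<open>L\<close> contains the net that generates it, since \<open>0\<close> is negligible; so the choice in
  \<^const>\<open>rep\<close> is from a nonempty set.\<close>

lemma rep_L: "rep L \<in> temp_moderate \<Omega>"
proof -
  interpret J: smooth_domain "\<Omega> \<times> UNIV :: ('p, 'q, 'n) jet_space set" "closure \<Omega> \<times> UNIV"
    by (rule smooth_domain_jet[OF \<Omega>(1)])
  obtain l :: "real \<Rightarrow> ('p, 'q, 'n) jet_space \<Rightarrow> real"
    where l: "l \<in> temp_moderate \<Omega>" "L = net_rel (temp_moderate \<Omega>) (temp_negligible \<Omega>) `` {l}"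
    using L unfolding gen_temp_def by (rule quotientE)
  have "bigO_on (closure \<Omega> \<times> UNIV) (\<lambda>\<epsilon> z. ext_partial (\<Omega> \<times> UNIV) \<beta> ((l - l) \<epsilon>) z / (1 + norm z) ^ 0)
      (\<lambda>\<epsilon>. \<epsilon> ^ m)" for \<beta> m
    unfolding bigO_on_def by (intro exI[of _ 0]) (simp add: fun_diff_def J.ext_partial_zero)
  then have "l - l \<in> temp_negligible \<Omega>"
    unfolding temp_negligible_def mem_Collect_eq
    by (intro conjI ballI allI exI[of _ 0]) (simp add: fun_diff_def J.Cinf_zero, blast)
  then have "l \<in> L" using l by (auto simp: net_rel_def)
  then have "rep L \<in> L" unfolding rep_def by (rule someI[of "\<lambda>l. l \<in> L"])
  then show ?thesis using l(2) by (auto simp: net_rel_def)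
qed

text \<open>The derivatives of \<open>s \<mapsto> \<L>(u + s v)\<close> for representatives \<open>u\<close>, \<open>v\<close>: at \<open>s = 0\<close> and along the line.\<close>

abbreviation gfun :: "nat \<Rightarrow> ('q \<Rightarrow> real \<Rightarrow> real ^ 'p \<Rightarrow> real) \<Rightarrow> ('q \<Rightarrow> real \<Rightarrow> real ^ 'p \<Rightarrow> real) \<Rightarrow> real \<Rightarrow> real"
  where "gfun k u v \<epsilon> \<equiv> variation k \<Omega> (rep L \<epsilon>) (\<lambda>i. u i \<epsilon>) (\<lambda>i. v i \<epsilon>)"

abbreviation gline :: "nat \<Rightarrow> ('q \<Rightarrow> real \<Rightarrow> real ^ 'p \<Rightarrow> real) \<Rightarrow> ('q \<Rightarrow> real \<Rightarrow> real ^ 'p \<Rightarrow> real)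
    \<Rightarrow> real \<Rightarrow> real \<Rightarrow> real"
  where "gline k u v \<epsilon> s \<equiv> variation k \<Omega> (rep L \<epsilon>) (\<lambda>i x. u i \<epsilon> x + s * v i \<epsilon> x) (\<lambda>i. v i \<epsilon>)"

context
  fixes u v :: "'q \<Rightarrow> real \<Rightarrow> real ^ 'p \<Rightarrow> real"
  assumes u: "\<And>i. u i \<in> moderate \<Omega> (closure \<Omega>)" and v: "\<And>i. v i \<in> moderate \<Omega> (closure \<Omega>)"
begin

lemma gline_chain:
  assumes "\<epsilon> \<in> {0<..1}"
  shows "derivative_chain (\<lambda>k. gline k u v \<epsilon>)"
proof
  have C: "u i \<epsilon> \<in> Cinf \<Omega> (closure \<Omega>)" "v i \<epsilon> \<in> Cinf \<Omega> (closure \<Omega>)" for i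
    using u v assms by (auto simp: moderate_iff)
  show "(gline k u v \<epsilon> has_real_derivative gline (Suc k) u v \<epsilon> s) (at s)" for k s
    by (rule variation_has_derivative[OF \<Omega> temp_moderate_tempered(2)[OF \<Omega>(1) rep_L assms] C])
qed

lemma gline_moderate_on: "bounded K \<Longrightarrow> moderate_on K (gline k u v)"
  by (rule variation_line_moderate[OF \<Omega> rep_L u v])

lemma gline_moderate: "gline k u v \<in> moderate UNIV UNIV"
  unfolding moderate_iff
proof (intro conjI ballI allI impI)
  show "gline k u v \<epsilon> \<in> Cinf UNIV UNIV" if "\<epsilon> \<in> {0<..1}" for \<epsilon>
    by (rule derivative_chain.Cinf_chain(1)[OF gline_chain[OF that] line.smooth_domain_axioms])
  fix K :: "real set" and \<alpha> :: "real \<Rightarrow> nat" assume "compact K \<and> K \<subseteq> UNIV"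
  then have "moderate_on K (gline (\<alpha> 1 + k) u v)"
    by (intro gline_moderate_on compact_imp_bounded) auto
  moreover have "moderate_on K (\<lambda>\<epsilon>. ext_partial UNIV \<alpha> (gline k u v \<epsilon>))
      \<longleftrightarrow> moderate_on K (gline (\<alpha> 1 + k) u v)"
    by (rule moderate_on_cong)
      (use derivative_chain.Cinf_chain(2)[OF gline_chain line.smooth_domain_axioms] in auto)
  ultimately show "moderate_on K (\<lambda>\<epsilon>. ext_partial UNIV \<alpha> (gline k u v \<epsilon>))" by simp
qed

lemma gen_deriv_gline:
  "gen_deriv (gen_class UNIV UNIV (gline k u v)) = gen_class UNIV UNIV (gline (Suc k) u v)"
proof -
  have "(\<lambda>\<epsilon> x. 0) \<in> negligible_nets UNIV (UNIV :: real set)" by (rule line.zero_negligible)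
  then have "(\<lambda>\<epsilon>. deriv (gline k u v \<epsilon>)) - gline (Suc k) u v \<in> negligible_nets UNIV UNIV"
  proof (rule negligible_nets_cong)
    fix \<epsilon> :: real assume "0 < \<epsilon>" "\<epsilon> \<le> 1"
    then have "deriv (gline k u v \<epsilon>) = gline (Suc k) u v \<epsilon>"
      using derivative_chain.deriv_chain[OF gline_chain, of \<epsilon> 1 k] by simp
    then show "(\<lambda>x. 0) = ((\<lambda>\<epsilon>. deriv (gline k u v \<epsilon>)) - gline (Suc k) u v) \<epsilon>"
      by (simp add: fun_eq_iff)
  qed
  then show ?thesis
    unfolding gen_deriv_class[OF gline_moderate]
    using line.gen_class_eq_iff[OF moderate_deriv[OF gline_moderate] gline_moderate] by blast
qed

lemma gfun_moderate: "gfun k u v \<in> rt_moderate"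
  using moderate_at[OF gline_moderate, of k 0] by simp

end

lemma gen_functional_eq: "gen_functional \<Omega> L u = rt_class (gfun 0 (\<lambda>i. rep (u i)) v)"
  by (simp add: gen_functional_def variation_0)

lemma functional_line_eq:
  "functional_line \<Omega> L u v = gen_class UNIV UNIV (gline 0 (\<lambda>i. rep (u i)) (\<lambda>i. rep (v i)))"
  by (simp add: functional_line_def variation_0)

lemma variations_eq:
  assumes "\<And>i. u i \<in> gen \<Omega> (closure \<Omega>)" "\<And>i. v i \<in> gen \<Omega> (closure \<Omega>)"
  shows "first_variation \<Omega> L u v = rt_class (gfun 1 (\<lambda>i. rep (u i)) (\<lambda>i. rep (v i)))"
    and "second_variation \<Omega> L u v = rt_class (gfun 2 (\<lambda>i. rep (u i)) (\<lambda>i. rep (v i)))"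
proof -
  note r = closed_domain.rep_gen(2)[OF assms(1)] closed_domain.rep_gen(2)[OF assms(2)]
  let ?g = "\<lambda>k. gline k (\<lambda>i. rep (u i)) (\<lambda>i. rep (v i))"
  have "gen_deriv (gen_class UNIV UNIV (?g k)) = gen_class UNIV UNIV (?g (Suc k))" for k
    by (rule gen_deriv_gline[OF r])
  moreover have "gen_at (gen_class UNIV UNIV (?g k)) 0 = rt_class (\<lambda>\<epsilon>. ?g k \<epsilon> 0)" for k
    by (rule gen_at_class[OF gline_moderate[OF r]])
  ultimately show "first_variation \<Omega> L u v = rt_class (gfun 1 (\<lambda>i. rep (u i)) (\<lambda>i. rep (v i)))"
    "second_variation \<Omega> L u v = rt_class (gfun 2 (\<lambda>i. rep (u i)) (\<lambda>i. rep (v i)))"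
    unfolding first_variation_def second_variation_def functional_line_eq
    by (simp_all add: numeral_2_eq_2)
qed

text \<open>Since \<open>(u + s v) + \<sigma> v = u + (\<sigma> + s) v\<close>, the number \<open>\<delta>\<^sup>2\<L>(u + s v; v)\<close> is the second derivative of \<open>\<sigma> \<mapsto> \<L>(u + \<sigma> v)\<close> at \<open>s\<close>.
  This function is smooth on all of \<open>\<real>\<close>, so its extended derivatives on \<open>[0,1]\<close> are the usual ones.\<close>

lemma second_variation_line_zero:
  assumes u: "\<And>i. u i \<in> gen \<Omega> (closure \<Omega>)" and v: "\<And>i. v i \<in> gen \<Omega> (closure \<Omega>)"
    and n: "\<And>k. 2 \<le> k \<Longrightarrow> negligible_on {0..1} (gline k (\<lambda>i. rep (u i)) (\<lambda>i. rep (v i)))"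
  shows "second_variation_line \<Omega> L u v = gen_zero {0<..<1} {0..1}"
proof -
  interpret I: smooth_domain "{0<..<1::real}" "{0..1}" by unfold_locales auto
  let ?u = "\<lambda>i. rep (u i)" and ?v = "\<lambda>i. rep (v i)"
  note r = closed_domain.rep_gen(2)[OF u] closed_domain.rep_gen(2)[OF v]
  have "gline 2 ?u ?v \<in> negligible_nets {0<..<1} {0..1}"
    unfolding negligible_nets_iff
  proof (intro conjI ballI allI impI)
    show "gline 2 ?u ?v \<epsilon> \<in> Cinf {0<..<1} {0..1}" if "\<epsilon> \<in> {0<..1}" for \<epsilon>
      by (rule derivative_chain.Cinf_chain(1)[OF gline_chain[OF r that] I.smooth_domain_axioms])
    fix K :: "real set" and \<alpha> :: "real \<Rightarrow> nat" assume K: "compact K \<and> K \<subseteq> {0..1}"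
    have "negligible_on K (gline (\<alpha> 1 + 2) ?u ?v)"
      using K by (intro negligible_on_mono[OF n[of "\<alpha> 1 + 2"]] always_eventually) auto
    moreover have "negligible_on K (\<lambda>\<epsilon>. ext_partial {0<..<1} \<alpha> (gline 2 ?u ?v \<epsilon>))
        \<longleftrightarrow> negligible_on K (gline (\<alpha> 1 + 2) ?u ?v)"
    proof (rule negligible_on_cong)
      fix \<epsilon> :: real and x assume "0 < \<epsilon>" "\<epsilon> \<le> 1" "x \<in> K"
      then show "ext_partial {0<..<1} \<alpha> (gline 2 ?u ?v \<epsilon>) x = gline (\<alpha> 1 + 2) ?u ?v \<epsilon> x"
        using K by (intro derivative_chain.Cinf_chain(2)[OF gline_chain[OF r] I.smooth_domain_axioms]) auto
    qed
    ultimately show "negligible_on K (\<lambda>\<epsilon>. ext_partial {0<..<1} \<alpha> (gline 2 ?u ?v \<epsilon>))" by simp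
  qed
  then have "(\<lambda>\<epsilon> s. deriv (deriv (\<lambda>\<sigma>. classical_functional \<Omega> (rep L \<epsilon>)
        (\<lambda>i x. (rep (u i) \<epsilon> x + s * rep (v i) \<epsilon> x) + \<sigma> * rep (v i) \<epsilon> x))) 0)
      \<in> negligible_nets {0<..<1} {0..1}" (is "?net \<in> _")
  proof (rule negligible_nets_cong)
    fix \<epsilon> :: real assume \<epsilon>: "0 < \<epsilon>" "\<epsilon> \<le> 1"
    then interpret derivative_chain "\<lambda>k. gline k ?u ?v \<epsilon>" by (intro gline_chain[OF r]) auto
    show "gline 2 ?u ?v \<epsilon> = ?net \<epsilon>"
    proof
      fix s
      have shift: "classical_functional \<Omega> (rep L \<epsilon>)
          (\<lambda>i x. (rep (u i) \<epsilon> x + s * rep (v i) \<epsilon> x) + \<sigma> * rep (v i) \<epsilon> x) = gline 0 ?u ?v \<epsilon> (\<sigma> + s)" for \<sigma>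
        unfolding variation_0 by (simp add: algebra_simps)
      have d: "deriv (\<lambda>\<sigma>. gline k ?u ?v \<epsilon> (\<sigma> + s)) = (\<lambda>\<sigma>. gline (Suc k) ?u ?v \<epsilon> (\<sigma> + s))" for k
        using chain[of k] DERIV_shift[of "gline k ?u ?v \<epsilon>"] by (intro ext DERIV_imp_deriv) blast
      show "gline 2 ?u ?v \<epsilon> s = ?net \<epsilon> s"
        unfolding shift d by (simp add: numeral_2_eq_2)
    qed
  qed
  then have "?net \<in> moderate {0<..<1} {0..1}" "?net - (\<lambda>\<epsilon> s. 0) \<in> negligible_nets {0<..<1} {0..1}"
    by (rule negligible_nets_moderate, simp only: fun_diff_def diff_0_right)
  then show ?thesis
    unfolding second_variation_line_def gen_zero_def
    using I.gen_class_eq_iff[OF _ I.zero_moderate] by blast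
qed

lemma admissible_gen: "u \<in> admissible \<Omega> u\<^sub>0 \<Longrightarrow> u i \<in> gen \<Omega> (closure \<Omega>)"
  by (simp add: admissible_def)

text \<open>Evaluating the hypothesis at the generalized point where \<open>f\<^sub>\<epsilon>''\<close> is minimal on \<open>[0,1]\<close> gives one
  negligible error for all \<open>s\<close>.\<close>

lemma second_variation_lower_bound:
  assumes u0: "\<And>i. u\<^sub>0 i \<in> gen_bd \<Omega>" and u: "u \<in> admissible \<Omega> u\<^sub>0" and v: "v \<in> admissible_zero \<Omega>"
    and nonneg: "\<And>w. w \<in> admissible \<Omega> u\<^sub>0 \<Longrightarrow> rt_nonneg (second_variation \<Omega> L w v)"
  obtains n where "n \<in> rt_negligible"
    "\<And>\<epsilon> s. \<epsilon> \<in> {0<..1} \<Longrightarrow> s \<in> {0..1} \<Longrightarrow>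
        - n \<epsilon> \<le> gline 2 (\<lambda>i. rep (u i)) (\<lambda>i. rep (v i)) \<epsilon> s"
proof -
  have vg: "v i \<in> gen \<Omega> (closure \<Omega>)" for i using v unfolding admissible_zero_def by (rule admissible_gen)
  let ?u = "\<lambda>i. rep (u i)" and ?v = "\<lambda>i. rep (v i)"
  note ru = closed_domain.rep_gen(2)[OF admissible_gen[OF u]] and rv = closed_domain.rep_gen(2)[OF vg]
  have "\<forall>\<epsilon>\<in>{0<..1}. \<exists>a. a \<in> {0..1} \<and> (\<forall>s\<in>{0..1}. gline 2 ?u ?v \<epsilon> a \<le> gline 2 ?u ?v \<epsilon> s)"
  proof
    fix \<epsilon> :: real assume "\<epsilon> \<in> {0<..1}"
    then have "continuous_on {0..1} (gline 2 ?u ?v \<epsilon>)"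
      by (rule derivative_chain.continuous_chain[OF gline_chain[OF ru rv]])
    then have "\<exists>a\<in>{0..1}. \<forall>s\<in>{0..1}. gline 2 ?u ?v \<epsilon> a \<le> gline 2 ?u ?v \<epsilon> s"
      by (intro continuous_attains_inf) simp_all
    then show "\<exists>a. a \<in> {0..1} \<and> (\<forall>s\<in>{0..1}. gline 2 ?u ?v \<epsilon> a \<le> gline 2 ?u ?v \<epsilon> s)" by blast
  qed
  from bchoice[OF this] obtain a where a: "\<forall>\<epsilon>\<in>{0<..1}. a \<epsilon> \<in> {0..1} \<and>
      (\<forall>s\<in>{0..1}. gline 2 ?u ?v \<epsilon> (a \<epsilon>) \<le> gline 2 ?u ?v \<epsilon> s)" by (elim exE)
  have a1: "\<bar>a \<epsilon>\<bar> \<le> 1" if "\<epsilon> \<in> {0<..1}" for \<epsilon>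
    using a[rule_format, OF that] by auto
  let ?z = "\<lambda>i \<epsilon> x. rep (u i) \<epsilon> x + a \<epsilon> * rep (v i) \<epsilon> x"
  let ?w = "\<lambda>i. gen_class \<Omega> (closure \<Omega>) (?z i)"
  have w: "?w \<in> admissible \<Omega> u\<^sub>0" by (rule admissible_add_scaled[OF \<Omega>(1) u v u0 a1])
  have z: "?z i \<in> moderate \<Omega> (closure \<Omega>)" for i
    using closed_domain.moderate_lincomb[OF ru rv, of "\<lambda>_. 1" a] a1 by simp
  note rw = closed_domain.rep_gen_class[OF z]
  have "rt_nonneg (rt_class (gfun 2 (\<lambda>i. rep (?w i)) ?v))"
    using nonneg[OF w] variations_eq(2)[OF admissible_gen[OF w] vg] by simp
  then obtain m where m: "m \<in> rt_negligible"
    "\<And>\<epsilon>. 0 < \<epsilon> \<Longrightarrow> \<epsilon> \<le> 1 \<Longrightarrow> 0 \<le> m \<epsilon> \<and> - m \<epsilon> \<le> gfun 2 (\<lambda>i. rep (?w i)) ?v \<epsilon>"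
    by (rule rt_nonneg_classD) blast
  \<comment> \<open>The hypothesis speaks of the chosen representative of \<open>?w\<close>, the bound is about the net \<open>?z\<close>.\<close>
  let ?d = "\<lambda>\<epsilon>. gfun 2 (\<lambda>i. rep (?w i)) ?v \<epsilon> - gfun 2 ?z ?v \<epsilon>"
  have d: "?d \<in> rt_negligible"
    by (rule variation_negligible[OF \<Omega> rep_L z rv rw])
  show ?thesis
  proof (rule that)
    show "(\<lambda>\<epsilon>. m \<epsilon> + \<bar>?d \<epsilon>\<bar>) \<in> rt_negligible" by (intro rt_negligible_add rt_negligible_abs m d)
    fix \<epsilon> s :: real assume \<epsilon>: "\<epsilon> \<in> {0<..1}" and s: "s \<in> {0..1}"
    have "gfun 2 ?z ?v \<epsilon> \<le> gline 2 ?u ?v \<epsilon> s" using a[rule_format, OF \<epsilon>] s by blast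
    moreover have "- m \<epsilon> \<le> gfun 2 (\<lambda>i. rep (?w i)) ?v \<epsilon>" using m(2) \<epsilon> by auto
    ultimately show "- (m \<epsilon> + \<bar>?d \<epsilon>\<bar>) \<le> gline 2 ?u ?v \<epsilon> s" by linarith
  qed
qed

text \<open>The chosen representatives of \<open>w\<close>, \<open>u\<close> and \<open>w - u\<close> satisfy \<open>w = u + (w - u)\<close> only up to a negligible
  net, and so do the chosen representatives of the values of the functional.\<close>

lemma functional_increment:
  assumes u0: "\<And>i. u\<^sub>0 i \<in> gen_bd \<Omega>" and u: "u \<in> admissible \<Omega> u\<^sub>0" and w: "w \<in> admissible \<Omega> u\<^sub>0"
  defines "v \<equiv> \<lambda>i. gen_class \<Omega> (closure \<Omega>) (rep (w i) - rep (u i))"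
  shows "(\<lambda>\<epsilon>. (rep (gen_functional \<Omega> L w) \<epsilon> - rep (gen_functional \<Omega> L u) \<epsilon>)
      - (gline 0 (\<lambda>i. rep (u i)) (\<lambda>i. rep (v i)) \<epsilon> 1 - gline 0 (\<lambda>i. rep (u i)) (\<lambda>i. rep (v i)) \<epsilon> 0))
      \<in> rt_negligible"
    and "(\<lambda>\<epsilon>. rep (gen_functional \<Omega> L w) \<epsilon> - rep (gen_functional \<Omega> L u) \<epsilon>) \<in> rt_moderate"
proof -
  let ?u = "\<lambda>i. rep (u i)" and ?v = "\<lambda>i. rep (v i)" and ?w = "\<lambda>i. rep (w i)"
  note ru = closed_domain.rep_gen(2)[OF admissible_gen[OF u]]
    and rw = closed_domain.rep_gen(2)[OF admissible_gen[OF w]]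
  have m: "?w i - ?u i \<in> moderate \<Omega> (closure \<Omega>)" for i by (rule closed_domain.moderate_diff[OF rw ru])
  have rv: "?v i \<in> moderate \<Omega> (closure \<Omega>)" "?v i - (?w i - ?u i) \<in> negligible_nets \<Omega> (closure \<Omega>)" for i
    using closed_domain.rep_gen_class[OF m] by (auto simp: v_def)
  let ?z = "\<lambda>i \<epsilon> x. ?u i \<epsilon> x + 1 * ?v i \<epsilon> x"
  have z: "?z i \<in> moderate \<Omega> (closure \<Omega>)" for i
    using closed_domain.moderate_lincomb[OF ru rv(1), of "\<lambda>_. 1" "\<lambda>_. 1"] by simp
  have "?z i - ?w i = ?v i - (?w i - ?u i)" for i by (simp add: fun_eq_iff)
  then have "?z i - ?w i \<in> negligible_nets \<Omega> (closure \<Omega>)" for i using rv(2) by simp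
  from closed_domain.negligible_minus[OF this]
  have c: "(\<lambda>\<epsilon>. gfun 0 ?w ?v \<epsilon> - gfun 0 ?z ?v \<epsilon>) \<in> rt_negligible"
    by (intro variation_negligible[OF \<Omega> rep_L z rv(1) rw])
  note Fw = rep_rt_class[OF gfun_moderate[OF rw rv(1), of 0], folded gen_functional_eq]
    and Fu = rep_rt_class[OF gfun_moderate[OF ru rv(1), of 0], folded gen_functional_eq]
  show "(\<lambda>\<epsilon>. rep (gen_functional \<Omega> L w) \<epsilon> - rep (gen_functional \<Omega> L u) \<epsilon>) \<in> rt_moderate"
    by (intro rt_moderate_diff Fw Fu)
  have "(\<lambda>\<epsilon>. (rep (gen_functional \<Omega> L w) \<epsilon> - gfun 0 ?w ?v \<epsilon>)
      - (rep (gen_functional \<Omega> L u) \<epsilon> - gfun 0 ?u ?v \<epsilon>) + (gfun 0 ?w ?v \<epsilon> - gfun 0 ?z ?v \<epsilon>)) \<in> rt_negligible"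
    by (intro rt_negligible_add rt_negligible_diff c Fw(2) Fu(2))
  then show "(\<lambda>\<epsilon>. (rep (gen_functional \<Omega> L w) \<epsilon> - rep (gen_functional \<Omega> L u) \<epsilon>)
      - (gline 0 ?u ?v \<epsilon> 1 - gline 0 ?u ?v \<epsilon> 0)) \<in> rt_negligible"
    by (simp add: algebra_simps)
qed

text \<open>The increment of the functional is \<open>h\<^sub>\<epsilon>(1)\<close> up to a negligible net, with the convex function \<open>h\<^sub>\<epsilon>\<close>
  of \<open>almost_convex_taylor\<close>. Its sign gives the first claim; if it is negligible, so is \<open>h\<^sub>\<epsilon>\<close> on
  \<open>[0,1]\<close> with all derivatives, which gives the second.\<close>

lemma minimizer_of_variations:
  assumes u0: "\<And>i. u\<^sub>0 i \<in> gen_bd \<Omega>" and u: "u \<in> admissible \<Omega> u\<^sub>0"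
    and first: "\<And>v. v \<in> admissible_zero \<Omega> \<Longrightarrow> first_variation \<Omega> L u v = rt_zero"
    and second: "\<And>w v. w \<in> admissible \<Omega> u\<^sub>0 \<Longrightarrow> v \<in> admissible_zero \<Omega> \<Longrightarrow>
           rt_nonneg (second_variation \<Omega> L w v)"
    and w: "w \<in> admissible \<Omega> u\<^sub>0"
  defines "v \<equiv> \<lambda>i. gen_class \<Omega> (closure \<Omega>) (rep (w i) - rep (u i))"
  shows "rt_le (gen_functional \<Omega> L u) (gen_functional \<Omega> L w)"
    and "rt_le (gen_functional \<Omega> L w) (gen_functional \<Omega> L u) \<Longrightarrow>
       second_variation_line \<Omega> L u v = gen_zero {0<..<1} {0..1}"
proof -
  let ?u = "\<lambda>i. rep (u i)" and ?v = "\<lambda>i. rep (v i)"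
  let ?D = "\<lambda>\<epsilon>. rep (gen_functional \<Omega> L w) \<epsilon> - rep (gen_functional \<Omega> L u) \<epsilon>"
  let ?f = "\<lambda>k. gline k ?u ?v"
  have v: "v \<in> admissible_zero \<Omega>" unfolding v_def by (rule admissible_diff[OF \<Omega>(1) u w u0])
  have vg: "v i \<in> gen \<Omega> (closure \<Omega>)" for i using v unfolding admissible_zero_def by (rule admissible_gen)
  note ug = admissible_gen[OF u]
  note r = closed_domain.rep_gen(2)[OF ug] closed_domain.rep_gen(2)[OF vg]
  note chain = gline_chain[OF r]
  obtain n where n: "n \<in> rt_negligible"
    "\<And>\<epsilon> s. \<epsilon> \<in> {0<..1} \<Longrightarrow> s \<in> {0..1} \<Longrightarrow> - n \<epsilon> \<le> ?f 2 \<epsilon> s"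
    using second_variation_lower_bound[OF u0 u v second] v by blast
  have "gfun 1 ?u ?v \<in> rt_negligible"
    using first[OF v] variations_eq(1)[OF ug vg] by (intro rt_class_zeroD) simp
  then have f1: "(\<lambda>\<epsilon>. ?f 1 \<epsilon> 0) \<in> rt_negligible" by simp
  define d where "d = (\<lambda>\<epsilon>. ?D \<epsilon> - (?f 0 \<epsilon> 1 - ?f 0 \<epsilon> 0))"
  have d: "d \<in> rt_negligible"
    unfolding d_def v_def by (rule functional_increment(1)[OF u0 u w])
  define h where "h = (\<lambda>\<epsilon> s. ?f 0 \<epsilon> s - ?f 0 \<epsilon> 0 - ?f 1 \<epsilon> 0 * s + n \<epsilon> * s\<^sup>2 / 2)"
  have h: "0 \<le> h \<epsilon> s" "h \<epsilon> s \<le> h \<epsilon> 1" if "\<epsilon> \<in> {0<..1}" "s \<in> {0..1}" for \<epsilon> s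
    using almost_convex_taylor[OF derivative_chain.chain[OF chain[OF that(1)], of 0]
        derivative_chain.chain[OF chain[OF that(1)], of "Suc 0"], where n = "n \<epsilon>" and s = s] n(2) that
    by (auto simp: h_def numeral_2_eq_2)
  have D: "?D \<epsilon> = h \<epsilon> 1 + d \<epsilon> + ?f 1 \<epsilon> 0 - n \<epsilon> / 2" for \<epsilon> by (simp add: h_def d_def)
  have e: "(\<lambda>\<epsilon>. \<bar>d \<epsilon>\<bar> + \<bar>?f 1 \<epsilon> 0\<bar> + \<bar>n \<epsilon>\<bar>) \<in> rt_negligible"
    by (intro rt_negligible_add rt_negligible_abs d f1 n)
  show "rt_le (gen_functional \<Omega> L u) (gen_functional \<Omega> L w)"
    unfolding rt_le_def
  proof (rule rt_nonneg_classI[OF functional_increment(2)[OF u0 u w] e])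
    fix \<epsilon> :: real assume "0 < \<epsilon>" "\<epsilon> \<le> 1"
    then show "- (\<bar>d \<epsilon>\<bar> + \<bar>?f 1 \<epsilon> 0\<bar> + \<bar>n \<epsilon>\<bar>) \<le> ?D \<epsilon>"
      using h(1)[of \<epsilon> 1] unfolding D by auto
  qed
  assume "rt_le (gen_functional \<Omega> L w) (gen_functional \<Omega> L u)"
  then obtain m where m: "m \<in> rt_negligible" "\<And>\<epsilon>. 0 < \<epsilon> \<Longrightarrow> \<epsilon> \<le> 1 \<Longrightarrow>
      0 \<le> m \<epsilon> \<and> - m \<epsilon> \<le> rep (gen_functional \<Omega> L u) \<epsilon> - rep (gen_functional \<Omega> L w) \<epsilon>"
    unfolding rt_le_def by (rule rt_nonneg_classD) blast
  have "(\<lambda>\<epsilon>. m \<epsilon> + (\<bar>d \<epsilon>\<bar> + \<bar>?f 1 \<epsilon> 0\<bar> + \<bar>n \<epsilon>\<bar>)) \<in> rt_negligible"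
    by (rule rt_negligible_add[OF m(1) e])
  then have e': "negligible_on {()} (\<lambda>\<epsilon> _. m \<epsilon> + (\<bar>d \<epsilon>\<bar> + \<bar>?f 1 \<epsilon> 0\<bar> + \<bar>n \<epsilon>\<bar>))"
    by (simp add: rt_negligible_iff)
  have h0: "negligible_on {0..1} h"
  proof (rule negligible_on_mono[OF e'], rule eventually_mono[OF eventually_at_right_0_le[OF zero_less_one]],
      intro ballI bexI[of _ "()"])
    fix \<epsilon> s :: real assume \<epsilon>: "0 < \<epsilon> \<and> \<epsilon> \<le> 1" and s: "s \<in> {0..1}"
    have "h \<epsilon> 1 \<le> m \<epsilon> + (\<bar>d \<epsilon>\<bar> + \<bar>?f 1 \<epsilon> 0\<bar> + \<bar>n \<epsilon>\<bar>)"
      using D[of \<epsilon>] m(2)[of \<epsilon>] \<epsilon> by linarith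
    then show "\<bar>h \<epsilon> s\<bar> \<le> \<bar>m \<epsilon> + (\<bar>d \<epsilon>\<bar> + \<bar>?f 1 \<epsilon> 0\<bar> + \<bar>n \<epsilon>\<bar>)\<bar>"
      using h[of \<epsilon> s] \<epsilon> s by simp
  qed simp
  \<comment> \<open>The derivatives of \<open>h\<close>; from order \<open>3\<close> on they are those of \<open>f\<close>.\<close>
  define H where "H = (\<lambda>k \<epsilon> s. if k = 0 then h \<epsilon> s else if k = 1 then ?f 1 \<epsilon> s - ?f 1 \<epsilon> 0 + n \<epsilon> * s
     else if k = 2 then ?f 2 \<epsilon> s + n \<epsilon> else ?f k \<epsilon> s)"
  have "H 0 = h" by (simp add: H_def fun_eq_iff)
  with h0 have H0: "negligible_on {0..1} (H 0)" by metis
  have H_chain: "derivative_chain (\<lambda>k. H k \<epsilon>)" if "\<epsilon> \<in> {0<..1}" for \<epsilon>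
  proof
    fix k :: nat and s :: real
    note dk = derivative_chain.chain[OF chain[OF that]]
    have d0: "(?f 0 \<epsilon> has_real_derivative ?f 1 \<epsilon> s) (at s)"
      and d1: "(?f 1 \<epsilon> has_real_derivative ?f 2 \<epsilon> s) (at s)" for s
      using dk[where k = 0 and x = s] dk[where k = 1 and x = s] by (simp_all add: numeral_2_eq_2)
    consider "k = 0" | "k = 1" | "k = 2" | "3 \<le> k" by linarith
    then show "(H k \<epsilon> has_real_derivative H (Suc k) \<epsilon> s) (at s)"
    proof cases
      case 1
      then show ?thesis by (auto simp: H_def h_def intro!: derivative_eq_intros d0[unfolded One_nat_def])
    next
      case 2
      then show ?thesis by (auto simp: H_def intro!: derivative_eq_intros d1[unfolded One_nat_def])
    next
      case 3
      then show ?thesis using dk[where k = 2 and x = s] by (auto simp: H_def intro!: derivative_eq_intros)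
    next
      case 4
      then show ?thesis using dk[where k = k and x = s] by (simp add: H_def)
    qed
  qed
  have const: "negligible_on {0..1::real} (\<lambda>\<epsilon> _. x \<epsilon>)" if "x \<in> rt_negligible" for x
    using that unfolding rt_negligible_iff by (rule negligible_on_mono) auto
  have id: "moderate_on {0..1::real} (\<lambda>\<epsilon> s. s)" by (rule moderate_on_bounded[of _ _ 1]) auto
  have n': "moderate_on {0..1::real} (\<lambda>\<epsilon> _. n \<epsilon>)" by (rule negligible_imp_moderate_on[OF const[OF n(1)]])
  have f1': "moderate_on {0..1::real} (\<lambda>\<epsilon> _. - ?f 1 \<epsilon> 0)"
    by (rule negligible_imp_moderate_on[OF const[OF rt_negligible_minus[OF f1]]])
  have fk: "moderate_on {0..1} (?f k)" for k by (rule gline_moderate_on[OF r]) simp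
  have H_moderate: "moderate_on {0..1} (H k)" for k
  proof -
    have "moderate_on {0..1} (\<lambda>\<epsilon> s. ?f 1 \<epsilon> s + - ?f 1 \<epsilon> 0 + n \<epsilon> * s)"
      by (intro moderate_on_add moderate_on_mult fk f1' n' id)
    moreover have "moderate_on {0..1} (\<lambda>\<epsilon> s. ?f 2 \<epsilon> s + n \<epsilon>)"
      by (intro moderate_on_add fk n')
    ultimately show ?thesis
      using negligible_imp_moderate_on[OF h0] fk[of k]
      by (cases "k = 0"; cases "k = 1"; cases "k = 2") (simp_all add: H_def)
  qed
  have Hk: "negligible_on {0..1} (H k)" for k
    by (rule negligible_on_all_derivatives[OF H_chain H_moderate H0])
  have "negligible_on {0..1} (?f k)" if "2 \<le> k" for k
  proof (cases "k = 2")
    case True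
    have "negligible_on {0..1} (\<lambda>\<epsilon> s. H 2 \<epsilon> s + - n \<epsilon>)"
      by (intro negligible_on_add Hk const rt_negligible_minus n)
    then show ?thesis using True by (simp add: H_def)
  next
    case False
    then show ?thesis using Hk[of k] that by (simp add: H_def)
  qed
  then show "second_variation_line \<Omega> L u v = gen_zero {0<..<1} {0..1}"
    by (rule second_variation_line_zero[OF ug vg])
qed

end

theorem proposition3p6:
  fixes \<Omega> :: "(real ^ 'p::finite) set"
    and L :: "(real \<Rightarrow> ('p, 'q::finite, 'n::finite) jet_space \<Rightarrow> real) set"
    and u\<^sub>0 u :: "'q \<Rightarrow> (real \<Rightarrow> real ^ 'p \<Rightarrow> real) set"
  assumes "open \<Omega>" and "connected \<Omega>" and "bounded \<Omega>" and "smooth_boundary \<Omega>"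
    and "L \<in> gen_temp \<Omega>"
    and "\<And>i. u\<^sub>0 i \<in> gen_bd \<Omega>"
    and "u \<in> admissible \<Omega> u\<^sub>0"
    and "\<And>v. v \<in> admissible_zero \<Omega> \<Longrightarrow> first_variation \<Omega> L u v = rt_zero"
    and "\<And>w v. w \<in> admissible \<Omega> u\<^sub>0 \<Longrightarrow> v \<in> admissible_zero \<Omega> \<Longrightarrow>
           rt_nonneg (second_variation \<Omega> L w v)"
  shows "is_minimizer \<Omega> L u\<^sub>0 u \<and>
    ((\<forall>v\<in>admissible_zero \<Omega>. v \<noteq> (\<lambda>i. gen_zero \<Omega> (closure \<Omega>)) \<longrightarrow>
        second_variation_line \<Omega> L u v \<noteq> gen_zero {0<..<1} {0..1}) \<longrightarrow>
     (\<forall>w. is_minimizer \<Omega> L u\<^sub>0 w \<longrightarrow> w = u))"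
proof (intro conjI impI allI)
  interpret generalized_functional \<Omega> L
    using assms(1,3,5) by unfold_locales
  have min: "rt_le (gen_functional \<Omega> L u) (gen_functional \<Omega> L w)"
    "rt_le (gen_functional \<Omega> L w) (gen_functional \<Omega> L u) \<Longrightarrow>
       second_variation_line \<Omega> L u (\<lambda>i. gen_class \<Omega> (closure \<Omega>) (rep (w i) - rep (u i)))
         = gen_zero {0<..<1} {0..1}"
    if w: "w \<in> admissible \<Omega> u\<^sub>0" for w
    by (rule minimizer_of_variations[where u\<^sub>0 = u\<^sub>0]; (fact assms w | simp add: assms w))+
  show "is_minimizer \<Omega> L u\<^sub>0 u"
    unfolding is_minimizer_def using assms(7) min(1) by blast
  fix w
  assume strict: "\<forall>v\<in>admissible_zero \<Omega>. v \<noteq> (\<lambda>i. gen_zero \<Omega> (closure \<Omega>)) \<longrightarrow>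
        second_variation_line \<Omega> L u v \<noteq> gen_zero {0<..<1} {0..1}"
    and "is_minimizer \<Omega> L u\<^sub>0 w"
  then have w: "w \<in> admissible \<Omega> u\<^sub>0" "rt_le (gen_functional \<Omega> L w) (gen_functional \<Omega> L u)"
    using assms(7) by (auto simp: is_minimizer_def)
  let ?v = "\<lambda>i. gen_class \<Omega> (closure \<Omega>) (rep (w i) - rep (u i))"
  have "?v = (\<lambda>i. gen_zero \<Omega> (closure \<Omega>))"
    using strict min(2)[OF w] admissible_diff[OF assms(1,7) w(1) assms(6)] by blast
  show "w = u"
  proof
    fix i
    note wi = closed_domain.rep_gen[OF admissible_gen[OF w(1)], of i]
      and ui = closed_domain.rep_gen[OF admissible_gen[OF assms(7)], of i]
    have "gen_class \<Omega> (closure \<Omega>) (rep (w i) - rep (u i)) = gen_class \<Omega> (closure \<Omega>) (\<lambda>\<epsilon> x. 0)"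
      using fun_cong[OF \<open>?v = _\<close>, of i] by (simp add: gen_zero_def)
    then have "rep (w i) - rep (u i) - (\<lambda>\<epsilon> x. 0) \<in> negligible_nets \<Omega> (closure \<Omega>)"
      using closed_domain.gen_class_eq_iff[OF closed_domain.moderate_diff[OF wi(2) ui(2)]
          closed_domain.zero_moderate] by blast
    then have "rep (w i) - rep (u i) \<in> negligible_nets \<Omega> (closure \<Omega>)" by (simp add: fun_diff_def)
    then show "w i = u i"
      using closed_domain.gen_class_eq_iff[OF wi(2) ui(2)] wi(3) ui(3) by simp
  qed
qed

end
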